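(* Let $m$ be a non-zero algebraic number. Suppose that $f$ and $T$ are polynomials over $\overline{\mathbb{Q}}$ of the same degree such that $f\equiv T\mod m$. If $\alpha\in\overline{\mathbb{Q}}$ satisfies $f(\alpha)=0$ and $T(\alpha)\neq 0$, then $$\deg T\cdot h(\alpha)\geq N(m)-\nu_\infty(T).$$
   Context: For a number field $K$ and a place $v$ of $K$ dividing the place $p$ of $\mathbb{Q}$ (with $p$ a prime or $\infty$), let $K_v$ and $\mathbb{Q}_p$ be the completions ($\mathbb{Q}_\infty=\mathbb{R}$), let $\|\cdot\|_v$ be the unique absolute value on $K_v$ extending the $p$-adic (for $p=\infty$, the usual) absolute value on $\mathbb{Q}_p$, and set $|\cdot|_v=\|\cdot\|_v^{[K_v:\mathbb{Q}_p]/[K:\mathbb{Q}]}$. Let $\Omega_v$ be the completion of an algebraic closure of $K_v$, with $|\cdot|_v$ extended to $\Omega_v$. Write $\log^+ t=\max\{0,\log t\}$ and $\log 0=-\infty$. The logarithmic Weil height of $\alpha\in K$ is $h(\alpha)=\sum_v\log^+|\alpha|_v$, the sum over all places $v$ of $K$. For $T\in\Omega_v[x]$ let $\nu_v(T)=\log\sup\{|T(z)|_v: z\in\Omega_v,\ |z|_v=1\}$. For $T\in K[x]$ let $\nu_\infty(T)=\sum_{v\mid\infty}\nu_v(T)$, the sum over Archimedean places of $K$. For $f,T\in K[x]$ and $m\in K$, $f\equiv T\mod m$ means $\nu_v(T-f)\leq\log|m|_v$ for all non-Archimedean places $v$ of $K$. For $m\in K$ non-zero, $N(m)=\sum_{v\mid\infty}\log|m|_v=-\sum_{v\nmid\infty}\log|m|_v$.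 None of these notions depends on the number field $K$ containing the relevant numbers and coefficients. *)

theory Defs
  imports
    "HOL-Analysis.Infinite_Sum"
    "HOL-Library.Extended_Real"
    "HOL-Algebra.Algebraic_Closure_Type"
begin

text \<open>
  Number fields are subfields of the complex numbers, so that the elements of all number fields
  (the algebraic numbers) live in one type. Completions and algebraic closures depend on the
  place, so they are handled as carrier-based rings of HOL-Algebra.
\<close>

abbreviation complex_ring :: "complex ring" where
  "complex_ring \<equiv> ring_of_type_algebra"

definition number_field :: "complex set \<Rightarrow> bool" where
  "number_field K \<longleftrightarrow> subfield K complex_ring \<and> ring.finite_dimension complex_ring \<rat> K"

definition nf_degree :: "complex set \<Rightarrow> nat" where
  "nf_degree K = ring.dim complex_ring \<rat> K"

definition nf_ring :: "complex set \<Rightarrow> complex ring" where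
  "nf_ring K = complex_ring\<lparr>carrier := K\<rparr>"


subsection \<open>Absolute values, completion, algebraic closure\<close>

definition absolute_value :: "('a, 'b) ring_scheme \<Rightarrow> ('a \<Rightarrow> real) \<Rightarrow> bool" where
  "absolute_value R v \<longleftrightarrow>
     (\<forall>x\<in>carrier R. 0 \<le> v x) \<and>
     (\<forall>x\<in>carrier R. v x = 0 \<longleftrightarrow> x = \<zero>\<^bsub>R\<^esub>) \<and>
     (\<forall>x\<in>carrier R. \<forall>y\<in>carrier R. v (x \<otimes>\<^bsub>R\<^esub> y) = v x * v y) \<and>
     (\<forall>x\<in>carrier R. \<forall>y\<in>carrier R. v (x \<oplus>\<^bsub>R\<^esub> y) \<le> v x + v y)"

definition Cauchy_seqs :: "('a, 'b) ring_scheme \<Rightarrow> ('a \<Rightarrow> real) \<Rightarrow> (nat \<Rightarrow> 'a) set" where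
  "Cauchy_seqs R v =
     {s. (\<forall>n. s n \<in> carrier R) \<and> (\<forall>e>0. \<exists>N. \<forall>i\<ge>N. \<forall>j\<ge>N. v (s i \<ominus>\<^bsub>R\<^esub> s j) < e)}"

definition null_seqs :: "('a, 'b) ring_scheme \<Rightarrow> ('a \<Rightarrow> real) \<Rightarrow> (nat \<Rightarrow> 'a) set" where
  "null_seqs R v = {s. (\<forall>n. s n \<in> carrier R) \<and> (\<lambda>n. v (s n)) \<longlonglongrightarrow> 0}"

definition Cauchy_ring :: "('a, 'b) ring_scheme \<Rightarrow> ('a \<Rightarrow> real) \<Rightarrow> (nat \<Rightarrow> 'a) ring" where
  "Cauchy_ring R v =
     \<lparr>carrier = Cauchy_seqs R v,
      monoid.mult = (\<lambda>s t n. s n \<otimes>\<^bsub>R\<^esub> t n), one = (\<lambda>_. \<one>\<^bsub>R\<^esub>),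
      ring.zero = (\<lambda>_. \<zero>\<^bsub>R\<^esub>), add = (\<lambda>s t n. s n \<oplus>\<^bsub>R\<^esub> t n)\<rparr>"

definition completion :: "('a, 'b) ring_scheme \<Rightarrow> ('a \<Rightarrow> real) \<Rightarrow> (nat \<Rightarrow> 'a) set ring" where
  "completion R v = Cauchy_ring R v Quot null_seqs R v"

definition completion_abs ::
    "('a, 'b) ring_scheme \<Rightarrow> ('a \<Rightarrow> real) \<Rightarrow> (nat \<Rightarrow> 'a) set \<Rightarrow> real" where
  "completion_abs R v c = lim (\<lambda>n. v ((SOME s. s \<in> c) n))"

definition completion_embed ::
    "('a, 'b) ring_scheme \<Rightarrow> ('a \<Rightarrow> real) \<Rightarrow> 'a \<Rightarrow> (nat \<Rightarrow> 'a) set" where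
  "completion_embed R v x = null_seqs R v +>\<^bsub>Cauchy_ring R v\<^esub> (\<lambda>_. x)"

text \<open>
  The extension of the absolute value of a complete field \<open>R\<close> to its algebraic closure.
  It is unique, so the choice below is immaterial. \<open>ring.indexed_const R\<close> is the library's
  embedding of \<open>R\<close> into \<open>field.alg_closure R\<close>.
\<close>

definition alg_closure_abs ::
    "('a, 'b) ring_scheme \<Rightarrow> ('a \<Rightarrow> real) \<Rightarrow> (('a list \<times> nat) multiset \<Rightarrow> 'a) \<Rightarrow> real" where
  "alg_closure_abs R v =
     (SOME w. absolute_value (field.alg_closure R) w \<and>
              (\<forall>x\<in>carrier R. w (ring.indexed_const R x) = v x))"


subsection \<open>Places\<close>

definition padic_abs :: "nat \<Rightarrow> rat \<Rightarrow> real" where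
  "padic_abs p q = (if q = 0 then 0 else
     real p powi (int (multiplicity (int p) (snd (quotient_of q)))
                - int (multiplicity (int p) (fst (quotient_of q)))))"

text \<open>
  A place of \<open>K\<close> dividing \<open>p\<close> is represented by its unique absolute value that restricts
  to the \<open>p\<close>-adic (or the usual) absolute value on \<open>\<rat>\<close>. Membership in \<^term>\<open>extensional K\<close> only
  fixes the values outside \<open>K\<close>, so that different elements are different places.
\<close>

definition infinite_places :: "complex set \<Rightarrow> (complex \<Rightarrow> real) set" where
  "infinite_places K = {v \<in> extensional K. absolute_value (nf_ring K) v \<and>
     (\<forall>q::rat. v (of_rat q) = \<bar>of_rat q\<bar>)}"

definition finite_places :: "complex set \<Rightarrow> (complex \<Rightarrow> real) set" where
  "finite_places K = {v \<in> extensional K. absolute_value (nf_ring K) v \<and>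
     (\<exists>p::nat. Factorial_Ring.prime p \<and> (\<forall>q::rat. v (of_rat q) = padic_abs p q))}"

definition places :: "complex set \<Rightarrow> (complex \<Rightarrow> real) set" where
  "places K = infinite_places K \<union> finite_places K"

definition loc_field :: "complex set \<Rightarrow> (complex \<Rightarrow> real) \<Rightarrow> (nat \<Rightarrow> complex) set ring" where
  "loc_field K v = completion (nf_ring K) v"

definition loc_field_abs ::
    "complex set \<Rightarrow> (complex \<Rightarrow> real) \<Rightarrow> (nat \<Rightarrow> complex) set \<Rightarrow> real" where
  "loc_field_abs K v = completion_abs (nf_ring K) v"

text \<open>
  The classes of the Cauchy sequences of rationals form the image in \<open>K\<^sub>v\<close> of the completion
  of \<open>\<rat>\<close> at the place below \<open>v\<close>.
\<close>

definition loc_base :: "complex set \<Rightarrow> (complex \<Rightarrow> real) \<Rightarrow> (nat \<Rightarrow> complex) set set" where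
  "loc_base K v = {c \<in> carrier (loc_field K v). \<exists>s\<in>c. \<forall>n. s n \<in> \<rat>}"

definition loc_degree :: "complex set \<Rightarrow> (complex \<Rightarrow> real) \<Rightarrow> nat" where
  "loc_degree K v = ring.dim (loc_field K v) (loc_base K v) (carrier (loc_field K v))"

definition weight :: "complex set \<Rightarrow> (complex \<Rightarrow> real) \<Rightarrow> real" where
  "weight K v = real (loc_degree K v) / real (nf_degree K)"

text \<open>\<open>|x|\<^sub>v\<close> for \<open>x \<in> K\<close>; the unnormalised \<open>\<parallel>x\<parallel>\<^sub>v\<close> is \<open>v x\<close>.\<close>

definition norm_at :: "complex set \<Rightarrow> (complex \<Rightarrow> real) \<Rightarrow> complex \<Rightarrow> real" where
  "norm_at K v x = v x powr weight K v"


subsection \<open>The field \<open>\<Omega>\<^sub>v\<close>\<close>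

definition Omega where
  "Omega K v = completion (field.alg_closure (loc_field K v))
                 (alg_closure_abs (loc_field K v) (loc_field_abs K v))"

definition Omega_embed where
  "Omega_embed K v x =
     completion_embed (field.alg_closure (loc_field K v))
       (alg_closure_abs (loc_field K v) (loc_field_abs K v))
       (ring.indexed_const (loc_field K v) (completion_embed (nf_ring K) v x))"

definition Omega_norm where
  "Omega_norm K v z =
     completion_abs (field.alg_closure (loc_field K v))
       (alg_closure_abs (loc_field K v) (loc_field_abs K v)) z powr weight K v"

definition Omega_poly where
  "Omega_poly K v T z =
     (\<Oplus>\<^bsub>Omega K v\<^esub> i\<in>{..Polynomial.degree T}.
        Omega_embed K v (poly.coeff T i) \<otimes>\<^bsub>Omega K v\<^esub> (z [^]\<^bsub>Omega K v\<^esub> i))"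


subsection \<open>Heights, congruence, norm\<close>

definition elog :: "real \<Rightarrow> ereal" where
  "elog t = (if t = 0 then -\<infinity> else ereal (ln t))"

definition nu :: "complex set \<Rightarrow> (complex \<Rightarrow> real) \<Rightarrow> complex poly \<Rightarrow> ereal" where
  "nu K v T = elog (Sup {Omega_norm K v (Omega_poly K v T z) |z.
                           z \<in> carrier (Omega K v) \<and> Omega_norm K v z = 1})"

definition nu_infinity :: "complex set \<Rightarrow> complex poly \<Rightarrow> ereal" where
  "nu_infinity K T = (\<Sum>v\<in>infinite_places K. nu K v T)"

definition poly_cong :: "complex set \<Rightarrow> complex poly \<Rightarrow> complex poly \<Rightarrow> complex \<Rightarrow> bool" where
  "poly_cong K f T m \<longleftrightarrow> (\<forall>v\<in>finite_places K. nu K v (T - f) \<le> elog (norm_at K v m))"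

text \<open>
  In the following, \<^term>\<open>ln (0::real) = 0\<close>, hence the summand is 0 for \<open>\<alpha> = 0\<close>, as it should be.
  All but finitely many summands vanish.
\<close>

definition weil_height :: "complex set \<Rightarrow> complex \<Rightarrow> real" where
  "weil_height K \<alpha> = (\<Sum>\<^sub>\<infinity>v\<in>places K. max 0 (ln (norm_at K v \<alpha>)))"

definition log_norm :: "complex set \<Rightarrow> complex \<Rightarrow> real" where
  "log_norm K m = (\<Sum>v\<in>infinite_places K. ln (norm_at K v m))"

end

theory Submission
  imports Defs "Jordan_Normal_Form.Char_Poly"
begin

text \<open>
  Write \<open>\<beta> = T(\<alpha>) = (T - f)(\<alpha>) \<noteq> 0\<close> and \<open>d = deg T\<close>. If \<open>S\<^sub>v(P)\<close> is the supremum of \<open>|P|\<^sub>v\<close> on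
  the unit circle of \<open>\<Omega>\<^sub>v\<close>, then \<open>|P(\<alpha>)|\<^sub>v \<le> S\<^sub>v(P) max(1, |\<alpha>|\<^sub>v) ^ deg P\<close> by the maximum principle.
  At the finite places use this for \<open>P = T - f\<close>, where \<open>S\<^sub>v(P) \<le> |m|\<^sub>v\<close>, and at the infinite places
  for \<open>P = T\<close>. Taking logarithms and summing over all places, the contributions of \<open>\<beta>\<close> cancel and those of
  \<open>m\<close> give \<open>-N(m)\<close>, both by the product formula.

  The maximum principle is proved in the same way at all places: averaging over square (or cube) roots of unity
  bounds the coefficients of a polynomial by its values on the unit circle, up to a factor linear in the degree,
  provided that \<open>|2|\<^sub>v \<ge> 1\<close> (or \<open>|3|\<^sub>v \<ge> 1\<close>), and the factor disappears when the bound is applied to high powers.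

  For the product formula, fix an absolute value \<open>w\<close> of the algebraic numbers above a place of \<open>\<rat>\<close>.
  By weak approximation, every place \<open>v\<close> of \<open>K\<close> above it is \<open>w\<close> composed with an embedding of \<open>K\<close>, and the
  number of these embeddings is the local degree, so \<open>\<Sum>\<^sub>v [K\<^sub>v : \<rat>\<^sub>p] log \<parallel>x\<parallel>\<^sub>v\<close> is the logarithm of the absolute
  value of the norm of \<open>x\<close>, and the product formula over \<open>\<rat>\<close> applies.
\<close>

subsection \<open>Extending absolute values to algebraic extensions\<close>

text \<open>Two absolute values have to be shown to exist: the one that
  \<open>alg_closure_abs\<close> merely chooses on the algebraic closure of
  \<open>loc_field K v\<close>, and the one on the algebraic numbers above a prime. Both are
  extensions along an algebraic extension, and one argument yields them without completeness and
  without separating Archimedean from ultrametric: a maximal consistent system of upper bounds is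
  shown to come from an absolute value. The supremum in \<open>nu\<close> runs over
  \<open>Omega K v\<close>, whereas roots are extracted in the algebraic closure of
  \<open>loc_field K v\<close>, whose unit circle embeds into the one of \<open>Omega K v\<close>.
  One of |2| and |3| is always at least 1: |2| = 2 at an infinite place, and 1 = 3 - 2 at an
  ultrametric one. The conjugates are complex numbers, the same for every prime. Hence the product
  of the conjugates of \<open>x\<close> is a single rational number, and the local identities at all
  primes speak about it. In the formula for the local degree, independence of the powers of the
  generator comes from interpolation at the conjugates that induce the place, and generation comes
  from weak approximation.\<close>

locale value_extension = field L for L (structure) +
  fixes F :: "'a set" and v :: "'a \<Rightarrow> real"
  assumes F: "subfield F L"
    and v: "absolute_value (L\<lparr>carrier := F\<rparr>) v"
    and alg: "\<And>x. x \<in> carrier L \<Longrightarrow> (algebraic over F) x"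
begin

lemma v_nonneg: "c \<in> F \<Longrightarrow> 0 \<le> v c"
  and v_eq_0: "c \<in> F \<Longrightarrow> v c = 0 \<longleftrightarrow> c = \<zero>"
  and v_mult: "c \<in> F \<Longrightarrow> d \<in> F \<Longrightarrow> v (c \<otimes> d) = v c * v d"
  using v by (auto simp: absolute_value_def)

lemma F_carrier: "c \<in> F \<Longrightarrow> c \<in> carrier L"
  using subfieldE(3)[OF F] by blast

lemma F_closed: "\<zero> \<in> F" "\<one> \<in> F" "c \<in> F \<Longrightarrow> \<ominus> c \<in> F" "c \<in> F \<Longrightarrow> c \<noteq> \<zero> \<Longrightarrow> inv c \<in> F"
  "c \<in> F \<Longrightarrow> d \<in> F \<Longrightarrow> c \<otimes> d \<in> F"
  using subringE[OF subfieldE(1)[OF F]] subfield_m_inv(1)[OF F] by auto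

lemma v_one: "v \<one> = 1"
  using v_mult[OF F_closed(2,2)] v_eq_0[OF F_closed(2)] by auto

lemma v_inv: "c \<in> F \<Longrightarrow> c \<noteq> \<zero> \<Longrightarrow> v (inv c) = 1 / v c"
proof -
  assume c: "c \<in> F" "c \<noteq> \<zero>"
  have "v c * v (inv c) = v (c \<otimes> inv c)" using c F_closed v_mult by simp
  also have "c \<otimes> inv c = \<one>" using c F_carrier field_Units by (intro Units_r_inv) auto
  finally have "v c * v (inv c) = 1" using v_one by simp
  thus ?thesis using v_eq_0[OF c(1)] c(2) by (auto simp: field_simps)
qed

lemma v_minus_one: "v (\<ominus> \<one>) = 1"
proof -
  have "v (\<ominus> \<one>) * v (\<ominus> \<one>) = v (\<ominus> \<one> \<otimes> \<ominus> \<one>)" using v_mult F_closed by simp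
  also have "\<ominus> \<one> \<otimes> \<ominus> \<one> = \<one>" by algebra
  finally have "v (\<ominus> \<one>) ^ 2 = 1" using v_one by (simp add: power2_eq_square)
  thus ?thesis using v_nonneg[of "\<ominus> \<one>"] F_closed by (auto simp: power2_eq_1_iff)
qed

text \<open>
  A pair \<open>(x, r)\<close> is read as the condition \<open>w x \<le> r\<close> on an extension \<open>w\<close> of \<open>v\<close>. The last clause says that
  the conditions are not contradictory, and a maximal admissible set determines \<open>w\<close> as an infimum.
\<close>

definition admissible :: "('a \<times> real) set \<Rightarrow> bool" where
  "admissible G \<longleftrightarrow> G \<subseteq> carrier L \<times> {0..} \<and> (\<forall>c\<in>F. (c, v c) \<in> G) \<and>
     (\<forall>x r y s. (x, r) \<in> G \<longrightarrow> (y, s) \<in> G \<longrightarrow> (x \<oplus> y, r + s) \<in> G \<and> (x \<otimes> y, r * s) \<in> G) \<and>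
     (\<forall>r. (\<one>, r) \<in> G \<longrightarrow> 1 \<le> r)"

text \<open>
  The bounds on polynomials of degree less than \<open>n\<close> in \<open>x\<close> that follow from \<open>G\<close> and \<open>w x \<le> r\<close>.
\<close>

primrec pexp :: "('a \<times> real) set \<Rightarrow> 'a \<Rightarrow> real \<Rightarrow> nat \<Rightarrow> ('a \<times> real) set" where
  "pexp G x r 0 = {(\<zero>, 0)}"
| "pexp G x r (Suc n) =
     {(z \<oplus> b \<otimes> x [^] n, t + u * r ^ n) | z t b u. (z, t) \<in> pexp G x r n \<and> (b, u) \<in> G}"

context
  fixes G assumes G: "admissible G"
begin

lemma G_carrier: "(x, r) \<in> G \<Longrightarrow> x \<in> carrier L" "(x, r) \<in> G \<Longrightarrow> 0 \<le> r"
  and G_F: "c \<in> F \<Longrightarrow> (c, v c) \<in> G"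
  and G_add: "(x, r) \<in> G \<Longrightarrow> (y, s) \<in> G \<Longrightarrow> (x \<oplus> y, r + s) \<in> G"
  and G_mult: "(x, r) \<in> G \<Longrightarrow> (y, s) \<in> G \<Longrightarrow> (x \<otimes> y, r * s) \<in> G"
  and G_one_ge: "(\<one>, r) \<in> G \<Longrightarrow> 1 \<le> r"
  using G unfolding admissible_def by auto

lemma G_zero: "(\<zero>, 0) \<in> G" using G_F[OF F_closed(1)] v_eq_0[OF F_closed(1)] by simp
lemma G_one: "(\<one>, 1) \<in> G" using G_F[OF F_closed(2)] v_one by simp
lemma G_minus_one: "(\<ominus> \<one>, 1) \<in> G" using G_F[OF F_closed(3)[OF F_closed(2)]] v_minus_one by simp

lemma G_minus: "(x, r) \<in> G \<Longrightarrow> (\<ominus> x, r) \<in> G"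
  using G_mult[OF G_minus_one, of x r] G_carrier(1)[of x r] by (simp add: l_minus)

lemma G_pow: "(x, r) \<in> G \<Longrightarrow> (x [^] (k::nat), r ^ k) \<in> G"
  by (induction k) (auto simp: G_one dest: G_mult simp: mult.commute)

context
  fixes x r assumes x: "x \<in> carrier L" and r: "(0::real) \<le> r"
begin

lemma pexp_SucE:
  assumes "(z, t) \<in> pexp G x r (Suc n)"
  obtains y s b u where "(y, s) \<in> pexp G x r n" "(b, u) \<in> G" "z = y \<oplus> b \<otimes> x [^] n" "t = s + u * r ^ n"
  using assms by auto

lemma pexp_carrier: "(z, t) \<in> pexp G x r n \<Longrightarrow> z \<in> carrier L \<and> 0 \<le> t"
proof (induction n arbitrary: z t)
  case (Suc n)
  from Suc.prems obtain y s b u where *: "(y, s) \<in> pexp G x r n" "(b, u) \<in> G" "z = y \<oplus> b \<otimes> x [^] n" "t = s + u * r ^ n"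
    by (rule pexp_SucE)
  have "0 \<le> s" "y \<in> carrier L" using Suc.IH[OF *(1)] by auto
  thus ?case using G_carrier[OF *(2)] r x unfolding * by simp
qed simp

lemma pexp_SucI: "(z, t) \<in> pexp G x r n \<Longrightarrow> (b, u) \<in> G \<Longrightarrow> (z \<oplus> b \<otimes> x [^] n, t + u * r ^ n) \<in> pexp G x r (Suc n)"
  by auto

lemma pexp_Suc: "(z, t) \<in> pexp G x r n \<Longrightarrow> (z, t) \<in> pexp G x r (Suc n)"
  using pexp_SucI[OF _ G_zero, of z t n] pexp_carrier[of z t n] x by simp

declare pexp.simps(2) [simp del]

lemma pexp_mono: assumes "(z, t) \<in> pexp G x r n" "n \<le> m" shows "(z, t) \<in> pexp G x r m"
  using assms(2,1) by (induction m rule: dec_induct) (auto intro: pexp_Suc)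

lemma pexp_zero: "(\<zero>, 0) \<in> pexp G x r n"
  by (rule pexp_mono[of _ _ 0]) auto

lemma pexp_monom: "(b, u) \<in> G \<Longrightarrow> k < n \<Longrightarrow> (b \<otimes> x [^] k, u * r ^ k) \<in> pexp G x r n"
  using pexp_mono[OF pexp_SucI[OF pexp_zero, of b u k], of n] G_carrier(1)[of b u] x by simp

lemma pexp_const: "(b, u) \<in> G \<Longrightarrow> 0 < n \<Longrightarrow> (b, u) \<in> pexp G x r n"
  using pexp_monom[of b u 0 n] G_carrier(1)[of b u] by simp

lemma pexp_add:
  "(z, t) \<in> pexp G x r n \<Longrightarrow> (z', t') \<in> pexp G x r n \<Longrightarrow> (z \<oplus> z', t + t') \<in> pexp G x r n"
proof (induction n arbitrary: z t z' t')
  case (Suc n)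
  from Suc.prems(1) obtain y s b u where *: "(y, s) \<in> pexp G x r n" "(b, u) \<in> G" "z = y \<oplus> b \<otimes> x [^] n" "t = s + u * r ^ n" by (rule pexp_SucE)
  from Suc.prems(2) obtain y' s' b' u' where **: "(y', s') \<in> pexp G x r n" "(b', u') \<in> G" "z' = y' \<oplus> b' \<otimes> x [^] n" "t' = s' + u' * r ^ n" by (rule pexp_SucE)
  note * = * **
  have c: "y \<in> carrier L" "y' \<in> carrier L" "b \<in> carrier L" "b' \<in> carrier L" "x [^] n \<in> carrier L"
    using * pexp_carrier G_carrier x by auto
  have "z \<oplus> z' = (y \<oplus> y') \<oplus> (b \<oplus> b') \<otimes> x [^] n" unfolding * using c by algebra
  moreover have "t + t' = (s + s') + (u + u') * r ^ n" unfolding * by (simp add: algebra_simps)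
  ultimately show ?case using pexp_SucI[OF Suc.IH[OF *(1,5)] G_add[OF *(2,6)]] by simp
qed simp

lemma pexp_smult: "(c, s) \<in> G \<Longrightarrow> (z, t) \<in> pexp G x r n \<Longrightarrow> (c \<otimes> z, s * t) \<in> pexp G x r n"
proof (induction n arbitrary: z t)
  case 0 thus ?case using G_carrier(1) by auto
next
  case (Suc n)
  from Suc.prems(2) obtain y s' b u where *: "(y, s') \<in> pexp G x r n" "(b, u) \<in> G" "z = y \<oplus> b \<otimes> x [^] n" "t = s' + u * r ^ n" by (rule pexp_SucE)
  have c: "y \<in> carrier L" "b \<in> carrier L" "x [^] n \<in> carrier L" "c \<in> carrier L"
    using * pexp_carrier G_carrier x Suc.prems by auto
  have "c \<otimes> z = c \<otimes> y \<oplus> (c \<otimes> b) \<otimes> x [^] n" unfolding * using c by algebra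
  moreover have "s * t = s * s' + (s * u) * r ^ n" unfolding * by (simp add: algebra_simps)
  ultimately show ?case using pexp_SucI[OF Suc.IH[OF Suc.prems(1) *(1)] G_mult[OF Suc.prems(1) *(2)]] by simp
qed

lemma pexp_shift: "(z, t) \<in> pexp G x r n \<Longrightarrow> (x \<otimes> z, r * t) \<in> pexp G x r (Suc n)"
proof (induction n arbitrary: z t)
  case 0 thus ?case using pexp_Suc[OF pexp_zero[of 0]] x by auto
next
  case (Suc n)
  from Suc.prems(1) obtain y s b u where *: "(y, s) \<in> pexp G x r n" "(b, u) \<in> G" "z = y \<oplus> b \<otimes> x [^] n" "t = s + u * r ^ n" by (rule pexp_SucE)
  have c: "y \<in> carrier L" "b \<in> carrier L" "x [^] n \<in> carrier L"
    using * pexp_carrier G_carrier x by auto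
  have "x \<otimes> z = x \<otimes> y \<oplus> b \<otimes> (x [^] n \<otimes> x)" unfolding * using c x by algebra
  moreover have "r * t = r * s + u * r ^ Suc n" unfolding * by (simp add: algebra_simps)
  ultimately show ?case using pexp_SucI[OF Suc.IH[OF *(1)] *(2)] by simp
qed

lemma pexp_shift_pow: "(z, t) \<in> pexp G x r n \<Longrightarrow> (x [^] k \<otimes> z, r ^ k * t) \<in> pexp G x r (n + k)"
proof (induction k)
  case (Suc k)
  have "x \<otimes> (x [^] k \<otimes> z) = x [^] Suc k \<otimes> z"
    using pexp_carrier[OF Suc.prems] x by (simp add: m_ac)
  thus ?case using pexp_shift[OF Suc.IH[OF Suc.prems]] by (simp add: mult.assoc)
qed (use pexp_carrier in auto)

lemma pexp_mult:
  "(z, t) \<in> pexp G x r n \<Longrightarrow> (w, s) \<in> pexp G x r m \<Longrightarrow> (z \<otimes> w, t * s) \<in> pexp G x r (n + m)"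
proof (induction m arbitrary: w s)
  case 0 thus ?case using pexp_zero[of n] pexp_carrier[of z t n] by auto
next
  case (Suc m)
  from Suc.prems(2) obtain y s' b u where *: "(y, s') \<in> pexp G x r m" "(b, u) \<in> G" "w = y \<oplus> b \<otimes> x [^] m" "s = s' + u * r ^ m" by (rule pexp_SucE)
  have c: "y \<in> carrier L" "b \<in> carrier L" "x [^] m \<in> carrier L" "z \<in> carrier L"
    using * pexp_carrier G_carrier x Suc.prems by auto
  have "z \<otimes> w = z \<otimes> y \<oplus> b \<otimes> (x [^] m \<otimes> z)" unfolding * using c by algebra
  moreover have "t * s = t * s' + u * (r ^ m * t)" unfolding * by (simp add: algebra_simps)
  moreover have "(z \<otimes> y, t * s') \<in> pexp G x r (n + Suc m)" using pexp_mono[OF Suc.IH[OF Suc.prems(1) *(1)]] by simp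
  moreover have "(b \<otimes> (x [^] m \<otimes> z), u * (r ^ m * t)) \<in> pexp G x r (n + Suc m)"
    using pexp_mono[OF pexp_smult[OF *(2) pexp_shift_pow[OF Suc.prems(1), of m]]] by simp
  ultimately show ?case using pexp_add by simp
qed

text \<open>The union of all \<open>pexp G x r n\<close> is the closure of \<open>G\<close> and the
  new pair under sums and products, so of the conditions in \<open>admissible\<close> only the one
  on bounds of \<open>\<one>\<close> can fail.\<close>

lemma admissible_adjoin:
  assumes "\<And>n t. (\<one>, t) \<in> pexp G x r n \<Longrightarrow> 1 \<le> t"
  shows "admissible (\<Union>n. pexp G x r n)" "G \<subseteq> (\<Union>n. pexp G x r n)" "(x, r) \<in> (\<Union>n. pexp G x r n)"
proof -
  show sub: "G \<subseteq> (\<Union>n. pexp G x r n)" using pexp_const[of _ _ 1] by auto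
  have "(x, r) \<in> pexp G x r 2" using pexp_monom[OF G_one, of 1 2] x by simp
  thus "(x, r) \<in> (\<Union>n. pexp G x r n)" by blast
  show "admissible (\<Union>n. pexp G x r n)" unfolding admissible_def
  proof (intro conjI allI impI ballI)
    show "(\<Union>n. pexp G x r n) \<subseteq> carrier L \<times> {0..}" using pexp_carrier by auto
    show "(c, v c) \<in> (\<Union>n. pexp G x r n)" if "c \<in> F" for c using G_F[OF that] sub by auto
    show "1 \<le> t" if "(\<one>, t) \<in> (\<Union>n. pexp G x r n)" for t using that assms by auto
  next
    fix y s z t assume "(y, s) \<in> (\<Union>n. pexp G x r n)" "(z, t) \<in> (\<Union>n. pexp G x r n)"
    then obtain n m where *: "(y, s) \<in> pexp G x r n" "(z, t) \<in> pexp G x r m" by auto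
    show "(y \<oplus> z, s + t) \<in> (\<Union>n. pexp G x r n)"
      using pexp_add[of y s "max n m" z t] pexp_mono * by (meson UN_I UNIV_I max.cobounded1 max.cobounded2)
    show "(y \<otimes> z, s * t) \<in> (\<Union>n. pexp G x r n)" using pexp_mult[OF *] by blast
  qed
qed

end
end

lemma exists_maximal_admissible:
  obtains G where "admissible G" "\<And>G'. admissible G' \<Longrightarrow> G \<subseteq> G' \<Longrightarrow> G' = G"
proof -
  \<comment> \<open>Zorn's lemma needs one admissible set to start with: all true upper bounds on
    \<open>F\<close>.\<close>
  define G0 where "G0 = {(c, r). c \<in> F \<and> v c \<le> r}"
  have "admissible G0" unfolding admissible_def
  proof (intro conjI allI impI ballI)
    show "G0 \<subseteq> carrier L \<times> {0..}" using F_carrier v_nonneg by (fastforce simp: G0_def)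
    show "(c, v c) \<in> G0" if "c \<in> F" for c using that by (simp add: G0_def)
    show "1 \<le> r" if "(\<one>, r) \<in> G0" for r using that v_one by (simp add: G0_def)
  next
    fix x r y s assume *: "(x, r) \<in> G0" "(y, s) \<in> G0"
    have "v (x \<oplus> y) \<le> v x + v y" using v * by (auto simp: absolute_value_def G0_def)
    thus "(x \<oplus> y, r + s) \<in> G0" using * subringE(7)[OF subfieldE(1)[OF F]] by (auto simp: G0_def)
    have "v x * v y \<le> r * s" using * v_nonneg by (intro mult_mono) (auto simp: G0_def intro: order_trans[rotated])
    thus "(x \<otimes> y, r * s) \<in> G0" using * F_closed v_mult by (auto simp: G0_def)
  qed
  have "\<exists>M\<in>Collect admissible. \<forall>Q\<in>Collect admissible. M \<subseteq> Q \<longrightarrow> Q = M"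
  proof (rule subset_Zorn_nonempty)
    show "Collect admissible \<noteq> {}" using \<open>admissible G0\<close> by blast
    fix C assume C: "C \<noteq> {}" "subset.chain (Collect admissible) C"
    have adm: "admissible Q" if "Q \<in> C" for Q using C that by (auto simp: subset_chain_def)
    have ch: "Q \<subseteq> Q2 \<or> Q2 \<subseteq> Q" if "Q \<in> C" "Q2 \<in> C" for Q Q2 using C that by (auto simp: subset_chain_def)
    have "admissible (\<Union>C)" unfolding admissible_def
    proof (intro conjI allI impI ballI)
      show "\<Union>C \<subseteq> carrier L \<times> {0..}" using adm by (fastforce simp: admissible_def)
      show "(c, v c) \<in> \<Union>C" if "c \<in> F" for c using adm C(1) that by (fastforce simp: admissible_def)
      show "1 \<le> t" if "(\<one>, t) \<in> \<Union>C" for t using adm that by (fastforce simp: admissible_def)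
    next
      fix y s z t assume "(y, s) \<in> \<Union>C" "(z, t) \<in> \<Union>C"
      then obtain Q where "Q \<in> C" "(y, s) \<in> Q" "(z, t) \<in> Q" using ch by blast
      thus "(y \<oplus> z, s + t) \<in> \<Union>C" "(y \<otimes> z, s * t) \<in> \<Union>C"
        using G_add[OF adm] G_mult[OF adm] by blast+
    qed
    thus "\<Union>C \<in> Collect admissible" by simp
  qed
  thus ?thesis using that by auto
qed

end

lemma le_cInf_mult:
  fixes A :: "real set"
  assumes "A \<noteq> {}" "0 \<le> s" "\<And>r. r \<in> A \<Longrightarrow> c \<le> r * s"
  shows "c \<le> Inf A * s"
proof (cases "s = 0")
  case True thus ?thesis using assms by auto
next
  case False
  hence s: "s > 0" using assms by simp
  have "c / s \<le> Inf A" using assms s by (intro cInf_greatest) (auto simp: field_simps)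
  thus ?thesis using s by (simp add: field_simps)
qed

section \<open>Maximal systems of bounds come from absolute values\<close>

context value_extension
begin

context
  fixes G
  assumes G: "admissible G" and G_max: "\<And>G'. admissible G' \<Longrightarrow> G \<subseteq> G' \<Longrightarrow> G' = G"
begin

text \<open>By maximality, a missing bound has a certificate: adjoining it breaks consistency, that
  is, some polynomial relation in \<open>x\<close> bounds \<open>\<one>\<close> by less than
  1.\<close>

lemma not_mem_obtain:
  assumes "x \<in> carrier L" "0 \<le> r" "(x, r) \<notin> G"
  obtains n t where "(\<one>, t) \<in> pexp G x r n" "t < 1"
proof (rule ccontr)
  assume "\<not> thesis"
  hence *: "\<And>n t. (\<one>, t) \<in> pexp G x r n \<Longrightarrow> 1 \<le> t" using that by force
  note adj = admissible_adjoin[OF G assms(1,2)]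
  have "(\<Union>n. pexp G x r n) = G" by (rule G_max) (use adj(1,2) * in blast)+
  moreover have "(x, r) \<in> (\<Union>n. pexp G x r n)" by (rule adj(3)) (use * in blast)
  ultimately show False using assms(3) by simp
qed

lemma subring_dom: "subring (fst ` G) L"
proof (rule subringI)
  show "fst ` G \<subseteq> carrier L" using G_carrier[OF G] by auto
  show "\<one> \<in> fst ` G" using G_one[OF G] by force
  show "\<ominus> h \<in> fst ` G" if "h \<in> fst ` G" for h using G_minus[OF G] that by force
  show "h \<otimes> k \<in> fst ` G" if "h \<in> fst ` G" "k \<in> fst ` G" for h k using G_mult[OF G] that by force
  show "h \<oplus> k \<in> fst ` G" if "h \<in> fst ` G" "k \<in> fst ` G" for h k using G_add[OF G] that by force
qed

text \<open>The elements that have some bound form a ring containing \<open>F\<close> and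
  \<open>x\<close>, hence \<open>F[x]\<close>, which is a field because \<open>x\<close> is
  algebraic. The bound \<open>s\<close> obtained for the inverse is uncontrolled.\<close>

lemma dom_inv:
  assumes "(x, r) \<in> G" "x \<noteq> \<zero>"
  obtains s where "(inv x, s) \<in> G"
proof -
  have x: "x \<in> carrier L" using assms G_carrier[OF G] by auto
  have "F \<subseteq> fst ` G" using G_F[OF G] by force
  hence "simple_extension F x \<subseteq> fst ` G"
    using simple_extension_subring_incl[OF subring_dom] assms(1) by (metis fst_conv imageI)
  moreover have "subfield (simple_extension F x) L" using simple_extension_is_subfield[OF F x] alg[OF x] by simp
  hence "inv x \<in> simple_extension F x"
    using subfield_m_inv(1) simple_extension_mem[OF subfieldE(1)[OF F] x] assms(2) by blast
  ultimately have "inv x \<in> fst ` G" by blast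
  thus ?thesis using that by (auto simp: image_iff)
qed

lemma pexp_dom:
  assumes x: "x \<in> carrier L" shows "(z, t) \<in> pexp G x r n \<Longrightarrow> \<exists>t'. (z, t') \<in> pexp G x r' n"
proof (induction n arbitrary: z t)
  case (Suc n)
  from Suc.prems obtain y s b u where *: "(y, s) \<in> pexp G x r n" "(b, u) \<in> G" "z = y \<oplus> b \<otimes> x [^] n"
    by (auto simp: pexp.simps)
  obtain t' where "(y, t') \<in> pexp G x r' n" using Suc.IH[OF *(1)] by auto
  hence "(z, t' + u * r' ^ n) \<in> pexp G x r' (Suc n)" using *(2,3) unfolding pexp.simps by blast
  thus ?case by blast
qed auto

text \<open>Raising the weight of \<open>x\<close> from 1 to \<open>r\<close> multiplies the bound
  of an expression of length \<open>n\<close> by at most r^(n-1). Writing the estimate with a factor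
  \<open>r\<close> on the left covers \<open>n = 0\<close> as well.\<close>

lemma pexp_bound:
  assumes x: "x \<in> carrier L" and r: "1 \<le> r"
  shows "(z, t) \<in> pexp G x 1 n \<Longrightarrow> \<exists>t'. (z, t') \<in> pexp G x r n \<and> r * t' \<le> t * r ^ n"
proof (induction n arbitrary: z t)
  case (Suc n)
  from Suc.prems obtain y s b u where *: "(y, s) \<in> pexp G x 1 n" "(b, u) \<in> G" "z = y \<oplus> b \<otimes> x [^] n" "t = s + u"
    by (auto simp: pexp.simps)
  obtain s' where s': "(y, s') \<in> pexp G x r n" "r * s' \<le> s * r ^ n" using Suc.IH[OF *(1)] by auto
  have s0: "0 \<le> s" using pexp_carrier[OF G x _ *(1)] by simp
  have "r * (s' + u * r ^ n) = r * s' + u * r ^ Suc n" by (simp add: algebra_simps)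
  also have "\<dots> \<le> s * r ^ n + u * r ^ Suc n" using s' by simp
  also have "s * r ^ n \<le> s * r ^ Suc n" using r s0 by (intro mult_left_mono) auto
  finally have "r * (s' + u * r ^ n) \<le> t * r ^ Suc n" by (simp add: * algebra_simps)
  moreover have "(z, s' + u * r ^ n) \<in> pexp G x r (Suc n)" using pexp_SucI[OF G x _ s'(1) *(2)] * r by simp
  ultimately show ?case by blast
qed auto

text \<open>If \<open>x\<close> had no bound, then every radius would be refuted by a certificate.
  Let \<open>d\<close> be least such that x^d is a combination of lower powers with bounded
  coefficients. For a suitable radius, replacing x^d by this combination never increases a bound, so
  the certificate can be shortened to length \<open>d\<close>. There the minimality of
  \<open>d\<close> kills all coefficients of positive powers, which leaves an inconsistency inside
  \<open>G\<close>.\<close>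

lemma dom_eq: assumes x: "x \<in> carrier L" obtains r where "(x, r) \<in> G"
proof (rule ccontr)
  assume "\<not> thesis"
  hence notin: "\<And>r. (x, r) \<notin> G" using that by blast
  define rel where "rel n \<longleftrightarrow> (\<exists>t. (x [^] n, t) \<in> pexp G x 1 n)" for n :: nat
  have ev: "\<exists>t. (eval q x, t) \<in> pexp G x 1 (length q)" if "set q \<subseteq> F" for q
    using that
  proof (induction q)
    case (Cons a q)
    then obtain t where "(eval q x, t) \<in> pexp G x 1 (length q)" by auto
    from pexp_SucI[OF G x zero_le_one this G_F[OF G]] Cons.prems have
      "\<exists>t. (eval q x \<oplus> a \<otimes> x [^] length q, t) \<in> pexp G x 1 (Suc (length q))" by (meson list.set_intros(1) subsetD)
    moreover have "eval (a # q) x = eval q x \<oplus> a \<otimes> x [^] length q"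
      using Cons.prems F_carrier x eval_in_carrier[of q x] by (simp add: a_comm subset_iff)
    ultimately show ?case by simp
  qed simp
  obtain p where p: "p \<in> carrier (F[X])" "p \<noteq> []" "eval p x = \<zero>"
    using algebraicE[OF subfieldE(1)[OF F] x alg[OF x]] by auto
  then obtain a q where aq: "p = a # q" "a \<in> F" "a \<noteq> \<zero>" "set q \<subseteq> F"
    by (cases p) (auto simp: univ_poly_def polynomial_def)
  have "rel (length q)"
  proof -
    obtain t where t: "(eval q x, t) \<in> pexp G x 1 (length q)" using ev aq by auto
    have c: "eval q x \<in> carrier L" "a \<in> carrier L" "inv a \<in> carrier L" "inv a \<otimes> a = \<one>"
      using pexp_carrier[OF G x _ t] aq F_carrier F_closed field_Units by auto
    have xq: "x [^] length q \<in> carrier L" using x by simp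
    have e: "a \<otimes> x [^] length q \<oplus> eval q x = \<zero>" using p aq by simp
    have "x [^] length q = (inv a \<otimes> a) \<otimes> x [^] length q" using c x by simp
    also have "\<dots> = inv a \<otimes> (a \<otimes> x [^] length q \<oplus> eval q x) \<oplus> (\<ominus> (inv a)) \<otimes> eval q x"
      using c(1-3) xq by algebra
    also have "\<dots> = (\<ominus> (inv a)) \<otimes> eval q x" using c e by simp
    finally have "x [^] length q = (\<ominus> (inv a)) \<otimes> eval q x" .
    moreover have "(\<ominus> (inv a), v (\<ominus> (inv a))) \<in> G" using aq F_closed G_F[OF G] by auto
    ultimately show ?thesis using pexp_smult[OF G x _ _ t] unfolding rel_def by fastforce
  qed
  define d where "d = (LEAST n. rel n)"
  have d: "rel d" "\<And>n. n < d \<Longrightarrow> \<not> rel n" unfolding d_def using \<open>rel (length q)\<close>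
    by (auto intro: LeastI dest: not_less_Least)
  \<comment> \<open>A nonzero coefficient \<open>b\<close> of a positive power x^n could be divided
    out, since \<open>inv b\<close> has a bound by \<open>dom_inv\<close>; this would express x^n
    with n < d by lower powers.\<close>
  have red0: "\<exists>s\<le>t. (z, s) \<in> G" if "(z, t) \<in> pexp G x r n" "n \<le> d" "(z, s) \<in> G" "1 \<le> r" for z t n s r
    using that
  proof (induction n arbitrary: t)
    case 0 thus ?case using G_zero[OF G] by auto
  next
    case (Suc n)
    have r0: "0 \<le> r" using Suc.prems by simp
    from Suc.prems(1) obtain y s' b u where *: "(y, s') \<in> pexp G x r n" "(b, u) \<in> G" "z = y \<oplus> b \<otimes> x [^] n" "t = s' + u * r ^ n"
      by (rule pexp_SucE[OF G x r0])
    have c: "y \<in> carrier L" "b \<in> carrier L" "z \<in> carrier L" "0 \<le> u"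
      using pexp_carrier[OF G x r0 *(1)] G_carrier[OF G] * x by auto
    consider "b = \<zero>" | "b \<noteq> \<zero>" "n = 0" | "b \<noteq> \<zero>" "n > 0" by auto
    thus ?case
    proof cases
      case 1
      hence "z = y" using * c x by simp
      then obtain s1 where "s1 \<le> s'" "(z, s1) \<in> G" using Suc.IH[of s'] * Suc.prems by auto
      moreover have "s' \<le> t" using * c r0 by simp
      ultimately show ?thesis by (meson order_trans)
    next
      case 2
      thus ?thesis using * c by auto
    next
      case 3
      obtain w where w: "(inv b, w) \<in> G" using dom_inv[OF *(2) 3(1)] .
      have ib: "inv b \<in> carrier L" "inv b \<otimes> b = \<one>" using 3 c field_Units by auto
      have xn: "x [^] n \<in> carrier L" using x by simp
      have "z \<oplus> (\<ominus> \<one>) \<otimes> y = b \<otimes> x [^] n" unfolding *(3) using c(1,2) xn by algebra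
      moreover have "x [^] n = inv b \<otimes> (b \<otimes> x [^] n)" using ib c xn by (simp add: m_assoc[symmetric])
      ultimately have "x [^] n = inv b \<otimes> (z \<oplus> (\<ominus> \<one>) \<otimes> y)" by simp
      note e = this
      have "(inv b \<otimes> (z \<oplus> (\<ominus> \<one>) \<otimes> y), w * (s + 1 * s')) \<in> pexp G x r n"
        by (intro pexp_smult[OF G x r0] pexp_add[OF G x r0] w * G_minus_one[OF G] pexp_const[OF G x r0] Suc.prems 3)
      hence "rel n" unfolding rel_def e using pexp_dom[OF x] by blast
      thus ?thesis using d(2)[of n] Suc.prems by simp
    qed
  qed
  obtain t0 where t0: "(x [^] d, t0) \<in> pexp G x 1 d" using d(1) rel_def by auto
  \<comment> \<open>With this radius the relation for x^d has weight at most r^d: its weight at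
    radius 1 is \<open>t0\<close>, at most \<open>r\<close>, and the change of radius costs at most
    r^(d-1).\<close>
  define r where "r = max 1 t0"
  have r: "1 \<le> r" "0 \<le> r" "t0 \<le> r" by (auto simp: r_def)
  obtain t1 where t1: "(x [^] d, t1) \<in> pexp G x r d" "r * t1 \<le> t0 * r ^ d" using pexp_bound[OF x r(1) t0] by auto
  have "r * t1 \<le> r * r ^ d" using t1 r by (meson mult_right_mono order_trans zero_le_power)
  hence t1r: "t1 \<le> r ^ d" using r by simp
  have red1: "\<exists>t'\<le>t. (z, t') \<in> pexp G x r d" if zt: "(z, t) \<in> pexp G x r (Suc d)" for z t
  proof -
    from zt obtain y s b u where *: "(y, s) \<in> pexp G x r d" "(b, u) \<in> G" "z = y \<oplus> b \<otimes> x [^] d" "t = s + u * r ^ d"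
      by (rule pexp_SucE[OF G x r(2)])
    have "(z, s + u * t1) \<in> pexp G x r d" unfolding * by (intro pexp_add[OF G x r(2)] pexp_smult[OF G x r(2)] * t1)
    moreover have "s + u * t1 \<le> t" using * t1r G_carrier(2)[OF G *(2)] by (simp add: mult_left_mono)
    ultimately show ?thesis by blast
  qed
  have pow: "\<exists>t'\<le>r ^ n. (x [^] n, t') \<in> pexp G x r d" for n
  proof (induction n)
    case 0
    have "d > 0" using t0 by (cases d) auto
    thus ?case using pexp_const[OF G x r(2) G_one[OF G]] by auto
  next
    case (Suc n)
    then obtain t' where t': "t' \<le> r ^ n" "(x [^] n, t') \<in> pexp G x r d" by auto
    have "(x [^] Suc n, r * t') \<in> pexp G x r (Suc d)" using pexp_shift[OF G x r(2) t'(2)] x by (simp add: m_comm)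
    then obtain t'' where "t'' \<le> r * t'" "(x [^] Suc n, t'') \<in> pexp G x r d" using red1 by blast
    moreover have "r * t' \<le> r ^ Suc n" using t' r by (simp add: mult_left_mono)
    ultimately show ?case by (meson order_trans)
  qed
  have red: "\<exists>t'\<le>t. (z, t') \<in> pexp G x r d" if "(z, t) \<in> pexp G x r n" for z t n
    using that
  proof (induction n arbitrary: z t)
    case 0 thus ?case using pexp_zero[OF G x r(2)] by auto
  next
    case (Suc n)
    from Suc.prems obtain y s b u where *: "(y, s) \<in> pexp G x r n" "(b, u) \<in> G" "z = y \<oplus> b \<otimes> x [^] n" "t = s + u * r ^ n"
      by (rule pexp_SucE[OF G x r(2)])
    obtain s' where s': "s' \<le> s" "(y, s') \<in> pexp G x r d" using Suc.IH[OF *(1)] by auto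
    obtain t' where t': "t' \<le> r ^ n" "(x [^] n, t') \<in> pexp G x r d" using pow by auto
    have "(z, s' + u * t') \<in> pexp G x r d" unfolding * by (intro pexp_add[OF G x r(2)] pexp_smult[OF G x r(2)] * t' s')
    moreover have "s' + u * t' \<le> t" using * s' t' G_carrier(2)[OF G *(2)] by (simp add: mult_left_mono add_mono)
    ultimately show ?case by blast
  qed
  obtain n t where nt: "(\<one>, t) \<in> pexp G x r n" "t < 1" using not_mem_obtain[OF x r(2) notin] .
  obtain t' where "t' \<le> t" "(\<one>, t') \<in> pexp G x r d" using red[OF nt(1)] by auto
  moreover then obtain s where "s \<le> t'" "(\<one>, s) \<in> G" using red0 G_one[OF G] r by blast
  ultimately show False using G_one_ge[OF G, of s] nt by simp
qed

lemma pow_mult_inv_pow: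
  assumes "x \<in> carrier L" "y \<in> carrier L" "x \<otimes> y = \<one>" "k \<le> n"
  shows "x [^] (n::nat) \<otimes> y [^] k = x [^] (n - k)"
proof -
  have "x [^] n \<otimes> y [^] k = x [^] (n - k) \<otimes> (x [^] k \<otimes> y [^] k)"
    using assms by (simp add: nat_pow_mult m_assoc[symmetric])
  also have "x [^] k \<otimes> y [^] k = (x \<otimes> y) [^] k" using nat_pow_distrib[OF assms(1,2), of k] by simp
  finally show ?thesis using assms by simp
qed

text \<open>Multiplication by x^n clears the powers of y = 1/x. Only the constant coefficient
  \<open>b\<close> ends up at degree \<open>n\<close>, and the bounds transform exactly because
  \<open>y\<close> has the weight 1/r.\<close>

lemma pexp_inverse:
  assumes x: "x \<in> carrier L" "y \<in> carrier L" "x \<otimes> y = \<one>" "0 < r"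
  shows "(z, t) \<in> pexp G y (1 / r) (Suc m) \<Longrightarrow> m \<le> n \<Longrightarrow>
    \<exists>b u w q. (b, u) \<in> G \<and> (w, q) \<in> pexp G x r n \<and> x [^] n \<otimes> z = b \<otimes> x [^] n \<oplus> w \<and> t * r ^ n = u * r ^ n + q"
proof (induction m arbitrary: z t)
  case 0
  have r0: "0 \<le> r" using x by simp
  from 0 obtain b u where *: "(b, u) \<in> G" "z = \<zero> \<oplus> b \<otimes> y [^] (0::nat)" "t = u" by (auto simp: pexp.simps)
  have "b \<in> carrier L" using G_carrier[OF G] * by auto
  hence "x [^] n \<otimes> z = b \<otimes> x [^] n \<oplus> \<zero>" using * x by (simp add: m_comm)
  thus ?case using pexp_zero[OF G x(1) r0, of n] * by (metis add.right_neutral)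
next
  case (Suc m)
  have r0: "0 \<le> r" "0 \<le> 1 / r" using x by auto
  from Suc.prems(1) obtain z1 t1 b' u' where *: "(z1, t1) \<in> pexp G y (1/r) (Suc m)" "(b', u') \<in> G"
      "z = z1 \<oplus> b' \<otimes> y [^] Suc m" "t = t1 + u' * (1/r) ^ Suc m"
    by (rule pexp_SucE[OF G x(2) r0(2)])
  obtain b u w q where IH: "(b, u) \<in> G" "(w, q) \<in> pexp G x r n" "x [^] n \<otimes> z1 = b \<otimes> x [^] n \<oplus> w" "t1 * r ^ n = u * r ^ n + q"
    using Suc.IH[OF *(1)] Suc.prems by auto
  have c: "z1 \<in> carrier L" "b' \<in> carrier L" "w \<in> carrier L" "b \<in> carrier L"
    using pexp_carrier[OF G x(2) r0(2) *(1)] G_carrier[OF G] * IH pexp_carrier[OF G x(1) r0(1)] by auto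
  have xn: "x [^] n \<in> carrier L" "y [^] Suc m \<in> carrier L" using x nat_pow_closed by blast+
  have "x [^] n \<otimes> z = x [^] n \<otimes> z1 \<oplus> b' \<otimes> (x [^] n \<otimes> y [^] Suc m)" unfolding * using c xn by algebra
  also have "\<dots> = b \<otimes> x [^] n \<oplus> (w \<oplus> b' \<otimes> x [^] (n - Suc m))"
    unfolding IH(3) pow_mult_inv_pow[OF x(1-3) Suc.prems(2)] using c xn x by (simp add: a_assoc)
  finally have 1: "x [^] n \<otimes> z = b \<otimes> x [^] n \<oplus> (w \<oplus> b' \<otimes> x [^] (n - Suc m))" .
  have "(1/r) ^ Suc m * r ^ n = r ^ (n - Suc m)"
  proof -
    have "r ^ n = r ^ Suc m * r ^ (n - Suc m)" using Suc.prems by (simp only: power_add[symmetric]) simp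
    thus ?thesis using x(4) by (simp add: power_one_over)
  qed
  hence 2: "t * r ^ n = u * r ^ n + (q + u' * r ^ (n - Suc m))"
  proof -
    have "t * r ^ n = t1 * r ^ n + u' * ((1/r) ^ Suc m * r ^ n)" unfolding *(4) by (simp only: distrib_right mult.assoc)
    thus ?thesis unfolding \<open>(1/r) ^ Suc m * r ^ n = r ^ (n - Suc m)\<close> using IH(4) by simp
  qed
  have "(w \<oplus> b' \<otimes> x [^] (n - Suc m), q + u' * r ^ (n - Suc m)) \<in> pexp G x r n"
    using Suc.prems by (intro pexp_add[OF G x(1) r0(1)] pexp_monom[OF G x(1) r0(1)] IH *) auto
  thus ?case using 1 2 IH(1) by blast
qed

text \<open>The second relation reads x^n = b x^n + w. The classical argument would divide by 1 - b,
  but no good bound for that inverse is available, so the relation is iterated instead: x^n = b^k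
  x^n + wk, where the geometric series keeps the bound of \<open>wk\<close> below q / (1 - u), hence
  below r^n. Substituting this for the top power in the first relation costs only the remainder a
  b^k x^n. Its weight s u^k R tends to 0, where \<open>R\<close> is the crude bound of x^n supplied
  by \<open>dom_eq\<close>, and it finally fits into the gap 1 - t.\<close>

lemma pexp_reduce:
  assumes x: "x \<in> carrier L" "y \<in> carrier L" "x \<otimes> y = \<one>" "0 < r"
    and 1: "(\<one>, t) \<in> pexp G x r (Suc n)" "t < 1"
    and 2: "(\<one>, t') \<in> pexp G y (1 / r) (Suc m)" "t' < 1"
    and mn: "m \<le> n" "0 < n"
  shows "\<exists>t''<1. (\<one>, t'') \<in> pexp G x r n"
proof -
  have r0: "0 \<le> r" using x by simp
  note rls = pexp_smult[OF G x(1) r0] pexp_add[OF G x(1) r0] pexp_const[OF G x(1) r0]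
  obtain b u w q where b: "(b, u) \<in> G" "(w, q) \<in> pexp G x r n" "x [^] n \<otimes> \<one> = b \<otimes> x [^] n \<oplus> w" "t' * r ^ n = u * r ^ n + q"
    using pexp_inverse[OF x 2(1) mn(1)] by auto
  from 1(1) obtain z0 t0 a s where z0: "(z0, t0) \<in> pexp G x r n" "(a, s) \<in> G" "\<one> = z0 \<oplus> a \<otimes> x [^] n" "t = t0 + s * r ^ n"
    by (rule pexp_SucE[OF G x(1) r0])
  have nn: "0 \<le> u" "0 \<le> q" "0 \<le> s" using G_carrier[OF G] b z0 pexp_carrier[OF G x(1) r0] by auto
  have c: "b \<in> carrier L" "w \<in> carrier L" "z0 \<in> carrier L" "a \<in> carrier L" "x [^] n \<in> carrier L"
    using G_carrier[OF G] b z0 x pexp_carrier[OF G x(1) r0] by auto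
  have rn: "0 < r ^ n" using x by simp
  have "u * r ^ n \<le> t' * r ^ n" using b nn by simp
  hence u1: "u < 1" using 2(2) rn by simp
  have qu: "q / (1 - u) \<le> r ^ n"
  proof -
    have "q = (t' - u) * r ^ n" using b by (simp add: algebra_simps)
    also have "\<dots> \<le> (1 - u) * r ^ n" using 2 rn by (intro mult_right_mono) auto
    finally show ?thesis using u1 by (simp add: field_simps)
  qed
  have it: "\<exists>wk qk. (wk, qk) \<in> pexp G x r n \<and> qk \<le> q / (1 - u) \<and> x [^] n = b [^] k \<otimes> x [^] n \<oplus> wk" for k :: nat
  proof (induction k)
    case 0
    show ?case using pexp_zero[OF G x(1) r0, of n] c u1 nn by (intro exI[of _ \<zero>] exI[of _ 0]) auto
  next
    case (Suc k)
    then obtain wk qk where k: "(wk, qk) \<in> pexp G x r n" "qk \<le> q / (1 - u)" "x [^] n = b [^] k \<otimes> x [^] n \<oplus> wk" by auto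
    have ck: "wk \<in> carrier L" "b [^] k \<in> carrier L" using pexp_carrier[OF G x(1) r0 k(1)] c by auto
    have "x [^] n = b \<otimes> x [^] n \<oplus> w" using b(3) c by simp
    also have "\<dots> = b \<otimes> (b [^] k \<otimes> x [^] n \<oplus> wk) \<oplus> w" using k(3) by simp
    also have "\<dots> = (b [^] k \<otimes> b) \<otimes> x [^] n \<oplus> (b \<otimes> wk \<oplus> w)" using c ck by algebra
    finally have e: "x [^] n = b [^] Suc k \<otimes> x [^] n \<oplus> (b \<otimes> wk \<oplus> w)" by simp
    have "u * qk + q \<le> u * (q / (1 - u)) + q" using mult_left_mono[OF k(2) nn(1)] by simp
    also have "\<dots> = q / (1 - u)" using u1 by (simp add: field_simps)
    finally show ?case using e rls(1)[OF b(1) k(1)] rls(2) b(2) by blast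
  qed
  obtain R where R: "(x [^] n, R) \<in> G" using dom_eq[OF c(5)] .
  have R0: "0 \<le> R" using G_carrier[OF G R] by simp
  have "(\<lambda>k. s * u ^ k * R) \<longlonglongrightarrow> s * 0 * R" using nn u1 by (intro tendsto_intros LIMSEQ_realpow_zero) auto
  hence "\<forall>\<^sub>F k in sequentially. s * u ^ k * R < 1 - t" using 1(2) by (intro order_tendstoD(2)) auto
  then obtain k where k: "s * u ^ k * R < 1 - t" by (auto simp: eventually_sequentially)
  obtain wk qk where wk: "(wk, qk) \<in> pexp G x r n" "qk \<le> q / (1 - u)" "x [^] n = b [^] k \<otimes> x [^] n \<oplus> wk"
    using it by blast
  have ck: "wk \<in> carrier L" "b [^] k \<in> carrier L" using pexp_carrier[OF G x(1) r0 wk(1)] c by auto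
  have "\<one> = z0 \<oplus> a \<otimes> (b [^] k \<otimes> x [^] n \<oplus> wk)" using z0(3) wk(3) by simp
  also have "\<dots> = (z0 \<oplus> a \<otimes> wk) \<oplus> (a \<otimes> b [^] k) \<otimes> x [^] n" using c ck by algebra
  finally have e: "\<one> = (z0 \<oplus> a \<otimes> wk) \<oplus> (a \<otimes> b [^] k) \<otimes> x [^] n" .
  have "((z0 \<oplus> a \<otimes> wk) \<oplus> (a \<otimes> b [^] k) \<otimes> x [^] n, (t0 + s * qk) + (s * u ^ k) * R) \<in> pexp G x r n"
    by (intro rls z0 wk mn G_mult[OF G] G_pow[OF G] R b)
  moreover have "(t0 + s * qk) + (s * u ^ k) * R < 1"
  proof -
    have "s * qk \<le> s * r ^ n" using wk(2) qu nn by (intro mult_left_mono) auto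
    thus ?thesis using k z0(4) by simp
  qed
  ultimately show ?thesis unfolding e[symmetric] by blast
qed

text \<open>
  This is Chevalley's argument for valuation rings: relations of minimal lengths that exclude \<open>(x, r)\<close>
  and \<open>(inv x, 1 / r)\<close> can be combined to a shorter one.
\<close>

lemma mem_or_inverse_mem:
  assumes x: "x \<in> carrier L" "x \<noteq> \<zero>" and r: "0 < r"
  shows "(x, r) \<in> G \<or> (inv x, 1 / r) \<in> G"
proof (rule ccontr)
  assume *: "\<not> ?thesis"
  have i: "inv x \<in> carrier L" "x \<otimes> inv x = \<one>" "inv x \<otimes> x = \<one>" using x field_Units by auto
  define P where "P x r n \<longleftrightarrow> (\<exists>t<1. (\<one>, t) \<in> pexp G x r n)" for x r n
  have ex: "\<exists>n. P x r n" "\<exists>n. P (inv x) (1 / r) n"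
  proof -
    have *: "(x, r) \<notin> G" "(inv x, 1 / r) \<notin> G" "0 \<le> r" "0 \<le> 1 / r" using * r by auto
    show "\<exists>n. P x r n" unfolding P_def using not_mem_obtain[OF x(1) *(3,1)] by metis
    show "\<exists>n. P (inv x) (1 / r) n" unfolding P_def using not_mem_obtain[OF i(1) *(4,2)] by metis
  qed
  \<comment> \<open>Length 0 expresses only \<open>\<zero>\<close>, and length 1 would put a bound
    of \<open>\<one>\<close> below 1 into \<open>G\<close> itself. So both minimal relations have a
    top power to eliminate.\<close>
  have large: "n \<ge> 2" if pn: "P y s n" "y \<in> carrier L" for y s n
  proof (rule ccontr)
    assume "\<not> n \<ge> 2"
    then consider "n = 0" | "n = Suc 0" by linarith
    thus False
    proof cases
      case 1 thus ?thesis using that by (auto simp: P_def)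
    next
      case 2
      then obtain u where u: "(\<one>, u) \<in> pexp G y s (Suc 0)" "u < 1" using pn by (auto simp: P_def)
      from u(1) obtain b where b: "(b, u) \<in> G" "\<one> = \<zero> \<oplus> b \<otimes> \<one>" by (auto simp: pexp.simps)
      have "b = \<one>" using b(2) G_carrier[OF G b(1)] by simp
      thus ?thesis using G_one_ge[OF G, of u] b(1) u(2) by simp
    qed
  qed
  define n m where "n = (LEAST n. P x r n)" and "m = (LEAST n. P (inv x) (1 / r) n)"
  have n: "P x r n" "\<And>k. k < n \<Longrightarrow> \<not> P x r k" and m: "P (inv x) (1 / r) m" "\<And>k. k < m \<Longrightarrow> \<not> P (inv x) (1 / r) k"
    unfolding n_def m_def using ex by (auto intro: LeastI_ex dest: not_less_Least)
  define n' m' where "n' = n - 1" and "m' = m - 1"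
  hence nm: "n = Suc n'" "n' > 0" "m = Suc m'" "m' > 0"
    using large[OF n(1) x(1)] large[OF m(1) i(1)] by auto
  obtain t where t: "(\<one>, t) \<in> pexp G x r (Suc n')" "t < 1" using n(1) nm unfolding P_def by blast
  obtain t' where t': "(\<one>, t') \<in> pexp G (inv x) (1 / r) (Suc m')" "t' < 1" using m(1) nm unfolding P_def by blast
  show False
  proof (cases "m' \<le> n'")
    case True
    have "P x r n'" unfolding P_def using pexp_reduce[OF x(1) i(1,2) r t t' True nm(2)] .
    thus False using n(2) nm by simp
  next
    case False
    hence le: "n' \<le> m'" by simp
    have r': "0 < 1 / r" "(\<one>, t) \<in> pexp G x (1 / (1 / r)) (Suc n')" using r t by auto
    have "P (inv x) (1 / r) m'" unfolding P_def using pexp_reduce[OF i(1) x(1) i(3) r'(1) t' r'(2) t(2) le nm(4)] .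
    thus False using m(2) nm by simp
  qed
qed

text \<open>Let \<open>w x\<close> be the infimum of the bounds of \<open>x\<close>. Closure of
  \<open>G\<close> makes it subadditive and submultiplicative; the alternative
  \<open>mem_or_inverse_mem\<close> bounds w(1/x) w(x) by 1, and this turns submultiplicativity into
  multiplicativity. On \<open>F\<close> the inequality w \<le> v, applied to \<open>c\<close> and to
  its inverse, forces equality.\<close>

lemma maximal_admissible_absolute_value:
  "\<exists>w. absolute_value L w \<and> (\<forall>c\<in>F. w c = v c)"
proof -
  define A where "A x = {r. (x, r) \<in> G}" for x
  define w where "w x = Inf (A x)" for x
  have ne: "A x \<noteq> {}" if "x \<in> carrier L" for x by (rule dom_eq[OF that]) (auto simp: A_def)
  have nn: "0 \<le> r" if "r \<in> A x" for x r using that G_carrier[OF G] by (auto simp: A_def)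
  have bdd: "bdd_below (A x)" for x using nn by (rule bdd_belowI)
  have w_le: "w x \<le> r" if "(x, r) \<in> G" for x r using cInf_lower[OF _ bdd, of r x] that by (simp add: w_def A_def)
  have w0: "0 \<le> w x" if "x \<in> carrier L" for x unfolding w_def using ne[OF that] nn by (intro cInf_greatest)
  have sub: "w (x \<otimes> y) \<le> w x * w y" if that2: "x \<in> carrier L" "y \<in> carrier L" for x y
  proof -
    have "w (x \<otimes> y) \<le> r * w y" if r: "r \<in> A x" for r
    proof -
      have "w (x \<otimes> y) \<le> Inf (A y) * r"
      proof (rule le_cInf_mult)
        fix s assume "s \<in> A y"
        thus "w (x \<otimes> y) \<le> s * r" using r G_mult[OF G, of x r y s] w_le by (simp add: A_def mult.commute)
      qed (use r nn[OF r] ne[OF that2(2)] in auto)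
      thus ?thesis by (simp add: w_def mult.commute)
    qed
    thus ?thesis unfolding w_def[of x] using ne that2 w0 by (intro le_cInf_mult) simp_all
  qed
  have add: "w (x \<oplus> y) \<le> w x + w y" if that2: "x \<in> carrier L" "y \<in> carrier L" for x y
  proof -
    have 1: "w (x \<oplus> y) \<le> r + s" if "r \<in> A x" "s \<in> A y" for r s using that w_le[OF G_add[OF G, of x r y s]] by (simp add: A_def)
    have "w (x \<oplus> y) - r \<le> w y" if "r \<in> A x" for r
      unfolding w_def[of y] using 1[OF that] ne that2 by (intro cInf_greatest) (simp_all add: diff_le_eq add.commute)
    hence "w (x \<oplus> y) - w y \<le> w x"
      unfolding w_def[of x] using ne that2 by (intro cInf_greatest) (simp_all add: diff_le_eq le_diff_eq add.commute)
    thus ?thesis by simp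
  qed
  have inv_le: "w x > 0 \<and> w (inv x) * w x \<le> 1" if x: "x \<in> carrier L" "x \<noteq> \<zero>" for x
  proof
    have i: "inv x \<in> carrier L" "x \<otimes> inv x = \<one>" using x field_Units by auto
    obtain s where s: "(inv x, s) \<in> G" using dom_eq[OF i(1)] .
    have ge: "1 \<le> r * s" if "r \<in> A x" for r using that G_one_ge[OF G] G_mult[OF G _ s, of x r] i by (simp add: A_def)
    have "1 \<le> w x * s" unfolding w_def using ge ne[OF x(1)] G_carrier[OF G s] by (intro le_cInf_mult) auto
    thus pos: "w x > 0" using w0[OF x(1)] by (cases "w x = 0") auto
    \<comment> \<open>A radius below the infimum is not a bound of \<open>x\<close>, so its
      reciprocal must be a bound of the inverse. Afterwards \<open>r\<close> tends to
      \<open>w x\<close>.\<close>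
    have "w (inv x) \<le> 1 / r" if "0 < r" "r < w x" for r
      using mem_or_inverse_mem[OF x that(1)] w_le[of x r] w_le[of "inv x" "1 / r"] that(2) by auto
    hence "w (inv x) * r \<le> 1" if "0 < r" "r < w x" for r using that by (simp add: field_simps)
    hence le: "r \<le> 1 / w (inv x)" if "0 < r" "r < w x" "w (inv x) > 0" for r using that by (simp add: field_simps)
    show "w (inv x) * w x \<le> 1"
    proof (cases "w (inv x) > 0")
      case True
      have "w x \<le> 1 / w (inv x)" by (rule dense_le_bounded[OF pos]) (use le True in auto)
      thus ?thesis using True by (simp add: field_simps)
    next
      case False
      thus ?thesis using w0[OF i(1)] by simp
    qed
  qed
  have zero: "w \<zero> = 0" using w_le[OF G_zero[OF G]] w0[of \<zero>] by simp
  have mult: "w (x \<otimes> y) = w x * w y" if "x \<in> carrier L" "y \<in> carrier L" for x y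
  proof (cases "y = \<zero>")
    case False
    have i: "inv y \<in> carrier L" "y \<otimes> inv y = \<one>" using that False field_Units by auto
    have "x = x \<otimes> y \<otimes> inv y" using that i by (simp add: m_assoc)
    hence "w x * w y \<le> w (x \<otimes> y) * w (inv y) * w y"
      using sub[of "x \<otimes> y" "inv y"] that i w0 by (simp add: mult_right_mono)
    also have "\<dots> \<le> w (x \<otimes> y) * 1" unfolding mult.assoc using inv_le[OF that(2) False] w0 that by (intro mult_left_mono) auto
    finally show ?thesis using sub[OF that] by simp
  qed (use that zero in simp)
  have "absolute_value L w" unfolding absolute_value_def
  proof (intro conjI ballI)
    show "(w x = 0) = (x = \<zero>)" if "x \<in> carrier L" for x using inv_le[OF that] zero by (cases "x = \<zero>") auto
  qed (use w0 mult add in auto)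
  moreover have "w c = v c" if c: "c \<in> F" for c
  proof (cases "c = \<zero>")
    case True thus ?thesis using zero v_eq_0[OF c] by simp
  next
    case False
    have i: "inv c \<in> F" "c \<otimes> inv c = \<one>" using c F_closed False F_carrier field_Units by auto
    have 1: "w c \<le> v c" "w (inv c) \<le> v (inv c)" using w_le G_F[OF G] c i by auto
    have "w \<one> = 1" using mult[of \<one> \<one>] inv_le[of \<one>] by auto
    hence "1 = w c * w (inv c)" using mult[of c "inv c"] c i F_carrier by simp
    also have "\<dots> \<le> w c * v (inv c)" using 1 w0 c F_carrier by (intro mult_left_mono) auto
    finally have "v c \<le> w c" using v_inv[OF c False] v_nonneg[OF c] v_eq_0[OF c] False by (simp add: field_simps)
    thus ?thesis using 1 by simp
  qed
  ultimately show ?thesis by blast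
qed

end

theorem absolute_value_extension: "\<exists>w. absolute_value L w \<and> (\<forall>c\<in>F. w c = v c)"
proof -
  obtain G where "admissible G" "\<And>G'. admissible G' \<Longrightarrow> G \<subseteq> G' \<Longrightarrow> G' = G"
    using exists_maximal_admissible by blast
  thus ?thesis by (rule maximal_admissible_absolute_value)
qed

end

subsection \<open>Completions\<close>

lemma null_comparison:
  fixes f g :: "nat \<Rightarrow> real"
  assumes "g \<longlonglongrightarrow> 0" "\<And>n. \<bar>f n\<bar> \<le> g n" shows "f \<longlonglongrightarrow> 0"
proof (rule tendsto_0_le[OF assms(1), of _ 1])
  have "\<bar>f n\<bar> \<le> \<bar>g n\<bar>" for n using assms(2)[of n] by linarith
  thus "\<forall>\<^sub>F n in sequentially. norm (f n) \<le> norm (g n) * 1" by simp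
qed

locale valued_field = field R for R (structure) +
  fixes v assumes abs: "absolute_value R v"
begin

lemma v_nonneg: "x \<in> carrier R \<Longrightarrow> 0 \<le> v x"
  and v_eq_0: "x \<in> carrier R \<Longrightarrow> v x = 0 \<longleftrightarrow> x = \<zero>"
  and v_mult: "x \<in> carrier R \<Longrightarrow> y \<in> carrier R \<Longrightarrow> v (x \<otimes> y) = v x * v y"
  and v_add: "x \<in> carrier R \<Longrightarrow> y \<in> carrier R \<Longrightarrow> v (x \<oplus> y) \<le> v x + v y"
  using abs by (auto simp: absolute_value_def)

lemma v_zero: "v \<zero> = 0" using v_eq_0 by simp

lemma v_one: "v \<one> = 1"
  using v_mult[of \<one> \<one>] v_eq_0[of \<one>] by auto

lemma v_pow: "x \<in> carrier R \<Longrightarrow> v (x [^] (n::nat)) = v x ^ n"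
  by (induction n) (auto simp: v_one v_mult)

lemma v_minus: assumes "x \<in> carrier R" shows "v (\<ominus> x) = v x"
proof -
  have "v (\<ominus> \<one>) ^ 2 = 1" using v_mult[of "\<ominus> \<one>" "\<ominus> \<one>"] v_one by (simp add: power2_eq_square l_minus)
  hence "v (\<ominus> \<one>) = 1" using v_nonneg[of "\<ominus> \<one>"] by (auto simp: power2_eq_1_iff)
  thus ?thesis using v_mult[of "\<ominus> \<one>" x] assms by (simp add: l_minus)
qed

lemma v_diff: "x \<in> carrier R \<Longrightarrow> y \<in> carrier R \<Longrightarrow> v (x \<ominus> y) \<le> v x + v y"
  using v_add[of x "\<ominus> y"] v_minus[of y] by (simp add: a_minus_def)

lemma v_abs_diff: assumes "x \<in> carrier R" "y \<in> carrier R" shows "\<bar>v x - v y\<bar> \<le> v (x \<ominus> y)"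
proof -
  have "x = (x \<ominus> y) \<oplus> y" "y = (\<ominus> (x \<ominus> y)) \<oplus> x" using assms by algebra+
  hence "v x \<le> v (x \<ominus> y) + v y" "v y \<le> v (x \<ominus> y) + v x"
    using v_add[of "x \<ominus> y" y] v_add[of "\<ominus> (x \<ominus> y)" x] v_minus[of "x \<ominus> y"] assms by simp_all
  thus ?thesis by simp
qed

lemma v_inv: assumes "x \<in> carrier R" "x \<noteq> \<zero>" shows "v (inv x) = 1 / v x"
proof -
  have "x \<otimes> inv x = \<one>" "inv x \<in> carrier R" using assms field_Units by auto
  hence "v x * v (inv x) = 1" using v_mult[of x "inv x"] assms v_one by simp
  thus ?thesis using v_eq_0 assms by (auto simp: field_simps)
qed

lemma v_finsum_le: "(\<And>i. i \<in> A \<Longrightarrow> f i \<in> carrier R) \<Longrightarrow> v (\<Oplus>i\<in>A. f i) \<le> (\<Sum>i\<in>A. v (f i))"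
proof (induction A rule: infinite_finite_induct)
  case (insert x F)
  have "v (\<Oplus>i\<in>insert x F. f i) = v (f x \<oplus> (\<Oplus>i\<in>F. f i))" using insert by (subst finsum_insert) auto
  also have "\<dots> \<le> v (f x) + v (\<Oplus>i\<in>F. f i)" using insert by (intro v_add finsum_closed) auto
  finally show ?case using insert by fastforce
qed (auto simp: v_zero)

abbreviation "CR \<equiv> Cauchy_ring R v"
abbreviation "CS \<equiv> Cauchy_seqs R v"
abbreviation "NS \<equiv> null_seqs R v"

lemma CR_simps: "carrier CR = CS" "s \<otimes>\<^bsub>CR\<^esub> t = (\<lambda>n. s n \<otimes> t n)" "s \<oplus>\<^bsub>CR\<^esub> t = (\<lambda>n. s n \<oplus> t n)"
  "\<one>\<^bsub>CR\<^esub> = (\<lambda>_. \<one>)" "\<zero>\<^bsub>CR\<^esub> = (\<lambda>_. \<zero>)"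
  by (simp_all add: Cauchy_ring_def)

lemma CS_carrier: "s \<in> CS \<Longrightarrow> s n \<in> carrier R" by (simp add: Cauchy_seqs_def)

lemma CSI: "(\<And>n. s n \<in> carrier R) \<Longrightarrow> (\<And>e. e > 0 \<Longrightarrow> \<exists>N. \<forall>i\<ge>N. \<forall>j\<ge>N. v (s i \<ominus> s j) < e) \<Longrightarrow> s \<in> CS"
  by (simp add: Cauchy_seqs_def)

lemma CSD: "s \<in> CS \<Longrightarrow> e > 0 \<Longrightarrow> \<exists>N. \<forall>i\<ge>N. \<forall>j\<ge>N. v (s i \<ominus> s j) < e"
  by (simp add: Cauchy_seqs_def)

lemma CS_const: "x \<in> carrier R \<Longrightarrow> (\<lambda>_. x) \<in> CS"
  by (intro CSI) (auto simp: r_neg a_minus_def v_zero)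

lemma CS_bounded: assumes "s \<in> CS" shows "\<exists>B>0. \<forall>n. v (s n) \<le> B"
proof -
  obtain N where N: "\<forall>i\<ge>N. \<forall>j\<ge>N. v (s i \<ominus> s j) < 1" using CSD[OF assms, of 1] by auto
  define B where "B = Max ((\<lambda>n. v (s n)) ` {..N}) + 1"
  have M: "v (s n) \<le> Max ((\<lambda>n. v (s n)) ` {..N})" if "n \<le> N" for n using that by (intro Max_ge) auto
  have "v (s n) \<le> B" for n
  proof (cases "n \<le> N")
    case True thus ?thesis unfolding B_def using M[OF True] by linarith
  next
    case False
    have "\<bar>v (s n) - v (s N)\<bar> \<le> v (s n \<ominus> s N)" using assms CS_carrier by (intro v_abs_diff) auto
    also have "\<dots> < 1" using N False by simp
    finally show ?thesis unfolding B_def using M[of N] by linarith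
  qed
  moreover have "B > 0" unfolding B_def using M[of N] v_nonneg[OF CS_carrier[OF assms], of N] by linarith
  ultimately show ?thesis by blast
qed

lemma CS_add: assumes "s \<in> CS" "t \<in> CS" shows "(\<lambda>n. s n \<oplus> t n) \<in> CS"
proof (rule CSI)
  fix e :: real assume e: "e > 0"
  obtain N where N: "\<forall>i\<ge>N. \<forall>j\<ge>N. v (s i \<ominus> s j) < e / 2" using CSD[OF assms(1), of "e/2"] e by auto
  obtain M where M: "\<forall>i\<ge>M. \<forall>j\<ge>M. v (t i \<ominus> t j) < e / 2" using CSD[OF assms(2), of "e/2"] e by auto
  have "v ((s i \<oplus> t i) \<ominus> (s j \<oplus> t j)) < e" if "i \<ge> max N M" "j \<ge> max N M" for i j
  proof -
    have "s i \<in> carrier R" "t i \<in> carrier R" "s j \<in> carrier R" "t j \<in> carrier R" using assms CS_carrier by auto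
    hence "(s i \<oplus> t i) \<ominus> (s j \<oplus> t j) = (s i \<ominus> s j) \<oplus> (t i \<ominus> t j)" "(s i \<ominus> s j) \<in> carrier R" "(t i \<ominus> t j) \<in> carrier R"
      by algebra+
    hence "v ((s i \<oplus> t i) \<ominus> (s j \<oplus> t j)) \<le> v (s i \<ominus> s j) + v (t i \<ominus> t j)" using v_add by simp
    moreover have "v (s i \<ominus> s j) < e / 2" "v (t i \<ominus> t j) < e / 2" using N M that by auto
    ultimately show ?thesis by simp
  qed
  thus "\<exists>N. \<forall>i\<ge>N. \<forall>j\<ge>N. v ((s i \<oplus> t i) \<ominus> (s j \<oplus> t j)) < e" by blast
qed (use assms CS_carrier in auto)

lemma CS_mult: assumes "s \<in> CS" "t \<in> CS" shows "(\<lambda>n. s n \<otimes> t n) \<in> CS"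
proof (rule CSI)
  fix e :: real assume e: "e > 0"
  obtain B where B: "B > 0" "\<And>n. v (s n) \<le> B" using CS_bounded[OF assms(1)] by blast
  obtain C where C: "C > 0" "\<And>n. v (t n) \<le> C" using CS_bounded[OF assms(2)] by blast
  obtain N where N: "\<forall>i\<ge>N. \<forall>j\<ge>N. v (s i \<ominus> s j) < e / (2 * C)" using CSD[OF assms(1), of "e/(2*C)"] e C by auto
  obtain M where M: "\<forall>i\<ge>M. \<forall>j\<ge>M. v (t i \<ominus> t j) < e / (2 * B)" using CSD[OF assms(2), of "e/(2*B)"] e B by auto
  have "v ((s i \<otimes> t i) \<ominus> (s j \<otimes> t j)) < e" if "i \<ge> max N M" "j \<ge> max N M" for i j
  proof -
    have c: "s i \<in> carrier R" "t i \<in> carrier R" "s j \<in> carrier R" "t j \<in> carrier R" using assms CS_carrier by auto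
    hence "(s i \<otimes> t i) \<ominus> (s j \<otimes> t j) = (s i \<ominus> s j) \<otimes> t i \<oplus> s j \<otimes> (t i \<ominus> t j)" "(s i \<ominus> s j) \<in> carrier R" "(t i \<ominus> t j) \<in> carrier R"
      by algebra+
    hence "v ((s i \<otimes> t i) \<ominus> (s j \<otimes> t j)) \<le> v (s i \<ominus> s j) * v (t i) + v (s j) * v (t i \<ominus> t j)"
      using v_add[of "(s i \<ominus> s j) \<otimes> t i" "s j \<otimes> (t i \<ominus> t j)"] c v_mult by simp
    also have "v (s i \<ominus> s j) * v (t i) \<le> v (s i \<ominus> s j) * C" using C c v_nonneg by (intro mult_left_mono) auto
    also have "\<dots> < e / (2 * C) * C" using N that C by (intro mult_strict_right_mono) auto
    also have "v (s j) * v (t i \<ominus> t j) \<le> B * v (t i \<ominus> t j)" using B c v_nonneg by (intro mult_right_mono) auto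
    also have "\<dots> < B * (e / (2 * B))" using M that B by (intro mult_strict_left_mono) auto
    finally show ?thesis using B C by simp
  qed
  thus "\<exists>N. \<forall>i\<ge>N. \<forall>j\<ge>N. v ((s i \<otimes> t i) \<ominus> (s j \<otimes> t j)) < e" by blast
qed (use assms CS_carrier in auto)

lemma CS_minus: "s \<in> CS \<Longrightarrow> (\<lambda>n. \<ominus> s n) \<in> CS"
  using CS_mult[OF CS_const[of "\<ominus> \<one>"], of s] CS_carrier[of s] by (simp add: l_minus)

lemma cring_CR: "cring CR"
proof (rule cringI)
  show "abelian_group CR"
  proof (rule abelian_groupI)
    show "\<exists>y\<in>carrier CR. y \<oplus>\<^bsub>CR\<^esub> x = \<zero>\<^bsub>CR\<^esub>" if "x \<in> carrier CR" for x
      using that CS_minus[of x] CS_carrier[of x] by (auto simp: CR_simps l_neg intro!: bexI[of _ "\<lambda>n. \<ominus> x n"])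
  qed (auto simp: CR_simps CS_add CS_const CS_carrier a_ac)
  show "comm_monoid CR"
    by (rule comm_monoidI) (auto simp: CR_simps CS_mult CS_const CS_carrier m_ac)
qed (auto simp: CR_simps CS_carrier l_distr)

interpretation CR: cring CR by (rule cring_CR)

lemma CR_minus: "s \<in> CS \<Longrightarrow> \<ominus>\<^bsub>CR\<^esub> s = (\<lambda>n. \<ominus> s n)"
  by (rule CR.minus_equality) (auto simp: CR_simps CS_minus CS_carrier l_neg)

lemma CR_diff: "s \<in> CS \<Longrightarrow> t \<in> CS \<Longrightarrow> s \<ominus>\<^bsub>CR\<^esub> t = (\<lambda>n. s n \<ominus> t n)"
  by (simp add: a_minus_def CR_minus CR_simps)

lemma NS_subset: "NS \<subseteq> CS"
proof
  fix s assume s: "s \<in> NS"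
  hence c: "\<And>n. s n \<in> carrier R" by (simp add: null_seqs_def)
  show "s \<in> CS"
  proof (rule CSI)
    fix e :: real assume "e > 0"
    then obtain N where N: "\<And>n. n \<ge> N \<Longrightarrow> \<bar>v (s n)\<bar> < e / 2"
      using s LIMSEQ_D[of "\<lambda>n. v (s n)" 0 "e/2"] by (auto simp: null_seqs_def)
    have "v (s i \<ominus> s j) < e" if "i \<ge> N" "j \<ge> N" for i j
      using v_diff[OF c c, of i j] N[of i] N[of j] that by simp
    thus "\<exists>N. \<forall>i\<ge>N. \<forall>j\<ge>N. v (s i \<ominus> s j) < e" by blast
  qed (rule c)
qed

lemma NS_iff: "s \<in> NS \<longleftrightarrow> s \<in> CS \<and> (\<lambda>n. v (s n)) \<longlonglongrightarrow> 0"
  using NS_subset CS_carrier by (auto simp: null_seqs_def)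

lemma NS_I: "(\<And>n. s n \<in> carrier R) \<Longrightarrow> (\<lambda>n. v (s n)) \<longlonglongrightarrow> 0 \<Longrightarrow> s \<in> NS"
  by (simp add: null_seqs_def)

lemma NS_mult: assumes "s \<in> NS" "t \<in> CS" shows "(\<lambda>n. s n \<otimes> t n) \<in> NS"
proof -
  obtain B where B: "B > 0" "\<And>n. v (t n) \<le> B" using CS_bounded[OF assms(2)] by blast
  have c: "s n \<in> carrier R" "t n \<in> carrier R" for n using assms CS_carrier NS_subset by auto
  have "(\<lambda>n. v (s n) * B) \<longlonglongrightarrow> 0 * B" using assms by (intro tendsto_intros) (simp add: NS_iff)
  hence lim: "(\<lambda>n. v (s n) * B) \<longlonglongrightarrow> 0" by simp
  have "(\<lambda>n. v (s n \<otimes> t n)) \<longlonglongrightarrow> 0"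
  proof (rule null_comparison[of "\<lambda>n. v (s n) * B"])
    show "\<bar>v (s n \<otimes> t n)\<bar> \<le> v (s n) * B" for n
      using mult_left_mono[OF B(2)[of n] v_nonneg[OF c(1)[of n]]] c v_nonneg by (simp add: v_mult abs_mult)
  qed (rule lim)
  thus ?thesis by (rule NS_I[rotated]) (simp add: c)
qed

lemma ideal_NS: "ideal NS CR"
proof (rule idealI)
  show "subgroup NS (add_monoid CR)"
  proof (rule CR.add.subgroupI)
    show "NS \<subseteq> carrier CR" using NS_subset by (simp add: CR_simps)
    show "NS \<noteq> {}" using NS_I[of "\<lambda>_. \<zero>"] v_zero by auto
  next
    fix s assume "s \<in> NS"
    hence "(\<lambda>n. s n \<otimes> \<ominus> \<one>) \<in> NS" by (rule NS_mult) (simp add: CS_const)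
    moreover have "(\<lambda>n. s n \<otimes> \<ominus> \<one>) = (\<lambda>n. \<ominus> s n)" using \<open>s \<in> NS\<close> NS_subset CS_carrier[of s] by (auto simp: r_minus)
    ultimately show "\<ominus>\<^bsub>CR\<^esub> s \<in> NS" using CR_minus \<open>s \<in> NS\<close> NS_subset by auto
  next
    fix s t assume st: "s \<in> NS" "t \<in> NS"
    have c: "s n \<in> carrier R" "t n \<in> carrier R" for n using st CS_carrier NS_subset by auto
    have "(\<lambda>n. v (s n) + v (t n)) \<longlonglongrightarrow> 0 + 0" using st by (intro tendsto_intros) (auto simp: NS_iff)
    hence "(\<lambda>n. v (s n) + v (t n)) \<longlonglongrightarrow> 0" by simp
    hence "(\<lambda>n. v (s n \<oplus> t n)) \<longlonglongrightarrow> 0"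
      by (rule null_comparison) (simp add: c v_nonneg v_add)
    thus "s \<oplus>\<^bsub>CR\<^esub> t \<in> NS" using c by (auto simp: CR_simps intro!: NS_I)
  qed
next
  fix s t assume st: "s \<in> NS" "t \<in> carrier CR"
  hence c: "s n \<in> carrier R" "t n \<in> carrier R" for n using CS_carrier NS_subset by (auto simp: CR_simps)
  show "s \<otimes>\<^bsub>CR\<^esub> t \<in> NS" using NS_mult st by (auto simp: CR_simps)
  moreover have "t \<otimes>\<^bsub>CR\<^esub> s = s \<otimes>\<^bsub>CR\<^esub> t" using c by (auto simp: CR_simps m_comm)
  ultimately show "t \<otimes>\<^bsub>CR\<^esub> s \<in> NS" by simp
qed (rule CR.ring_axioms)

interpretation NS: ideal NS CR by (rule ideal_NS)

lemma one_notin_NS: "(\<lambda>_. \<one>) \<notin> NS"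
  using v_one by (auto simp: NS_iff tendsto_const_iff)

lemma CS_v_convergent: assumes "s \<in> CS" shows "convergent (\<lambda>n. v (s n))"
proof -
  have "Cauchy (\<lambda>n. v (s n))"
  proof (rule CauchyI)
    fix e :: real assume "e > 0"
    then obtain N where "\<forall>i\<ge>N. \<forall>j\<ge>N. v (s i \<ominus> s j) < e" using CSD[OF assms] by blast
    thus "\<exists>M. \<forall>m\<ge>M. \<forall>n\<ge>M. norm (v (s m) - v (s n)) < e"
      unfolding real_norm_def using v_abs_diff[OF CS_carrier[OF assms] CS_carrier[OF assms]] order_le_less_trans by blast
  qed
  thus ?thesis by (rule Cauchy_convergent)
qed

text \<open>The values of a Cauchy sequence that is not null converge to some l > 0, so from some
  index on they exceed l/2 and termwise inversion preserves the Cauchy property. The finitely many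
  zero terms are sent to zero.\<close>

lemma CS_inverse:
  assumes s: "s \<in> CS" "s \<notin> NS"
  defines "t \<equiv> (\<lambda>n. if s n = \<zero> then \<zero> else inv (s n))"
  shows "t \<in> CS" "\<forall>\<^sub>F n in sequentially. s n \<otimes> t n = \<one>"
proof -
  obtain l where l: "(\<lambda>n. v (s n)) \<longlonglongrightarrow> l" using CS_v_convergent[OF s(1)] by (auto simp: convergent_def)
  have c: "s n \<in> carrier R" for n using CS_carrier[OF s(1)] .
  have "l \<ge> 0" by (rule LIMSEQ_le_const[OF l]) (use v_nonneg c in auto)
  moreover have "l \<noteq> 0" using l s by (auto simp: NS_iff)
  ultimately have l0: "l > 0" by simp
  obtain N where N: "\<And>n. n \<ge> N \<Longrightarrow> v (s n) > l / 2"
    using order_tendstoD(1)[OF l, of "l/2"] l0 by (auto simp: eventually_sequentially)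
  have nz: "s n \<noteq> \<zero>" if "n \<ge> N" for n using N[OF that] l0 v_zero by auto
  have i: "t n \<in> carrier R" "s n \<otimes> t n = \<one>" "v (t n) < 2 / l" if "n \<ge> N" for n
  proof -
    show "t n \<in> carrier R" "s n \<otimes> t n = \<one>" using nz[OF that] c[of n] field_Units by (auto simp: t_def)
    have "v (t n) = 1 / v (s n)" using v_inv[OF c nz[OF that]] nz[OF that] by (simp add: t_def)
    also have "\<dots> < 1 / (l / 2)" using N[OF that] l0 by (intro divide_strict_left_mono) auto
    finally show "v (t n) < 2 / l" by simp
  qed
  have tc: "t n \<in> carrier R" for n using c[of n] field_Units by (auto simp: t_def)
  show "t \<in> CS"
  proof (rule CSI)
    fix e :: real assume e: "e > 0"
    obtain M where M: "\<forall>i\<ge>M. \<forall>j\<ge>M. v (s i \<ominus> s j) < e * (l / 2) * (l / 2)" using CSD[OF s(1), of "e * (l/2) * (l/2)"] e l0 by auto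
    have "v (t i \<ominus> t j) < e" if ij: "i \<ge> max N M" "j \<ge> max N M" for i j
    proof -
      have "t i \<ominus> t j = t i \<otimes> (s j \<otimes> t j) \<ominus> (s i \<otimes> t i) \<otimes> t j" using i ij tc by simp
      also have "\<dots> = \<ominus> ((s i \<ominus> s j) \<otimes> (t i \<otimes> t j))" using tc[of i] tc[of j] c[of i] c[of j] by algebra
      finally have "v (t i \<ominus> t j) = v (s i \<ominus> s j) * (v (t i) * v (t j))" using tc c by (simp add: v_minus v_mult)
      also have "\<dots> \<le> v (s i \<ominus> s j) * ((2/l) * (2/l))"
        using i(3)[of i] i(3)[of j] ij tc c v_nonneg l0 by (intro mult_left_mono mult_mono) (auto intro: less_imp_le)
      also have "\<dots> < (e * (l / 2) * (l / 2)) * ((2/l) * (2/l))" using M ij l0 by (intro mult_strict_right_mono) auto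
      finally show ?thesis using l0 by simp
    qed
    thus "\<exists>N. \<forall>i\<ge>N. \<forall>j\<ge>N. v (t i \<ominus> t j) < e" by blast
  qed (rule tc)
  show "\<forall>\<^sub>F n in sequentially. s n \<otimes> t n = \<one>" using i(2) by (auto simp: eventually_sequentially)
qed

text \<open>A strictly larger ideal contains a Cauchy sequence that is not null. Its product with
  the termwise inverse is eventually 1, so it differs from the unit by a null sequence, and the
  ideal contains the unit.\<close>

lemma maximalideal_NS: "maximalideal NS CR"
proof (rule maximalidealI)
  show "ideal NS CR" by (rule ideal_NS)
  show "carrier CR \<noteq> NS" using one_notin_NS CS_const[of \<one>] by (auto simp: CR_simps)
  fix J assume J: "ideal J CR" "NS \<subseteq> J" "J \<subseteq> carrier CR"
  interpret J: ideal J CR by fact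
  show "J = NS \<or> J = carrier CR"
  proof (rule disjCI)
    assume "J \<noteq> carrier CR"
    show "J = NS"
    proof (rule ccontr)
      assume "J \<noteq> NS"
      then obtain s where s: "s \<in> J" "s \<notin> NS" using J by auto
      hence "s \<in> CS" using J by (auto simp: CR_simps)
      then obtain t where t: "t \<in> CS" "\<forall>\<^sub>F n in sequentially. s n \<otimes> t n = \<one>" using CS_inverse s(2) by blast
      have st: "s \<otimes>\<^bsub>CR\<^esub> t \<in> J" "s \<otimes>\<^bsub>CR\<^esub> t \<in> CS" using J.I_r_closed[OF s(1), of t] t \<open>s \<in> CS\<close> CS_mult by (auto simp: CR_simps)
      have "(\<lambda>n. v (\<one> \<ominus> s n \<otimes> t n)) \<longlonglongrightarrow> 0"
        by (rule tendsto_eventually) (use t(2) in eventually_elim, simp add: a_minus_def r_neg v_zero)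
      hence "\<one>\<^bsub>CR\<^esub> \<ominus>\<^bsub>CR\<^esub> (s \<otimes>\<^bsub>CR\<^esub> t) \<in> NS"
        using CR_diff[OF CS_const[of \<one>] st(2)] CS_carrier[OF \<open>s \<in> CS\<close>] CS_carrier[OF t(1)] by (auto simp: CR_simps intro!: NS_I)
      hence "(\<one>\<^bsub>CR\<^esub> \<ominus>\<^bsub>CR\<^esub> (s \<otimes>\<^bsub>CR\<^esub> t)) \<oplus>\<^bsub>CR\<^esub> (s \<otimes>\<^bsub>CR\<^esub> t) \<in> J" using J(2) st by (intro J.a_closed) auto
      moreover have "(\<one>\<^bsub>CR\<^esub> \<ominus>\<^bsub>CR\<^esub> (s \<otimes>\<^bsub>CR\<^esub> t)) \<oplus>\<^bsub>CR\<^esub> (s \<otimes>\<^bsub>CR\<^esub> t) = \<one>\<^bsub>CR\<^esub>"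
        using st J(3) CR.one_closed by (simp add: a_minus_def CR.add.m_assoc CR.l_neg subset_iff)
      ultimately have "\<one>\<^bsub>CR\<^esub> \<in> J" by simp
      thus False using J.one_imp_carrier \<open>J \<noteq> carrier CR\<close> by simp
    qed
  qed
qed

lemma field_completion: "field (completion R v)"
  unfolding completion_def by (rule maximalideal.quotient_is_field[OF maximalideal_NS cring_CR])

definition cls where "cls s = NS +>\<^bsub>CR\<^esub> s"

lemma cls_hom: "cls \<in> Ring.ring_hom CR (completion R v)"
  using NS.rcos_ring_hom by (simp add: completion_def cls_def[abs_def])

lemma cls_closed: "s \<in> CS \<Longrightarrow> cls s \<in> carrier (completion R v)"
  and cls_mult: "s \<in> CS \<Longrightarrow> t \<in> CS \<Longrightarrow> cls s \<otimes>\<^bsub>completion R v\<^esub> cls t = cls (\<lambda>n. s n \<otimes> t n)"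
  and cls_add: "s \<in> CS \<Longrightarrow> t \<in> CS \<Longrightarrow> cls s \<oplus>\<^bsub>completion R v\<^esub> cls t = cls (\<lambda>n. s n \<oplus> t n)"
  and cls_one: "\<one>\<^bsub>completion R v\<^esub> = cls (\<lambda>_. \<one>)"
  using cls_hom by (auto simp: Ring.ring_hom_def CR_simps)

lemma cls_zero: "\<zero>\<^bsub>completion R v\<^esub> = cls (\<lambda>_. \<zero>)"
  using ring_hom_zero[OF cls_hom CR.ring_axioms field.is_ring[OF field_completion]] by (simp add: CR_simps)

lemma cls_eq_iff: "s \<in> CS \<Longrightarrow> t \<in> CS \<Longrightarrow> cls s = cls t \<longleftrightarrow> (\<lambda>n. v (s n \<ominus> t n)) \<longlonglongrightarrow> 0"
  using CR.quotient_eq_iff_same_a_r_cos[OF ideal_NS, of s t] CS_carrier[of s] CS_carrier[of t]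
  by (auto simp: CR_simps cls_def CR_diff null_seqs_def)

lemma completion_cases:
  assumes "c \<in> carrier (completion R v)" obtains s where "s \<in> CS" "c = cls s"
  using assms by (auto simp: completion_def FactRing_def A_RCOSETS_def' CR_simps cls_def)

lemma mem_cls: "s \<in> CS \<Longrightarrow> t \<in> cls s \<longleftrightarrow> t \<in> CS \<and> (\<lambda>n. v (t n \<ominus> s n)) \<longlonglongrightarrow> 0"
proof -
  assume s: "s \<in> CS"
  have "t \<in> cls s \<Longrightarrow> t \<in> CS" using NS.a_rcosets_carrier[of "cls s"] s by (auto simp: cls_def CR_simps A_RCOSETS_def')
  moreover have "t \<in> cls s \<longleftrightarrow> (\<lambda>n. v (t n \<ominus> s n)) \<longlonglongrightarrow> 0" if t: "t \<in> CS"
    using NS.a_rcos_module[of s t] s t CS_carrier[OF s] CS_carrier[OF t]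
    by (simp add: cls_def CR_simps CR_minus null_seqs_def a_minus_def)
  ultimately show ?thesis by blast
qed

text \<open>\<open>completion_abs\<close> takes the limit along a chosen representative. Two
  representatives differ by a null sequence, so any representative computes it.\<close>

lemma completion_abs_cls:
  assumes "s \<in> CS" "(\<lambda>n. v (s n)) \<longlonglongrightarrow> l" shows "completion_abs R v (cls s) = l"
proof -
  define t where "t = (SOME t. t \<in> cls s)"
  have "s \<in> cls s" using mem_cls[OF assms(1)] assms(1) CS_carrier[OF assms(1)] by (simp add: a_minus_def r_neg v_zero)
  hence "t \<in> cls s" unfolding t_def by (rule someI[of "\<lambda>t. t \<in> cls s"])
  hence t: "t \<in> CS" "(\<lambda>n. v (t n \<ominus> s n)) \<longlonglongrightarrow> 0" using mem_cls[OF assms(1)] by auto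
  have "(\<lambda>n. v (t n) - v (s n)) \<longlonglongrightarrow> 0"
    by (rule null_comparison[OF t(2)]) (use v_abs_diff CS_carrier t assms in auto)
  from tendsto_add[OF this assms(2)] have "(\<lambda>n. v (t n)) \<longlonglongrightarrow> l" by simp
  thus ?thesis unfolding completion_abs_def t_def[symmetric] by (rule limI)
qed

lemma completion_abs_lim: "s \<in> CS \<Longrightarrow> (\<lambda>n. v (s n)) \<longlonglongrightarrow> completion_abs R v (cls s)"
  using completion_abs_cls CS_v_convergent unfolding convergent_def by metis

lemma absolute_value_completion: "absolute_value (completion R v) (completion_abs R v)"
  unfolding absolute_value_def
proof (intro conjI ballI)
  fix x assume "x \<in> carrier (completion R v)"
  then obtain s where s: "s \<in> CS" "x = cls s" by (rule completion_cases)
  note ls = completion_abs_lim[OF s(1)]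
  have cs: "s n \<in> carrier R" for n using CS_carrier[OF s(1)] .
  show "0 \<le> completion_abs R v x" unfolding s by (rule LIMSEQ_le_const[OF ls]) (use v_nonneg cs in auto)
  have "x = \<zero>\<^bsub>completion R v\<^esub> \<longleftrightarrow> (\<lambda>n. v (s n)) \<longlonglongrightarrow> 0"
    using cls_eq_iff[OF s(1) CS_const[of \<zero>]] cs by (simp add: s cls_zero a_minus_def)
  also have "\<dots> \<longleftrightarrow> completion_abs R v x = 0" using ls LIMSEQ_unique unfolding s by metis
  finally show "(completion_abs R v x = 0) = (x = \<zero>\<^bsub>completion R v\<^esub>)" by simp
  fix y assume "y \<in> carrier (completion R v)"
  then obtain t where t: "t \<in> CS" "y = cls t" by (rule completion_cases)
  note lt = completion_abs_lim[OF t(1)]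
  have ct: "t n \<in> carrier R" for n using CS_carrier[OF t(1)] .
  have "(\<lambda>n. v (s n \<otimes> t n)) \<longlonglongrightarrow> completion_abs R v x * completion_abs R v y"
    using tendsto_mult[OF ls lt] cs ct by (simp add: s t v_mult)
  thus "completion_abs R v (x \<otimes>\<^bsub>completion R v\<^esub> y) = completion_abs R v x * completion_abs R v y"
    using completion_abs_cls[OF CS_mult[OF s(1) t(1)]] by (simp add: s t cls_mult)
  have "completion_abs R v (cls (\<lambda>n. s n \<oplus> t n)) \<le> completion_abs R v x + completion_abs R v y"
    by (rule LIMSEQ_le[OF completion_abs_lim[OF CS_add[OF s(1) t(1)]]])
       (use tendsto_add[OF ls lt] cs ct v_add in \<open>auto simp: s t\<close>)
  thus "completion_abs R v (x \<oplus>\<^bsub>completion R v\<^esub> y) \<le> completion_abs R v x + completion_abs R v y"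
    by (simp add: s t cls_add)
qed

lemma completion_embed_eq: "completion_embed R v x = cls (\<lambda>_. x)"
  by (simp add: completion_embed_def cls_def)

lemma completion_embed_hom: "completion_embed R v \<in> Ring.ring_hom R (completion R v)"
  by (rule ring_hom_memI) (auto simp: completion_embed_eq cls_closed CS_const cls_mult cls_add cls_one)

lemma completion_abs_embed: "x \<in> carrier R \<Longrightarrow> completion_abs R v (completion_embed R v x) = v x"
  unfolding completion_embed_eq by (rule completion_abs_cls) (auto simp: CS_const)

lemma valued_field_completion: "valued_field (completion R v) (completion_abs R v)"
  using field_completion absolute_value_completion by (simp add: valued_field_def valued_field_axioms_def)

end

subsection \<open>Subfields of the complex numbers\<close>

text \<open>Bridge from HOL-Algebra subfields to the type class operations on complex numbers, in
  which polynomials and their roots are handled.\<close>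

locale complex_subfield =
  fixes K :: "complex set"
  assumes subfield_K: "subfield K complex_ring"
begin

lemma zero_K: "0 \<in> K" and one_K: "1 \<in> K"
  and add_K: "x \<in> K \<Longrightarrow> y \<in> K \<Longrightarrow> x + y \<in> K"
  and mult_K: "x \<in> K \<Longrightarrow> y \<in> K \<Longrightarrow> x * y \<in> K"
  using subringE[OF subfieldE(1)[OF subfield_K]] by (auto simp: ring_of_type_algebra_def)

lemma uminus_K: assumes "x \<in> K" shows "- x \<in> K"
proof -
  interpret field complex_ring by (rule field_from_type_algebra)
  have "\<ominus>\<^bsub>complex_ring\<^esub> x = - x"
    by (rule minus_equality) (auto simp: ring_of_type_algebra_def)
  thus ?thesis using subringE(5)[OF subfieldE(1)[OF subfield_K]] assms by metis
qed

lemma inverse_K: assumes "x \<in> K" shows "inverse x \<in> K"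
proof (cases "x = 0")
  case False
  interpret field complex_ring by (rule field_from_type_algebra)
  have "inv\<^bsub>complex_ring\<^esub> x = inverse x"
    by (rule inv_char) (use False in \<open>auto simp: ring_of_type_algebra_def\<close>)
  moreover have "x \<in> K - {\<zero>\<^bsub>complex_ring\<^esub>}" using False assms by (simp add: ring_of_type_algebra_def)
  ultimately show ?thesis using subfield_m_inv(1)[OF subfield_K, of x] by auto
qed (simp add: zero_K)

lemma diff_K: "x \<in> K \<Longrightarrow> y \<in> K \<Longrightarrow> x - y \<in> K"
  using add_K[of x "- y"] uminus_K by simp

lemma divide_K: "x \<in> K \<Longrightarrow> y \<in> K \<Longrightarrow> x / y \<in> K"
  by (simp add: divide_inverse mult_K inverse_K)

lemma power_K: "x \<in> K \<Longrightarrow> x ^ n \<in> K"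
  by (induction n) (auto simp: one_K mult_K)

lemma sum_K: "(\<And>i. i \<in> A \<Longrightarrow> f i \<in> K) \<Longrightarrow> sum f A \<in> K"
  by (induction A rule: infinite_finite_induct) (auto simp: zero_K add_K)

lemma prod_K: "(\<And>i. i \<in> A \<Longrightarrow> f i \<in> K) \<Longrightarrow> prod f A \<in> K"
  by (induction A rule: infinite_finite_induct) (auto simp: one_K mult_K)

lemma of_nat_K: "of_nat n \<in> K"
  by (induction n) (auto simp: zero_K one_K add_K)

lemma of_int_K: "of_int n \<in> K"
  by (cases n rule: int_cases2) (auto simp: of_nat_K uminus_K)

lemma of_rat_K: "of_rat q \<in> K"
  by (cases q) (auto simp: of_rat_rat of_int_K divide_K)

lemmas closed_K = zero_K one_K add_K mult_K uminus_K inverse_K diff_K divide_K power_K of_nat_K of_int_K of_rat_K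

definition polys :: "complex poly set" where
  "polys = {p. \<forall>i. poly.coeff p i \<in> K}"

lemma polys_pCons: "pCons a p \<in> polys \<longleftrightarrow> a \<in> K \<and> p \<in> polys"
  by (auto simp: polys_def coeff_pCons all_conj_distrib split: nat.splits)

lemma polys_zero: "0 \<in> polys" by (simp add: polys_def zero_K)

lemma polys_one: "1 \<in> polys" by (simp add: polys_def zero_K one_K)

lemma polys_add: "p \<in> polys \<Longrightarrow> q \<in> polys \<Longrightarrow> p + q \<in> polys"
  by (simp add: polys_def add_K)

lemma polys_diff: "p \<in> polys \<Longrightarrow> q \<in> polys \<Longrightarrow> p - q \<in> polys"
  by (simp add: polys_def diff_K)

lemma polys_smult: "a \<in> K \<Longrightarrow> p \<in> polys \<Longrightarrow> Polynomial.smult a p \<in> polys"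
  by (simp add: polys_def mult_K)

lemma polys_mult: "p \<in> polys \<Longrightarrow> q \<in> polys \<Longrightarrow> p * q \<in> polys"
  by (auto simp: polys_def coeff_mult intro!: sum_K mult_K)

lemma polys_power: "p \<in> polys \<Longrightarrow> p ^ n \<in> polys"
  by (induction n) (auto simp: polys_one polys_mult)

lemma poly_K: "p \<in> polys \<Longrightarrow> x \<in> K \<Longrightarrow> poly p x \<in> K"
  by (induction p) (auto simp: polys_pCons zero_K add_K mult_K)

lemma polys_of_rat: "map_poly of_rat p \<in> polys"
  by (simp add: polys_def coeff_map_poly of_rat_K)

lemma nf_ring_simps:
  "carrier (nf_ring K) = K" "x \<otimes>\<^bsub>nf_ring K\<^esub> y = x * y" "x \<oplus>\<^bsub>nf_ring K\<^esub> y = x + y"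
  "\<one>\<^bsub>nf_ring K\<^esub> = 1" "\<zero>\<^bsub>nf_ring K\<^esub> = 0"
  by (simp_all add: nf_ring_def ring_of_type_algebra_def)

lemma field_nf_ring: "field (nf_ring K)"
  unfolding nf_ring_def using ring.subfield_iff(2)[OF field.is_ring[OF field_from_type_algebra] subfield_K] .

end

text \<open>A factor that is polynomial in \<open>k\<close> disappears on taking k-th roots. With s
  = sqrt(y/x) < 1 the sequence k s^k tends to 0, and its square is k^2 (y/x)^k. The shape of the
  factor is dictated by \<open>maximum_principle\<close>: kn + 1 terms, each with a coefficient
  bound of 3(kn + 1).\<close>

lemma le_of_power_le_poly:
  fixes x y :: real and n :: nat
  assumes "0 \<le> x" "0 \<le> y" "\<And>k. k \<ge> 1 \<Longrightarrow> x ^ k \<le> 3 * (real (k * n + 1))\<^sup>2 * y ^ k"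
  shows "x \<le> y"
proof (rule ccontr)
  assume xy: "\<not> x \<le> y"
  have y: "y > 0" using assms(3)[of 1] assms(1,2) xy by (cases "y = 0") auto
  define s where "s = sqrt (y / x)"
  have s: "0 \<le> s" "s < 1" "s\<^sup>2 = y / x" using y xy by (auto simp: s_def real_sqrt_lt_1_iff)
  have "(\<lambda>k. of_nat k * s ^ k) \<longlonglongrightarrow> 0" by (rule powser_times_n_limit_0) (use s in auto)
  hence "(\<lambda>k. 3 * (real n + 1)\<^sup>2 * (of_nat k * s ^ k)\<^sup>2) \<longlonglongrightarrow> 3 * (real n + 1)\<^sup>2 * 0\<^sup>2"
    by (intro tendsto_intros)
  hence "(\<lambda>k. 3 * (real n + 1)\<^sup>2 * (of_nat k * s ^ k)\<^sup>2) \<longlonglongrightarrow> 0" by simp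
  from order_tendstoD(2)[OF this, of 1] obtain N where
    N: "\<And>k. k \<ge> N \<Longrightarrow> 3 * (real n + 1)\<^sup>2 * (of_nat k * s ^ k)\<^sup>2 < 1" by (auto simp: eventually_sequentially)
  define k where "k = max 1 N"
  have k: "k \<ge> 1" "k \<ge> N" by (auto simp: k_def)
  have "x ^ k \<le> 3 * (real (k * n + 1))\<^sup>2 * y ^ k" using assms(3) k by simp
  also have "\<dots> \<le> 3 * (real k * (real n + 1))\<^sup>2 * y ^ k"
    using k y by (intro mult_right_mono mult_left_mono power_mono) (auto simp: algebra_simps)
  also have "y ^ k = (s ^ k)\<^sup>2 * x ^ k" using s(3) xy y
    by (simp add: power_mult[symmetric] mult.commute[of k] power_mult power_divide)
  also have "3 * (real k * (real n + 1))\<^sup>2 * ((s ^ k)\<^sup>2 * x ^ k) = (3 * (real n + 1)\<^sup>2 * (of_nat k * s ^ k)\<^sup>2) * x ^ k"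
    by (simp add: power_mult_distrib)
  also have "\<dots> < 1 * x ^ k" using N[OF k(2)] xy y by (intro mult_strict_right_mono) auto
  finally show False by simp
qed

subsection \<open>The maximum principle\<close>

context valued_field
begin

text \<open>Recursion on the length makes the splittings by residues of the index plain inductions;
  \<open>Omega_poly_ov\<close> connects this form with the finite sum in
  \<open>Omega_poly\<close>.\<close>

primrec psum :: "(nat \<Rightarrow> 'a) \<Rightarrow> nat \<Rightarrow> 'a \<Rightarrow> 'a" where
  "psum b 0 z = \<zero>"
| "psum b (Suc n) z = psum b n z \<oplus> b n \<otimes> z [^] n"

lemma psum_closed: "(\<And>i. b i \<in> carrier R) \<Longrightarrow> z \<in> carrier R \<Longrightarrow> psum b n z \<in> carrier R"
  by (induction n) auto

lemma psum_Suc_shift: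
  assumes "\<And>i. b i \<in> carrier R" "z \<in> carrier R"
  shows "psum b (Suc n) z = b 0 \<oplus> z \<otimes> psum (\<lambda>i. b (Suc i)) n z"
proof (induction n)
  case 0 thus ?case using assms by simp
next
  case (Suc n)
  define S w where "S = psum (\<lambda>i. b (Suc i)) n z" and "w = z [^] n"
  have c: "S \<in> carrier R" "w \<in> carrier R" "b 0 \<in> carrier R" "b (Suc n) \<in> carrier R"
    using psum_closed[of "\<lambda>i. b (Suc i)"] assms by (auto simp: S_def w_def)
  have "psum b (Suc (Suc n)) z = psum b (Suc n) z \<oplus> b (Suc n) \<otimes> (w \<otimes> z)" by (simp add: w_def)
  also have "\<dots> = (b 0 \<oplus> z \<otimes> S) \<oplus> b (Suc n) \<otimes> (w \<otimes> z)" unfolding Suc.IH S_def ..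
  also have "\<dots> = b 0 \<oplus> z \<otimes> (S \<oplus> b (Suc n) \<otimes> w)"
    using c assms(2) by algebra
  finally show ?case by (simp add: S_def w_def)
qed

lemma psum_le:
  assumes "\<And>i. b i \<in> carrier R" "z \<in> carrier R"
  shows "v (psum b n z) \<le> (\<Sum>i<n. v (b i) * v z ^ i)"
proof (induction n)
  case (Suc n)
  have "v (psum b (Suc n) z) \<le> v (psum b n z) + v (b n \<otimes> z [^] n)"
    using psum_closed[OF assms] assms by (auto intro!: v_add)
  also have "v (b n \<otimes> z [^] n) = v (b n) * v z ^ n" using assms by (simp add: v_mult v_pow)
  finally show ?case using Suc by simp
qed (simp add: v_zero)

lemma psum_extend:
  assumes "\<And>i. b i \<in> carrier R" "z \<in> carrier R" "m \<le> n" "\<And>i. m \<le> i \<Longrightarrow> b i = \<zero>"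
  shows "psum b n z = psum b m z"
  using assms(3) by (induction n rule: dec_induct) (use assms psum_closed[OF assms(1,2)] in auto)

lemma psum_split2:
  assumes "\<And>i. b i \<in> carrier R" "z \<in> carrier R"
  shows "psum b (2 * n) z = psum (\<lambda>i. b (2 * i)) n (z \<otimes> z) \<oplus> z \<otimes> psum (\<lambda>i. b (2 * i + 1)) n (z \<otimes> z)"
proof (induction n)
  case (Suc n)
  define E Od P w where "E = psum (\<lambda>i. b (2 * i)) n (z \<otimes> z)" and "Od = psum (\<lambda>i. b (2 * i + 1)) n (z \<otimes> z)"
    and "P = psum b (2 * n) z" and "w = z [^] n"
  have c: "E \<in> carrier R" "Od \<in> carrier R" "P \<in> carrier R" "w \<in> carrier R" "b (2 * n) \<in> carrier R" "b (2 * n + 1) \<in> carrier R"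
    using assms psum_closed unfolding E_def Od_def P_def w_def by auto
  have zw: "z [^] (2 * n) = w \<otimes> w" "(z \<otimes> z) [^] n = w \<otimes> w"
    using assms by (simp_all add: w_def nat_pow_mult mult_2 nat_pow_distrib)
  have "psum b (2 * Suc n) z = P \<oplus> b (2 * n) \<otimes> z [^] (2 * n) \<oplus> b (2 * n + 1) \<otimes> (z [^] (2 * n) \<otimes> z)"
    by (simp add: P_def)
  also have "\<dots> = P \<oplus> b (2 * n) \<otimes> (w \<otimes> w) \<oplus> b (2 * n + 1) \<otimes> (w \<otimes> w \<otimes> z)" unfolding zw ..
  also have "P = E \<oplus> z \<otimes> Od" using Suc.IH by (simp add: E_def Od_def P_def)
  also have "E \<oplus> z \<otimes> Od \<oplus> b (2 * n) \<otimes> (w \<otimes> w) \<oplus> b (2 * n + 1) \<otimes> (w \<otimes> w \<otimes> z)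
    = (E \<oplus> b (2 * n) \<otimes> (w \<otimes> w)) \<oplus> z \<otimes> (Od \<oplus> b (2 * n + 1) \<otimes> (w \<otimes> w))"
    using c assms(2) by algebra
  finally show ?case by (simp add: E_def Od_def zw)
qed (use assms in simp)

lemma psum_split3:
  assumes "\<And>i. b i \<in> carrier R" "z \<in> carrier R"
  shows "psum b (3 * n) z = psum (\<lambda>i. b (3 * i)) n (z \<otimes> z \<otimes> z) \<oplus> z \<otimes> psum (\<lambda>i. b (3 * i + 1)) n (z \<otimes> z \<otimes> z)
    \<oplus> z \<otimes> z \<otimes> psum (\<lambda>i. b (3 * i + 2)) n (z \<otimes> z \<otimes> z)"
proof (induction n)
  case (Suc n)
  define E Od Q P w where "E = psum (\<lambda>i. b (3 * i)) n (z \<otimes> z \<otimes> z)" and "Od = psum (\<lambda>i. b (3 * i + 1)) n (z \<otimes> z \<otimes> z)"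
    and "Q = psum (\<lambda>i. b (3 * i + 2)) n (z \<otimes> z \<otimes> z)" and "P = psum b (3 * n) z" and "w = z [^] n"
  have c: "E \<in> carrier R" "Od \<in> carrier R" "Q \<in> carrier R" "P \<in> carrier R" "w \<in> carrier R"
    "b (3 * n) \<in> carrier R" "b (3 * n + 1) \<in> carrier R" "b (3 * n + 2) \<in> carrier R"
    using assms psum_closed unfolding E_def Od_def P_def Q_def w_def by auto
  have "z [^] (3 * n) = z [^] (n + n + n)" by (simp add: numeral_3_eq_3 add.commute)
  hence zw: "z [^] (3 * n) = w \<otimes> w \<otimes> w" "(z \<otimes> z \<otimes> z) [^] n = w \<otimes> w \<otimes> w"
    using assms by (simp_all add: w_def nat_pow_mult nat_pow_distrib)
  have "psum b (3 * Suc n) z = P \<oplus> b (3 * n) \<otimes> z [^] (3 * n) \<oplus> b (3 * n + 1) \<otimes> (z [^] (3 * n) \<otimes> z)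
      \<oplus> b (3 * n + 2) \<otimes> (z [^] (3 * n) \<otimes> z \<otimes> z)"
    by (simp add: P_def numeral_3_eq_3 numeral_2_eq_2)
  also have "\<dots> = P \<oplus> b (3 * n) \<otimes> (w \<otimes> w \<otimes> w) \<oplus> b (3 * n + 1) \<otimes> (w \<otimes> w \<otimes> w \<otimes> z) \<oplus> b (3 * n + 2) \<otimes> (w \<otimes> w \<otimes> w \<otimes> z \<otimes> z)" unfolding zw ..
  also have "P = E \<oplus> z \<otimes> Od \<oplus> z \<otimes> z \<otimes> Q" using Suc.IH by (simp add: E_def Od_def P_def Q_def)
  also have "E \<oplus> z \<otimes> Od \<oplus> z \<otimes> z \<otimes> Q \<oplus> b (3 * n) \<otimes> (w \<otimes> w \<otimes> w) \<oplus> b (3 * n + 1) \<otimes> (w \<otimes> w \<otimes> w \<otimes> z) \<oplus> b (3 * n + 2) \<otimes> (w \<otimes> w \<otimes> w \<otimes> z \<otimes> z)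
    = (E \<oplus> b (3 * n) \<otimes> (w \<otimes> w \<otimes> w)) \<oplus> z \<otimes> (Od \<oplus> b (3 * n + 1) \<otimes> (w \<otimes> w \<otimes> w)) \<oplus> z \<otimes> z \<otimes> (Q \<oplus> b (3 * n + 2) \<otimes> (w \<otimes> w \<otimes> w))"
    using c assms(2) by algebra
  finally show ?case by (simp add: E_def Od_def Q_def zw)
qed (use assms in simp)

text \<open>
  Induction on \<open>k\<close>: if the sum is split into \<open>E(z\<^sup>2) + z O(z\<^sup>2)\<close>, then its values at \<open>z\<close> and \<open>- z\<close>
  bound \<open>2 E(z\<^sup>2)\<close> and \<open>2 z O(z\<^sup>2)\<close>. Square roots make every point of the unit circle a \<open>z\<^sup>2\<close>.
\<close>

lemma psum_coeff_bound2:
  assumes two: "v (\<one> \<oplus> \<one>) \<ge> 1"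
    and root: "\<And>y. y \<in> carrier R \<Longrightarrow> \<exists>z\<in>carrier R. z \<otimes> z = y"
  shows "(\<And>i. b i \<in> carrier R) \<Longrightarrow> (\<And>z. z \<in> carrier R \<Longrightarrow> v z = 1 \<Longrightarrow> v (psum b (2 ^ k) z) \<le> B)
    \<Longrightarrow> i < 2 ^ k \<Longrightarrow> v (b i) \<le> 2 ^ k * B"
proof (induction k arbitrary: b B i)
  case 0
  thus ?case using "0"(2)[of \<one>] v_one by simp
next
  case (Suc k)
  have *: "v (psum (\<lambda>i. b (2 * i)) (2 ^ k) y) \<le> 2 * B \<and> v (psum (\<lambda>i. b (2 * i + 1)) (2 ^ k) y) \<le> 2 * B"
    if y: "y \<in> carrier R" "v y = 1" for y
  proof -
    obtain z where z: "z \<in> carrier R" "z \<otimes> z = y" using root y by blast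
    have vz: "v z = 1" using v_mult[OF z(1,1)] z y v_nonneg[OF z(1)] by (auto simp: power2_eq_square[symmetric] power2_eq_1_iff)
    define E Od where "E = psum (\<lambda>i. b (2 * i)) (2 ^ k) y" and "Od = psum (\<lambda>i. b (2 * i + 1)) (2 ^ k) y"
    have c: "E \<in> carrier R" "Od \<in> carrier R" using Suc.prems y psum_closed unfolding E_def Od_def by auto
    have p: "psum b (2 ^ Suc k) z = E \<oplus> z \<otimes> Od" "psum b (2 ^ Suc k) (\<ominus> z) = E \<oplus> (\<ominus> z) \<otimes> Od"
      using psum_split2[of b _ "2 ^ k", OF Suc.prems(1) z(1)] psum_split2[of b _ "2 ^ k", OF Suc.prems(1) a_inv_closed[OF z(1)]] z y
      by (simp_all add: E_def Od_def l_minus r_minus)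
    have le: "v (E \<oplus> z \<otimes> Od) \<le> B" "v (E \<oplus> (\<ominus> z) \<otimes> Od) \<le> B"
      using Suc.prems(2)[of z] Suc.prems(2)[of "\<ominus> z"] z vz v_minus unfolding p by auto
    define M where "M = z \<otimes> Od"
    have M: "M \<in> carrier R" "v M = v Od" using c z(1) vz by (simp_all add: M_def v_mult)
    have two_c: "\<one> \<oplus> \<one> \<in> carrier R" by simp
    have Mm: "(\<ominus> z) \<otimes> Od = \<ominus> M" using c z(1) by (simp add: M_def l_minus)
    have le': "v (E \<oplus> M) \<le> B" "v (E \<ominus> M) \<le> B" using le unfolding Mm M_def[symmetric] a_minus_def by auto
    have cc: "E \<oplus> M \<in> carrier R" "E \<ominus> M \<in> carrier R" using c M by auto
    have "(E \<oplus> M) \<oplus> (E \<ominus> M) = E \<oplus> E" using c(1) M(1) by algebra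
    moreover have "(E \<oplus> M) \<ominus> (E \<ominus> M) = (E \<oplus> \<ominus> E) \<oplus> (M \<oplus> M)"
      using c(1) M(1) by (simp add: a_minus_def minus_add a_ac)
    ultimately have e1: "(\<one> \<oplus> \<one>) \<otimes> E = (E \<oplus> M) \<oplus> (E \<ominus> M)" "(\<one> \<oplus> \<one>) \<otimes> M = (E \<oplus> M) \<ominus> (E \<ominus> M)"
      using c M(1) by (simp_all add: l_distr r_neg)
    have "v (\<one> \<oplus> \<one>) * v E \<le> 2 * B"
      using v_add[OF cc] le' unfolding v_mult[OF two_c c(1), symmetric] e1 by linarith
    moreover have "v (\<one> \<oplus> \<one>) * v Od \<le> 2 * B"
      using v_diff[OF cc] le' unfolding M(2)[symmetric] v_mult[OF two_c M(1), symmetric] e1 by linarith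
    moreover have "1 * v E \<le> v (\<one> \<oplus> \<one>) * v E" "1 * v Od \<le> v (\<one> \<oplus> \<one>) * v Od"
      using mult_right_mono[OF two v_nonneg[OF c(1)]] mult_right_mono[OF two v_nonneg[OF c(2)]] by auto
    ultimately show ?thesis unfolding E_def Od_def by simp
  qed
  have "i div 2 < 2 ^ k" using Suc.prems(3) by auto
  have "v (b i) \<le> 2 ^ k * (2 * B)"
  proof (cases "even i")
    case True
    then obtain j where "i = 2 * j" by (elim evenE)
    thus ?thesis using Suc.IH[of "\<lambda>i. b (2 * i)" "2 * B" j] Suc.prems * by auto
  next
    case False
    then obtain j where "i = 2 * j + 1" by (elim oddE)
    thus ?thesis using Suc.IH[of "\<lambda>i. b (2 * i + 1)" "2 * B" j] Suc.prems * by auto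
  qed
  thus ?case by (simp add: algebra_simps)
qed

text \<open>The variant that serves the places with |2| < 1. Since \<open>t\<close> is a cube root
  of unity, u = t^2 and 1 + t + u = 0, the values at z, t z and u z, combined with the weights (1,
  1, 1), (1, u, t) and (1, t, u), give three times the parts with index 0, 1 and 2 modulo 3. Cube
  roots make every point of the unit circle a z^3.\<close>

lemma psum_coeff_bound3:
  assumes three: "v (\<one> \<oplus> \<one> \<oplus> \<one>) \<ge> 1"
    and root: "\<And>y. y \<in> carrier R \<Longrightarrow> \<exists>z\<in>carrier R. z \<otimes> z \<otimes> z = y"
    and t: "t \<in> carrier R" "t \<otimes> t \<oplus> t \<oplus> \<one> = \<zero>"
  shows "(\<And>i. b i \<in> carrier R) \<Longrightarrow> (\<And>z. z \<in> carrier R \<Longrightarrow> v z = 1 \<Longrightarrow> v (psum b (3 ^ k) z) \<le> B)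
    \<Longrightarrow> i < 3 ^ k \<Longrightarrow> v (b i) \<le> 3 ^ k * B"
proof (induction k arbitrary: b B i)
  case 0
  thus ?case using "0"(2)[of \<one>] v_one by simp
next
  case (Suc k)
  define u where "u = t \<otimes> t"
  have u: "u \<in> carrier R" using t by (simp add: u_def)
  have "t \<otimes> u = (t \<ominus> \<one>) \<otimes> (t \<otimes> t \<oplus> t \<oplus> \<one>) \<oplus> \<one>" using t(1) unfolding u_def by algebra
  hence tu: "t \<otimes> u = \<one>" using t by simp
  have uu: "u \<otimes> u = t"
  proof -
    have "u \<otimes> u = t \<otimes> (t \<otimes> u)" using t(1) unfolding u_def by algebra
    thus ?thesis using tu t by simp
  qed
  have tt: "t \<otimes> t = u" by (simp add: u_def)
  have sum0: "u \<oplus> t \<oplus> \<one> = \<zero>" using t by (simp add: u_def)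
  have vt: "v t = 1"
  proof -
    have "v t ^ 3 = v (t \<otimes> u)" using t u by (simp add: v_mult u_def power3_eq_cube)
    hence "v t ^ 3 = 1 ^ 3" using tu v_one by simp
    thus ?thesis using v_nonneg[OF t(1)] by (meson power_eq_imp_eq_base zero_le_one zero_less_numeral)
  qed
  have vu: "v u = 1" using vt t by (simp add: u_def v_mult)
  have *: "v (psum (\<lambda>i. b (3 * i)) (3 ^ k) y) \<le> 3 * B \<and> v (psum (\<lambda>i. b (3 * i + 1)) (3 ^ k) y) \<le> 3 * B
     \<and> v (psum (\<lambda>i. b (3 * i + 2)) (3 ^ k) y) \<le> 3 * B"
    if y: "y \<in> carrier R" "v y = 1" for y
  proof -
    obtain z where z: "z \<in> carrier R" "z \<otimes> z \<otimes> z = y" using root y by blast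
    have "v z ^ 3 = v y" using v_mult z by (simp add: power3_eq_cube flip: z(2))
    hence "v z ^ 3 = 1 ^ 3" using y by simp
    hence vz: "v z = 1" using v_nonneg[OF z(1)] by (meson power_eq_imp_eq_base zero_le_one zero_less_numeral)
    define E Od Q where "E = psum (\<lambda>i. b (3 * i)) (3 ^ k) y" and "Od = psum (\<lambda>i. b (3 * i + 1)) (3 ^ k) y"
      and "Q = psum (\<lambda>i. b (3 * i + 2)) (3 ^ k) y"
    have c: "E \<in> carrier R" "Od \<in> carrier R" "Q \<in> carrier R" using Suc.prems y psum_closed unfolding E_def Od_def Q_def by auto
    have cube: "(t \<otimes> z) \<otimes> (t \<otimes> z) \<otimes> (t \<otimes> z) = y" "(u \<otimes> z) \<otimes> (u \<otimes> z) \<otimes> (u \<otimes> z) = y"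
    proof -
      have "(t \<otimes> z) \<otimes> (t \<otimes> z) \<otimes> (t \<otimes> z) = (t \<otimes> u) \<otimes> (z \<otimes> z \<otimes> z)" unfolding u_def using t(1) z(1) by algebra
      thus "(t \<otimes> z) \<otimes> (t \<otimes> z) \<otimes> (t \<otimes> z) = y" using tu z y by simp
      have "(u \<otimes> z) \<otimes> (u \<otimes> z) \<otimes> (u \<otimes> z) = ((u \<otimes> u) \<otimes> u) \<otimes> (z \<otimes> z \<otimes> z)" using u z(1) by algebra
      thus "(u \<otimes> z) \<otimes> (u \<otimes> z) \<otimes> (u \<otimes> z) = y" using tu uu z y by simp
    qed
    define M N where "M = z \<otimes> Od" and "N = z \<otimes> z \<otimes> Q"
    have MN: "M \<in> carrier R" "N \<in> carrier R" using c z by (auto simp: M_def N_def)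
    define P0 P1 P2 where "P0 = E \<oplus> M \<oplus> N" and "P1 = E \<oplus> t \<otimes> M \<oplus> u \<otimes> N" and "P2 = E \<oplus> u \<otimes> M \<oplus> t \<otimes> N"
    have Pc: "P0 \<in> carrier R" "P1 \<in> carrier R" "P2 \<in> carrier R" using c MN t u by (auto simp: P0_def P1_def P2_def)
    have zz: "(t \<otimes> z) \<otimes> (t \<otimes> z) = u \<otimes> (z \<otimes> z)" "(u \<otimes> z) \<otimes> (u \<otimes> z) = t \<otimes> (z \<otimes> z)"
    proof -
      have "(t \<otimes> z) \<otimes> (t \<otimes> z) = (t \<otimes> t) \<otimes> (z \<otimes> z)" "(u \<otimes> z) \<otimes> (u \<otimes> z) = (u \<otimes> u) \<otimes> (z \<otimes> z)"
        using t(1) u z(1) by algebra+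
      thus "(t \<otimes> z) \<otimes> (t \<otimes> z) = u \<otimes> (z \<otimes> z)" "(u \<otimes> z) \<otimes> (u \<otimes> z) = t \<otimes> (z \<otimes> z)"
        unfolding tt uu .
    qed
    have p: "psum b (3 ^ Suc k) z = P0" "psum b (3 ^ Suc k) (t \<otimes> z) = P1" "psum b (3 ^ Suc k) (u \<otimes> z) = P2"
    proof -
      show "psum b (3 ^ Suc k) z = P0" using psum_split3[of b _ "3 ^ k", OF Suc.prems(1) z(1)] z by (simp add: E_def Od_def Q_def P0_def M_def N_def)
      show "psum b (3 ^ Suc k) (t \<otimes> z) = P1" using psum_split3[of b _ "3 ^ k", OF Suc.prems(1) m_closed[OF t(1) z(1)]]
        unfolding cube unfolding zz unfolding E_def[symmetric] Od_def[symmetric] Q_def[symmetric] using z(1) t(1) u c by (simp add: P1_def M_def N_def m_assoc)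
      show "psum b (3 ^ Suc k) (u \<otimes> z) = P2" using psum_split3[of b _ "3 ^ k", OF Suc.prems(1) m_closed[OF u z(1)]]
        unfolding cube unfolding zz unfolding E_def[symmetric] Od_def[symmetric] Q_def[symmetric] using z(1) t(1) u c by (simp add: P2_def M_def N_def m_assoc)
    qed
    have le: "v P0 \<le> B" "v P1 \<le> B" "v P2 \<le> B"
      using Suc.prems(2)[of z] Suc.prems(2)[of "t \<otimes> z"] Suc.prems(2)[of "u \<otimes> z"] z vz vt vu t u unfolding p by (auto simp: v_mult)
    have z0: "\<one> \<oplus> t \<oplus> u = \<zero>" "\<one> \<oplus> u \<oplus> t = \<zero>" "u \<oplus> t \<oplus> \<one> = \<zero>" using sum0 t(1) u by (simp_all add: a_ac)
    have e0: "(\<one> \<oplus> \<one> \<oplus> \<one>) \<otimes> E = P0 \<oplus> P1 \<oplus> P2"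
    proof -
      have "P0 \<oplus> P1 \<oplus> P2 = (\<one> \<oplus> \<one> \<oplus> \<one>) \<otimes> E \<oplus> (\<one> \<oplus> t \<oplus> u) \<otimes> M \<oplus> (\<one> \<oplus> u \<oplus> t) \<otimes> N"
        unfolding P0_def P1_def P2_def using c MN t(1) u by algebra simp
      thus ?thesis unfolding z0 using c MN by simp
    qed
    have e1: "(\<one> \<oplus> \<one> \<oplus> \<one>) \<otimes> M = P0 \<oplus> u \<otimes> P1 \<oplus> t \<otimes> P2"
    proof -
      have "P0 \<oplus> u \<otimes> P1 \<oplus> t \<otimes> P2 = (\<one> \<oplus> u \<oplus> t) \<otimes> E \<oplus> (\<one> \<oplus> t \<otimes> u \<oplus> t \<otimes> u) \<otimes> M \<oplus> (\<one> \<oplus> u \<otimes> u \<oplus> t \<otimes> t) \<otimes> N"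
        unfolding P0_def P1_def P2_def using c MN t(1) u by algebra simp
      thus ?thesis unfolding tu uu tt z0 using c MN by simp
    qed
    have e2: "(\<one> \<oplus> \<one> \<oplus> \<one>) \<otimes> N = P0 \<oplus> t \<otimes> P1 \<oplus> u \<otimes> P2"
    proof -
      have "P0 \<oplus> t \<otimes> P1 \<oplus> u \<otimes> P2 = (\<one> \<oplus> t \<oplus> u) \<otimes> E \<oplus> (\<one> \<oplus> t \<otimes> t \<oplus> u \<otimes> u) \<otimes> M \<oplus> (\<one> \<oplus> t \<otimes> u \<oplus> t \<otimes> u) \<otimes> N"
        unfolding P0_def P1_def P2_def using c MN t(1) u by algebra simp
      thus ?thesis unfolding tu uu tt z0 using c MN by simp
    qed
    have tri: "v (p \<oplus> q \<oplus> r) \<le> v p + v q + v r" if "p \<in> carrier R" "q \<in> carrier R" "r \<in> carrier R" for p q r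
      using v_add[of "p \<oplus> q" r] v_add[of p q] that by simp
    have vMN: "v M = v Od" "v N = v Q" using c z(1) vz by (simp_all add: M_def N_def v_mult)
    have three_c: "\<one> \<oplus> \<one> \<oplus> \<one> \<in> carrier R" by simp
    have vu': "v (u \<otimes> p) = v p" "v (t \<otimes> p) = v p" if "p \<in> carrier R" for p
      using v_mult[OF u that] v_mult[OF t(1) that] vu vt by simp_all
    have "v (\<one> \<oplus> \<one> \<oplus> \<one>) * v E \<le> 3 * B"
      using tri[OF Pc] le unfolding v_mult[OF three_c c(1), symmetric] e0 by linarith
    moreover have "v (\<one> \<oplus> \<one> \<oplus> \<one>) * v Od \<le> 3 * B"
      using tri[OF Pc(1) m_closed[OF u Pc(2)] m_closed[OF t(1) Pc(3)]] le vu'[OF Pc(2)] vu'[OF Pc(3)]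
      unfolding vMN(1)[symmetric] v_mult[OF three_c MN(1), symmetric] e1 by linarith
    moreover have "v (\<one> \<oplus> \<one> \<oplus> \<one>) * v Q \<le> 3 * B"
      using tri[OF Pc(1) m_closed[OF t(1) Pc(2)] m_closed[OF u Pc(3)]] le vu'[OF Pc(2)] vu'[OF Pc(3)]
      unfolding vMN(2)[symmetric] v_mult[OF three_c MN(2), symmetric] e2 by linarith
    moreover have "v q \<le> v (\<one> \<oplus> \<one> \<oplus> \<one>) * v q" if "q \<in> carrier R" for q
      using mult_right_mono[OF three v_nonneg[OF that]] by simp
    ultimately show ?thesis unfolding E_def[symmetric] Od_def[symmetric] Q_def[symmetric]
      using c by (meson order_trans)
  qed
  have "i mod 3 = 0 \<or> i mod 3 = 1 \<or> i mod 3 = 2" by linarith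
  moreover define j where "j = i div 3"
  moreover have "j < 3 ^ k" using Suc.prems(3) by (simp add: j_def less_mult_imp_div_less mult.commute)
  ultimately have "v (b i) \<le> 3 ^ k * (3 * B)"
  proof (elim disjE)
    assume "i mod 3 = 0" hence "i = 3 * j" using mult_div_mod_eq[of 3 i] by (simp add: j_def)
    thus ?thesis using Suc.IH[of "\<lambda>i. b (3 * i)" "3 * B" j] Suc.prems * \<open>j < 3 ^ k\<close> by auto
  next
    assume "i mod 3 = 1" hence "i = 3 * j + 1" using mult_div_mod_eq[of 3 i] by (simp add: j_def)
    thus ?thesis using Suc.IH[of "\<lambda>i. b (3 * i + 1)" "3 * B" j] Suc.prems * \<open>j < 3 ^ k\<close> by auto
  next
    assume "i mod 3 = 2" hence "i = 3 * j + 2" using mult_div_mod_eq[of 3 i] by (simp add: j_def)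
    thus ?thesis using Suc.IH[of "\<lambda>i. b (3 * i + 2)" "3 * B" j] Suc.prems * \<open>j < 3 ^ k\<close> by auto
  qed
  thus ?case by (simp add: algebra_simps)
qed

end

section \<open>Coefficient bounds over algebraically closed valued fields\<close>

context valued_field
begin

text \<open>The factor covers both variants of the bound: the least power of q = 2 or q = 3 that is
  at least \<open>d\<close> is at most 3 * max 1 d. The maximum takes care of
  \<open>d = 0\<close>.\<close>

definition unit_bounded :: "bool" where
  "unit_bounded \<longleftrightarrow> (\<forall>d B b. (\<forall>i. b i \<in> carrier R) \<longrightarrow> (\<forall>i\<ge>d. b i = \<zero>) \<longrightarrow>
     (\<forall>z\<in>carrier R. v z = 1 \<longrightarrow> v (psum b d z) \<le> B) \<longrightarrow> (\<forall>i. v (b i) \<le> 3 * real (max 1 d) * B))"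

lemma unit_boundedD:
  assumes unit_bounded "\<forall>i. b i \<in> carrier R" "\<forall>i\<ge>d. b i = \<zero>" "\<forall>z\<in>carrier R. v z = 1 \<longrightarrow> v (psum b d z) \<le> B"
  shows "v (b i) \<le> 3 * real (max 1 d) * B"
  using assms unfolding unit_bounded_def by simp

lemma exists_power_between:
  assumes "2 \<le> (q::nat)" obtains k where "d \<le> q ^ k" "q ^ k \<le> q * max 1 d"
proof -
  have ex: "\<exists>k. d \<le> q ^ k"
  proof
    have "d \<le> 2 ^ d" using less_exp[of d] by simp
    also have "\<dots> \<le> q ^ d" using assms by (rule power_mono) simp
    finally show "d \<le> q ^ d" .
  qed
  define k where "k = (LEAST k. d \<le> q ^ k)"
  have k: "d \<le> q ^ k" unfolding k_def using ex by (rule LeastI_ex)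
  moreover have "q ^ k \<le> q * max 1 d"
  proof (cases k)
    case 0 thus ?thesis using assms by simp
  next
    case (Suc j)
    have "\<not> d \<le> q ^ j" using not_less_Least[of j "\<lambda>k. d \<le> q ^ k"] Suc by (simp add: k_def)
    hence "q ^ j \<le> max 1 d" by simp
    thus ?thesis using Suc by simp
  qed
  ultimately show ?thesis using that by blast
qed

lemma unit_boundedI:
  assumes "algebraically_closed R" and "v (\<one> \<oplus> \<one>) \<ge> 1 \<or> v (\<one> \<oplus> \<one> \<oplus> \<one>) \<ge> 1"
  shows unit_bounded
proof -
  interpret algebraically_closed R by fact
  have root: "\<exists>z\<in>carrier R. eval p z = \<zero>" if p: "p \<in> carrier (poly_ring R)" "length p > 1" for p
  proof -
    have "splitted p" using roots_over_carrier[OF p(1)] .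
    hence "size (roots p) = length p - 1" by (simp add: splitted_def)
    hence "roots p \<noteq> {#}" using p by auto
    then obtain z where "z \<in># roots p" by blast
    hence "is_root p z" using roots_mem_iff_is_root[OF p(1)] by simp
    thus ?thesis by (auto simp: is_root_def)
  qed
  have pc: "p \<in> carrier (poly_ring R)" if "set p \<subseteq> carrier R" "p \<noteq> []" "hd p = \<one>" for p
    using that by (auto simp: univ_poly_def polynomial_def)
  have sq: "\<exists>z\<in>carrier R. z \<otimes> z = y" if y: "y \<in> carrier R" for y
  proof -
    obtain z where z: "z \<in> carrier R" "eval [\<one>, \<zero>, \<ominus> y] z = \<zero>" using root[of "[\<one>, \<zero>, \<ominus> y]"] pc y by auto
    hence "z \<otimes> z \<ominus> y = \<zero>" using y by (simp add: a_minus_def numeral_2_eq_2)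
    hence "z \<otimes> z = y" using r_right_minus_eq[OF m_closed[OF z(1) z(1)] y] by simp
    thus ?thesis using z by blast
  qed
  have cub: "\<exists>z\<in>carrier R. z \<otimes> z \<otimes> z = y" if y: "y \<in> carrier R" for y
  proof -
    obtain z where z: "z \<in> carrier R" "eval [\<one>, \<zero>, \<zero>, \<ominus> y] z = \<zero>" using root[of "[\<one>, \<zero>, \<zero>, \<ominus> y]"] pc y by auto
    hence "z \<otimes> z \<otimes> z \<ominus> y = \<zero>" using y by (simp add: a_minus_def numeral_2_eq_2 numeral_3_eq_3)
    hence "z \<otimes> z \<otimes> z = y" using r_right_minus_eq[OF m_closed[OF m_closed[OF z(1) z(1)] z(1)] y] by simp
    thus ?thesis using z by blast
  qed
  obtain t where t: "t \<in> carrier R" "t \<otimes> t \<oplus> t \<oplus> \<one> = \<zero>"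
  proof -
    obtain z where z: "z \<in> carrier R" "eval [\<one>, \<one>, \<one>] z = \<zero>" using root[of "[\<one>, \<one>, \<one>]"] pc by auto
    hence "z \<otimes> z \<oplus> z \<oplus> \<one> = \<zero>" by (simp add: a_assoc numeral_2_eq_2)
    thus ?thesis using that z by blast
  qed
  show ?thesis unfolding unit_bounded_def
  proof (intro allI impI)
    fix d B b i
    assume b: "\<forall>i. b i \<in> carrier R" and d: "\<forall>i\<ge>d. b i = \<zero>" and B: "\<forall>z\<in>carrier R. v z = 1 \<longrightarrow> v (psum b d z) \<le> B"
    have "v (psum b d \<one>) \<le> B" using B v_one by simp
    hence B0: "0 \<le> B" using v_nonneg[OF psum_closed[of b \<one> d]] b by auto
    have B': "v (psum b n z) \<le> B" if "z \<in> carrier R" "v z = 1" "d \<le> n" for n z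
      using psum_extend[of b z d n] b d B that by simp
    have main: "v (b i) \<le> 3 * real (max 1 d) * B" if k: "d \<le> q ^ k" "q ^ k \<le> q * max 1 d" "q \<le> 3"
      and bd: "i < q ^ k \<Longrightarrow> v (b i) \<le> real (q ^ k) * B" for q k :: nat
    proof (cases "i < q ^ k")
      case True
      have "real (q ^ k) \<le> 3 * real (max 1 d)"
      proof -
        have "q ^ k \<le> 3 * max 1 d" using k(2,3) by (meson mult_le_mono1 order_trans)
        thus ?thesis by (metis of_nat_le_iff of_nat_mult of_nat_numeral)
      qed
      hence "real (q ^ k) * B \<le> 3 * real (max 1 d) * B" using B0 by (rule mult_right_mono)
      thus ?thesis using bd[OF True] by linarith
    next
      case False
      hence "b i = \<zero>" using d k by simp
      thus ?thesis using v_zero B0 by simp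
    qed
    show "v (b i) \<le> 3 * real (max 1 d) * B"
      using assms(2)
    proof
      assume two: "v (\<one> \<oplus> \<one>) \<ge> 1"
      obtain k where k: "d \<le> 2 ^ k" "2 ^ k \<le> 2 * max 1 d" by (rule exists_power_between[of 2 d]) simp
      show ?thesis
        by (rule main[OF k]) (use psum_coeff_bound2[OF two sq, where b = b and k = k and B = B and i = i] b B' k in simp_all)
    next
      assume three: "v (\<one> \<oplus> \<one> \<oplus> \<one>) \<ge> 1"
      obtain k where k: "d \<le> 3 ^ k" "3 ^ k \<le> 3 * max 1 d" by (rule exists_power_between[of 3 d]) simp
      show ?thesis
        by (rule main[OF k]) (use psum_coeff_bound3[OF three cub t, where b = b and k = k and B = B and i = i] b B' k in simp_all)
    qed
  qed
qed

end

locale poly_evaluation = valued_field R v + complex_subfield K for R (structure) and v and K +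
  fixes h :: "complex \<Rightarrow> 'a"
  assumes h: "h \<in> Ring.ring_hom (nf_ring K) R"
begin

lemma h_closed: "x \<in> K \<Longrightarrow> h x \<in> carrier R"
  and h_mult: "x \<in> K \<Longrightarrow> y \<in> K \<Longrightarrow> h (x * y) = h x \<otimes> h y"
  and h_add: "x \<in> K \<Longrightarrow> y \<in> K \<Longrightarrow> h (x + y) = h x \<oplus> h y"
  and h_one: "h 1 = \<one>"
  using h by (auto simp: Ring.ring_hom_def nf_ring_simps)

lemma h_zero: "h 0 = \<zero>"
  using ring_hom_zero[OF h field.is_ring[OF field_nf_ring] ring_axioms] by (simp add: nf_ring_simps)

definition ev :: "complex poly \<Rightarrow> 'a \<Rightarrow> 'a" where
  "ev p z = psum (\<lambda>i. h (poly.coeff p i)) (Suc (Polynomial.degree p)) z"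

lemma ev_eq:
  assumes "p \<in> polys" "z \<in> carrier R" "Polynomial.degree p < n"
  shows "ev p z = psum (\<lambda>i. h (poly.coeff p i)) n z"
  unfolding ev_def
  by (rule psum_extend[symmetric]) (use assms in \<open>auto simp: polys_def h_closed coeff_eq_0 h_zero\<close>)

lemma ev_closed: "p \<in> polys \<Longrightarrow> z \<in> carrier R \<Longrightarrow> ev p z \<in> carrier R"
  unfolding ev_def by (rule psum_closed) (auto simp: polys_def h_closed)

lemma ev_0: "z \<in> carrier R \<Longrightarrow> ev 0 z = \<zero>"
  by (simp add: ev_def h_zero)

lemma ev_pCons:
  assumes "a \<in> K" "p \<in> polys" "z \<in> carrier R"
  shows "ev (pCons a p) z = h a \<oplus> z \<otimes> ev p z"
proof -
  have ap: "pCons a p \<in> polys" using assms by (simp add: polys_pCons)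
  have "ev (pCons a p) z = psum (\<lambda>i. h (poly.coeff (pCons a p) i)) (Suc (Suc (Polynomial.degree p))) z"
    by (rule ev_eq[OF ap assms(3)]) (simp add: degree_pCons_eq_if)
  also have "\<dots> = h (poly.coeff (pCons a p) 0) \<oplus> z \<otimes> psum (\<lambda>i. h (poly.coeff (pCons a p) (Suc i))) (Suc (Polynomial.degree p)) z"
    by (rule psum_Suc_shift) (use ap assms in \<open>auto simp: polys_def h_closed\<close>)
  finally show ?thesis by (simp add: ev_def)
qed

lemma ev_add: "p \<in> polys \<Longrightarrow> q \<in> polys \<Longrightarrow> z \<in> carrier R \<Longrightarrow> ev (p + q) z = ev p z \<oplus> ev q z"
proof (induction p arbitrary: q)
  case 0 thus ?case by (simp add: ev_0 ev_closed)
next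
  case (pCons a p)
  obtain b q' where q: "q = pCons b q'" by (cases q)
  have c: "a \<in> K" "b \<in> K" "p \<in> polys" "q' \<in> polys" using pCons.prems by (auto simp: q polys_pCons)
  hence "h a \<in> carrier R" "h b \<in> carrier R" "ev p z \<in> carrier R" "ev q' z \<in> carrier R"
    using h_closed ev_closed pCons.prems by auto
  moreover have "ev (pCons a p + q) z = (h a \<oplus> h b) \<oplus> z \<otimes> (ev p z \<oplus> ev q' z)"
    using pCons.IH[OF c(3,4) pCons.prems(3)] c pCons.prems by (simp add: q ev_pCons polys_add add_K h_add)
  ultimately show ?case using c pCons.prems(3) unfolding q by (simp add: ev_pCons r_distr a_ac)
qed

lemma ev_smult:
  "a \<in> K \<Longrightarrow> p \<in> polys \<Longrightarrow> z \<in> carrier R \<Longrightarrow> ev (Polynomial.smult a p) z = h a \<otimes> ev p z"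
proof (induction p)
  case 0 thus ?case by (simp add: ev_0 h_closed)
next
  case (pCons b p)
  have c: "b \<in> K" "p \<in> polys" using pCons.prems by (auto simp: polys_pCons)
  hence "h a \<in> carrier R" "h b \<in> carrier R" "ev p z \<in> carrier R"
    using h_closed ev_closed pCons.prems by auto
  moreover have "ev (Polynomial.smult a (pCons b p)) z = h a \<otimes> h b \<oplus> z \<otimes> (h a \<otimes> ev p z)"
    using pCons c by (simp add: ev_pCons polys_smult mult_K h_mult)
  ultimately show ?case using c pCons.prems by (simp add: ev_pCons r_distr m_lcomm)
qed

lemma ev_mult: "p \<in> polys \<Longrightarrow> q \<in> polys \<Longrightarrow> z \<in> carrier R \<Longrightarrow> ev (p * q) z = ev p z \<otimes> ev q z"
proof (induction p)
  case 0 thus ?case by (simp add: ev_0 ev_closed)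
next
  case (pCons a p)
  have c: "a \<in> K" "p \<in> polys" using pCons.prems by (auto simp: polys_pCons)
  hence d: "h a \<in> carrier R" "ev p z \<in> carrier R" "ev q z \<in> carrier R"
    using h_closed ev_closed pCons.prems by auto
  have "ev (pCons a p * q) z = ev (Polynomial.smult a q + pCons 0 (p * q)) z" by simp
  also have "\<dots> = h a \<otimes> ev q z \<oplus> z \<otimes> (ev p z \<otimes> ev q z)"
    using pCons c d by (simp add: ev_add ev_smult polys_smult polys_mult polys_pCons zero_K ev_pCons h_zero)
  finally show ?case using c d pCons.prems by (simp add: ev_pCons l_distr m_assoc)
qed

lemma ev_power: "p \<in> polys \<Longrightarrow> z \<in> carrier R \<Longrightarrow> ev (p ^ k) z = ev p z [^] k"
proof (induction k)
  case 0
  have "ev [:1:] z = \<one>" using 0 ev_pCons[of 1 0 z] by (simp add: one_K polys_zero ev_0 h_one)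
  thus ?case by (simp add: one_pCons)
qed (simp add: ev_mult polys_power ev_closed m_comm)

lemma ev_h: "p \<in> polys \<Longrightarrow> a \<in> K \<Longrightarrow> ev p (h a) = h (poly p a)"
  by (induction p) (auto simp: polys_pCons ev_0 h_zero ev_pCons h_closed h_add h_mult poly_K mult_K)

text \<open>For p^k the coefficient bound reads 3 N B^k with N = kn + 1, since the values of p^k on
  the unit circle are at most B^k. Evaluation at \<open>a\<close> adds \<open>N\<close> such terms,
  each times at most M^(kn). The result exceeds (B M^n)^k only by the factor 3 N^2, which is
  harmless because \<open>k\<close> is arbitrary.\<close>

theorem maximum_principle:
  assumes ub: unit_bounded and p: "p \<in> polys" and a: "a \<in> carrier R"
    and B: "\<And>z. z \<in> carrier R \<Longrightarrow> v z = 1 \<Longrightarrow> v (ev p z) \<le> B"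
  shows "v (ev p a) \<le> B * max 1 (v a) ^ Polynomial.degree p"
proof (rule le_of_power_le_poly[where n = "Polynomial.degree p"])
  define n where "n = Polynomial.degree p"
  define M where "M = max 1 (v a)"
  have M: "1 \<le> M" "v a \<le> M" "0 \<le> M" by (auto simp: M_def)
  have B0: "0 \<le> B" using B[of \<one>] v_one v_nonneg[OF ev_closed[OF p, of \<one>]] by auto
  show "0 \<le> v (ev p a)" using v_nonneg ev_closed p a by simp
  show "0 \<le> B * max 1 (v a) ^ Polynomial.degree p" using B0 by simp
  fix k :: nat assume "k \<ge> 1"
  define q where "q = p ^ k"
  have q: "q \<in> polys" using p polys_power by (simp add: q_def)
  have dq: "Polynomial.degree q \<le> k * n" unfolding q_def n_def by (metis degree_power_le mult.commute)
  define N where "N = Suc (k * n)"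
  have evq: "ev q z = psum (\<lambda>i. h (poly.coeff q i)) N z" if "z \<in> carrier R" for z
    using ev_eq[OF q that, of N] dq by (simp add: N_def)
  have coef: "v (h (poly.coeff q i)) \<le> 3 * real N * B ^ k" for i
  proof -
    have "\<forall>i. h (poly.coeff q i) \<in> carrier R" using q h_closed by (auto simp: polys_def)
    moreover have "\<forall>i\<ge>N. h (poly.coeff q i) = \<zero>" using dq h_zero by (auto simp: N_def coeff_eq_0)
    moreover have "\<forall>z\<in>carrier R. v z = 1 \<longrightarrow> v (psum (\<lambda>i. h (poly.coeff q i)) N z) \<le> B ^ k"
    proof (intro ballI impI)
      fix z assume z: "z \<in> carrier R" "v z = 1"
      have "v (psum (\<lambda>i. h (poly.coeff q i)) N z) = v (ev p z) ^ k"
        unfolding evq[OF z(1), symmetric] using p z by (simp add: q_def ev_power v_pow ev_closed)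
      also have "\<dots> \<le> B ^ k" by (rule power_mono[OF B[OF z] v_nonneg[OF ev_closed[OF p z(1)]]])
      finally show "v (psum (\<lambda>i. h (poly.coeff q i)) N z) \<le> B ^ k" .
    qed
    ultimately have "v (h (poly.coeff q i)) \<le> 3 * real (max 1 N) * B ^ k"
      using unit_boundedD[OF ub, where b = "\<lambda>i. h (poly.coeff q i)" and d = N and B = "B ^ k" and i = i] by simp
    thus ?thesis by (simp add: N_def)
  qed
  have "v (ev p a) ^ k = v (ev q a)" using p a by (simp add: q_def ev_power v_pow ev_closed)
  also have "\<dots> \<le> (\<Sum>i<N. v (h (poly.coeff q i)) * v a ^ i)"
    unfolding evq[OF a] by (rule psum_le) (use q a in \<open>auto simp: polys_def h_closed\<close>)
  also have "\<dots> \<le> (\<Sum>i<N. (3 * real N * B ^ k) * M ^ (k * n))"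
  proof (rule sum_mono)
    fix i assume "i \<in> {..<N}"
    hence "v a ^ i \<le> M ^ (k * n)"
      using power_mono[OF M(2) v_nonneg[OF a], of i] power_increasing[OF _ M(1), of i "k * n"] by (simp add: N_def)
    thus "v (h (poly.coeff q i)) * v a ^ i \<le> (3 * real N * B ^ k) * M ^ (k * n)"
      by (rule mult_mono[OF coef]) (use v_nonneg[OF a] B0 in simp_all)
  qed
  also have "\<dots> = 3 * (real (k * n + 1))\<^sup>2 * (B * M ^ n) ^ k"
    by (simp add: N_def power2_eq_square power_mult_distrib power_mult[symmetric] mult.commute[of n])
  finally show "v (ev p a) ^ k \<le> 3 * (real (k * Polynomial.degree p + 1))\<^sup>2 * (B * max 1 (v a) ^ Polynomial.degree p) ^ k"
    by (simp add: M_def n_def)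
qed

end

subsection \<open>Primitive elements and conjugates\<close>

abbreviation rp :: "rat poly \<Rightarrow> complex poly" where "rp \<equiv> map_poly of_rat"

lemma rp_eq_0_iff [simp]: "rp p = 0 \<longleftrightarrow> p = 0"
  by (simp add: poly_eq_iff)

lemma rp_add: "rp (p + q) = rp p + rp q"
  by (rule poly_eqI) (simp add: of_rat_add)

lemma rp_diff: "rp (p - q) = rp p - rp q"
  by (rule poly_eqI) (simp add: of_rat_diff)

lemma rp_mult: "rp (p * q) = rp p * rp q"
  by (rule poly_eqI) (simp add: coeff_mult of_rat_sum of_rat_mult)

lemma rp_smult: "rp (Polynomial.smult c p) = Polynomial.smult (of_rat c) (rp p)"
  by (rule poly_eqI) (simp add: of_rat_mult)

lemma rp_pCons: "rp (pCons c p) = pCons (of_rat c) (rp p)"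
  by (rule poly_eqI) (simp add: Polynomial.coeff_pCons split: nat.splits)

lemma rp_pderiv: "rp (pderiv p) = pderiv (rp p)"
  by (rule poly_eqI) (simp add: coeff_pderiv of_rat_mult of_rat_add)

lemma rp_1: "rp 1 = 1"
  by (rule poly_eqI) (simp add: coeff_1)

lemma rp_dvd: "p dvd q \<Longrightarrow> rp p dvd rp q"
  by (auto simp: rp_mult elim!: dvdE)

lemma cr_simps:
  "carrier complex_ring = UNIV" "x \<otimes>\<^bsub>complex_ring\<^esub> y = x * y" "x \<oplus>\<^bsub>complex_ring\<^esub> y = x + y"
  "\<one>\<^bsub>complex_ring\<^esub> = 1" "\<zero>\<^bsub>complex_ring\<^esub> = 0"
  by (simp_all add: ring_of_type_algebra_def)

interpretation RV: vector_space "\<lambda>(q::rat) (x::complex). of_rat q * x"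
  by unfold_locales (simp_all add: of_rat_add of_rat_mult algebra_simps)

text \<open>Injectivity is part of the first alternative because independence concerns the set of
  powers, in which coinciding powers would collapse.\<close>

lemma powers_independent_or_root:
  "(inj_on (\<lambda>k. c ^ k) {..<d} \<and> RV.independent ((\<lambda>k. c ^ k) ` {..<d}))
    \<or> (\<exists>p. p \<noteq> 0 \<and> Polynomial.degree p < d \<and> poly (rp p) c = 0)"
proof (rule disjCI)
  assume no: "\<nexists>p. p \<noteq> 0 \<and> Polynomial.degree p < d \<and> poly (rp p) c = 0"
  have no': "p = 0" if "\<And>i. i \<ge> d \<Longrightarrow> poly.coeff p i = 0" "poly (rp p) c = 0" "d > 0" for p
  proof (rule ccontr)
    assume "p \<noteq> 0"
    have "Polynomial.degree p < d" using that \<open>p \<noteq> 0\<close> by (metis leading_coeff_0_iff not_le)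
    thus False using no that \<open>p \<noteq> 0\<close> by blast
  qed
  have inj: "inj_on (\<lambda>k. c ^ k) {..<d}"
  proof (rule inj_onI)
    fix i j assume ij: "i \<in> {..<d}" "j \<in> {..<d}" "c ^ i = c ^ j"
    have "Polynomial.monom 1 i - Polynomial.monom 1 j = (0 :: rat poly)"
      by (rule no') (use ij in \<open>auto simp: rp_diff poly_monom\<close>)
    hence "poly.coeff (Polynomial.monom 1 i - Polynomial.monom 1 j :: rat poly) i = 0" by simp
    thus "i = j" by (auto split: if_splits)
  qed
  moreover have "RV.independent ((\<lambda>k. c ^ k) ` {..<d})"
  proof (rule ccontr)
    assume "\<not> ?thesis"
    then obtain u where u: "\<exists>x\<in>(\<lambda>k. c ^ k) ` {..<d}. u x \<noteq> 0" "(\<Sum>x\<in>(\<lambda>k. c ^ k) ` {..<d}. of_rat (u x) * x) = 0"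
      using RV.dependent_finite[of "(\<lambda>k. c ^ k) ` {..<d}"] by auto
    obtain k where k: "k < d" "u (c ^ k) \<noteq> 0" using u(1) by auto
    define p where "p = (\<Sum>k<d. Polynomial.monom (u (c ^ k)) k)"
    have cf: "poly.coeff p i = (if i < d then u (c ^ i) else 0)" for i
      by (simp add: p_def coeff_sum)
    have "poly (rp p) c = (\<Sum>k<d. of_rat (u (c ^ k)) * c ^ k)"
    proof -
      have "rp p = (\<Sum>k<d. Polynomial.monom (of_rat (u (c ^ k))) k)"
        by (rule poly_eqI) (simp add: cf coeff_sum)
      thus ?thesis by (simp add: poly_sum poly_monom)
    qed
    also have "\<dots> = 0" using u(2) by (simp add: sum.reindex[OF inj])
    finally have "p = 0" using no'[of p] cf k by simp
    thus False using cf[of k] k by simp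
  qed
  ultimately show "inj_on (\<lambda>k. c ^ k) {..<d} \<and> RV.independent ((\<lambda>k. c ^ k) ` {..<d})" by simp
qed

lemma subfield_Rats: "subfield \<rat> complex_ring"
proof -
  interpret C: field complex_ring by (rule field_from_type_algebra)
  have m: "\<ominus>\<^bsub>complex_ring\<^esub> x = - x" for x
    by (rule C.minus_equality) (auto simp: ring_of_type_algebra_def)
  have i: "inv\<^bsub>complex_ring\<^esub> x = inverse x" if "x \<noteq> 0" for x
    by (rule C.inv_char) (use that in \<open>auto simp: ring_of_type_algebra_def\<close>)
  show ?thesis
  proof (rule C.subfieldI'[OF C.subringI])
    show "\<ominus>\<^bsub>complex_ring\<^esub> h \<in> \<rat>" if "h \<in> \<rat>" for h unfolding m using that by simp
    show "inv\<^bsub>complex_ring\<^esub> k \<in> \<rat>" if "k \<in> \<rat> - {\<zero>\<^bsub>complex_ring\<^esub>}" for k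
      using that i[of k] by (auto simp: ring_of_type_algebra_def)
  qed (auto simp: ring_of_type_algebra_def)
qed

lemma complex_subfield_rat_polys:
  assumes K: "number_field K" and t: "t \<in> K"
  shows "complex_subfield {poly (rp h) t | h. True}"
proof -
  interpret C: field complex_ring by (rule field_from_type_algebra)
  have "C.algebraic \<rat> t"
    using C.finite_dimension_imp_algebraic[OF subfield_Rats subfieldE(1)] K t unfolding number_field_def over_def by blast
  hence sf: "subfield (C.simple_extension \<rat> t) complex_ring"
    using C.simple_extension_is_subfield[OF subfield_Rats, of t] by (simp add: over_def ring_of_type_algebra_def)
  have "C.simple_extension \<rat> t = {poly (rp h) t | h. True}"
  proof (intro equalityI subsetI)
    fix x assume "x \<in> C.simple_extension \<rat> t"
    thus "x \<in> {poly (rp h) t | h. True}"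
    proof (induction rule: C.simple_extension.induct)
      case zero
      have "0 = poly (rp 0) t" by simp
      hence "\<exists>h. 0 = poly (rp h) t" by blast
      thus ?case by (simp add: ring_of_type_algebra_def)
    next
      case (lin k1 k2)
      then obtain h q where "k1 = poly (rp h) t" "k2 = of_rat q" by (auto elim!: Rats_cases)
      hence "k1 * t + k2 = poly (rp (pCons q h)) t" by (simp add: rp_pCons)
      hence "\<exists>h. k1 * t + k2 = poly (rp h) t" by blast
      thus ?case by (simp add: ring_of_type_algebra_def)
    qed
  next
    fix x assume "x \<in> {poly (rp h) t | h. True}"
    then obtain h where "x = poly (rp h) t" by auto
    moreover have "poly (rp h) t \<in> C.simple_extension \<rat> t"
    proof (induction h)
      case 0 thus ?case using C.simple_extension.zero[of \<rat> t] by (simp add: ring_of_type_algebra_def)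
    next
      case (pCons q h)
      show ?case using C.simple_extension.lin[OF pCons.IH, of "of_rat q"]
        by (simp add: ring_of_type_algebra_def rp_pCons algebra_simps)
    qed
    ultimately show "x \<in> C.simple_extension \<rat> t" by simp
  qed
  thus ?thesis using sf by (simp add: complex_subfield_def)
qed

lemma (in complex_subfield) polys_pcompose: "p \<in> polys \<Longrightarrow> q \<in> polys \<Longrightarrow> pcompose p q \<in> polys"
  by (induction p) (auto simp: polys_pCons pcompose_pCons polys_zero intro!: polys_add polys_mult)

lemma (in complex_subfield) polys_pderiv: "p \<in> polys \<Longrightarrow> pderiv p \<in> polys"
  by (auto simp: polys_def coeff_pderiv intro!: mult_K) (metis of_nat_K of_nat_Suc)

text \<open>Leading terms are removed by multiples of \<open>h\<close> with coefficients in
  \<open>K\<close>. Thus every intermediate polynomial stays in \<open>polys\<close> and still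
  vanishes at \<open>b\<close>, and the minimality of \<open>h\<close> guarantees that there is
  always room for the next step.\<close>

lemma (in complex_subfield) minimal_dvd:
  assumes h: "h \<in> polys" "h \<noteq> 0" "poly h b = 0"
    and min: "\<And>q. q \<in> polys \<Longrightarrow> q \<noteq> 0 \<Longrightarrow> poly q b = 0 \<Longrightarrow> Polynomial.degree h \<le> Polynomial.degree q"
  shows "p \<in> polys \<Longrightarrow> poly p b = 0 \<Longrightarrow> h dvd p"
proof (induction "Polynomial.degree p" arbitrary: p rule: less_induct)
  case less
  show ?case
  proof (cases "p = 0")
    case False
    define c where "c = Polynomial.lead_coeff p / Polynomial.lead_coeff h"
    define k where "k = Polynomial.degree p - Polynomial.degree h"
    define s where "s = Polynomial.monom c k * h"
    have le: "Polynomial.degree h \<le> Polynomial.degree p" using min less.prems False by simp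
    have c: "c \<in> K" "c \<noteq> 0" using less.prems h False by (auto simp: c_def polys_def intro!: divide_K)
    have s: "s \<in> polys" "poly s b = 0" "h dvd s"
      using c h by (auto simp: s_def polys_def coeff_monom_mult mult_K zero_K)
    have ds0: "Polynomial.degree s = Polynomial.degree p"
      using c h le by (simp add: s_def degree_mult_eq monom_eq_0_iff degree_monom_eq k_def)
    have "Polynomial.lead_coeff s = Polynomial.lead_coeff (Polynomial.monom c k) * Polynomial.lead_coeff h"
      unfolding s_def by (rule lead_coeff_mult)
    hence ds: "Polynomial.degree s = Polynomial.degree p" "Polynomial.lead_coeff s = Polynomial.lead_coeff p"
      using c h ds0 by (auto simp: degree_monom_eq c_def)
    have ps: "p - s \<in> polys" "poly (p - s) b = 0" using less.prems s polys_diff by auto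
    have "h dvd p - s"
    proof (cases "p - s = 0")
      case nz: False
      have "Polynomial.degree (p - s) < Polynomial.degree p"
      proof (rule ccontr)
        assume "\<not> ?thesis"
        hence "Polynomial.degree (p - s) = Polynomial.degree p"
          using degree_diff_le[of p "Polynomial.degree p" s] ds by simp
        hence "poly.coeff (p - s) (Polynomial.degree p) \<noteq> 0" using nz by (metis leading_coeff_0_iff)
        thus False using ds by simp
      qed
      thus ?thesis using less.hyps ps by blast
    qed simp
    thus ?thesis using s(3) by (metis dvd_add diff_add_cancel)
  qed simp
qed

text \<open>With t = a + l b, the element \<open>b\<close> is a common root of \<open>pb\<close> and
  of pa(t - l x), two polynomials over Q(t). For \<open>l\<close> outside a finite set there is no
  other common root, so the minimal polynomial \<open>h\<close> of \<open>b\<close> over Q(t) has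
  \<open>b\<close> as its only complex root. The root is simple, because the derivative has smaller
  degree and cannot vanish at \<open>b\<close>. So \<open>h\<close> is linear, and \<open>b\<close>
  and then \<open>a\<close> lie in Q(t).\<close>

lemma primitive_element_two:
  fixes a b :: complex
  assumes a: "pa \<noteq> 0" "poly (rp pa) a = 0" and b: "pb \<noteq> 0" "poly (rp pb) b = 0"
    and sf: "\<And>l::rat. complex_subfield {poly (rp h) (a + of_rat l * b) | h. True}"
  obtains l :: rat where "a \<in> {poly (rp h) (a + of_rat l * b) | h. True}" "b \<in> {poly (rp h) (a + of_rat l * b) | h. True}"
proof -
  \<comment> \<open>Pairs with b' = b contribute 0 by the convention for division, which only
    excludes \<open>l = 0\<close> in addition.\<close>
  define S where "S = (\<lambda>(a', b'). (a' - a) / (b - b')) ` ({x. poly (rp pa) x = 0} \<times> {x. poly (rp pb) x = 0})"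
  have "finite S" unfolding S_def using a b by (intro finite_imageI finite_cartesian_product poly_roots_finite) auto
  moreover have "infinite (range (of_rat :: rat \<Rightarrow> complex))"
    using finite_imageD[of "of_rat :: rat \<Rightarrow> complex" UNIV] infinite_UNIV_char_0 by (auto simp: inj_on_def)
  ultimately obtain l where l: "of_rat l \<notin> S" using finite_subset[of "range (of_rat :: rat \<Rightarrow> complex)" S] by blast
  define t where "t = a + of_rat l * b"
  define F where "F = {poly (rp h) t | h. True}"
  interpret F: complex_subfield F unfolding F_def t_def by (rule sf)
  have "t = poly (rp [:0, 1:]) t" by (simp add: rp_pCons)
  hence tF: "t \<in> F" unfolding F_def by blast
  define P1 where "P1 = rp pb"
  define P2 where "P2 = pcompose (rp pa) [:t, - of_rat l:]"
  have P1: "P1 \<in> F.polys" "P1 \<noteq> 0" "poly P1 b = 0" unfolding P1_def using b F.polys_of_rat by auto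
  have P2: "P2 \<in> F.polys" "poly P2 b = 0" unfolding P2_def
    using a F.polys_of_rat tF by (auto intro!: F.polys_pcompose simp: F.polys_pCons F.polys_zero F.of_rat_K F.uminus_K poly_pcompose t_def)
  define A where "A q \<longleftrightarrow> q \<in> F.polys \<and> q \<noteq> 0 \<and> poly q b = 0" for q
  obtain h where h: "A h" "\<And>q. A q \<Longrightarrow> Polynomial.degree h \<le> Polynomial.degree q"
    using ex_has_least_nat[of A P1 Polynomial.degree] P1 by (auto simp: A_def)
  have dvd: "h dvd P1" "h dvd P2"
    using F.minimal_dvd[of h b] h P1 P2 by (auto simp: A_def)
  have root: "x = b" if x: "poly h x = 0" for x
  proof (rule ccontr)
    assume xb: "x \<noteq> b"
    have "poly P1 x = 0" "poly P2 x = 0" using dvd x by (auto elim!: dvdE)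
    hence "poly (rp pb) x = 0" "poly (rp pa) (t - of_rat l * x) = 0" by (auto simp: P1_def P2_def poly_pcompose mult.commute)
    hence "((t - of_rat l * x) - a) / (b - x) \<in> S" unfolding S_def by force
    moreover have "((t - of_rat l * x) - a) / (b - x) = of_rat l" using xb by (simp add: t_def field_simps)
    ultimately show False using l by simp
  qed
  have "Polynomial.degree h > 0"
  proof (rule ccontr)
    assume "\<not> ?thesis"
    then obtain c where "h = [:c:]" by (metis degree_eq_zeroE gr0I)
    thus False using h(1) by (auto simp: A_def)
  qed
  hence "pderiv h \<noteq> 0" by (simp add: pderiv_eq_0_iff)
  moreover have "Polynomial.degree (pderiv h) < Polynomial.degree h" using \<open>Polynomial.degree h > 0\<close> by (simp add: degree_pderiv)
  ultimately have "poly (pderiv h) b \<noteq> 0" using h(2)[of "pderiv h"] h(1) F.polys_pderiv by (auto simp: A_def)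
  moreover obtain s where s: "h = [:- b, 1:] * s" using h(1) by (auto simp: A_def poly_eq_0_iff_dvd elim: dvdE)
  moreover have "pderiv h = [:- b, 1:] * pderiv s + s * pderiv [:- b, 1:]" unfolding s by (rule pderiv_mult)
  ultimately have sb: "poly s b \<noteq> 0" by (simp add: pderiv_pCons)
  have "\<not> (\<exists>z. poly s z = 0)" using root sb s by auto
  hence "constant (poly s)" using fundamental_theorem_of_algebra by blast
  hence "Polynomial.degree s = 0" by (simp add: constant_degree)
  then obtain c where c: "s = [:c:]" by (metis degree_eq_zeroE)
  have "c \<noteq> 0" using sb c by simp
  have "poly.coeff h 1 = c" "poly.coeff h 0 = - b * c" by (auto simp: s c)
  moreover have "poly.coeff h i \<in> F" for i using h(1) by (simp add: A_def F.polys_def)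
  ultimately have "c \<in> F" "- b * c \<in> F" by metis+
  hence "- ((- b * c) / c) \<in> F" using F.divide_K F.uminus_K by blast
  hence bF: "b \<in> F" using \<open>c \<noteq> 0\<close> by simp
  have "t - of_rat l * b \<in> F" by (rule F.diff_K[OF tF F.mult_K[OF F.of_rat_K bF]])
  hence "a \<in> F" by (simp add: t_def)
  thus ?thesis using that bF unfolding F_def t_def by blast
qed

definition rat_deg :: "complex \<Rightarrow> nat" where
  "rat_deg c = (LEAST d. \<exists>p. p \<noteq> 0 \<and> Polynomial.degree p = d \<and> poly (rp p) c = 0)"

lemma rat_deg_le: "p \<noteq> 0 \<Longrightarrow> poly (rp p) c = 0 \<Longrightarrow> rat_deg c \<le> Polynomial.degree p"
  unfolding rat_deg_def by (rule Least_le) blast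

lemma rat_deg_obtain:
  assumes "\<exists>p. p \<noteq> 0 \<and> poly (rp p) c = 0"
  obtains p where "p \<noteq> 0" "Polynomial.degree p = rat_deg c" "poly (rp p) c = 0"
proof -
  have "\<exists>p. p \<noteq> 0 \<and> Polynomial.degree p = rat_deg c \<and> poly (rp p) c = 0"
    unfolding rat_deg_def
    by (rule LeastI_ex[of "\<lambda>d. \<exists>p. p \<noteq> 0 \<and> Polynomial.degree p = d \<and> poly (rp p) c = 0"]) (use assms in blast)
  thus ?thesis using that by blast
qed

lemma number_field_subset_span:
  assumes "number_field K"
  obtains B where "finite B" "K \<subseteq> RV.span B"
proof -
  interpret C: field complex_ring by (rule field_from_type_algebra)
  obtain n where "C.dimension n \<rat> K" using assms unfolding number_field_def by blast
  then obtain Us where Us: "C.Span \<rat> Us = K" using C.exists_base[OF subfield_Rats] by blast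
  have "C.Span \<rat> Us \<subseteq> RV.span (set Us)"
  proof (induction Us)
    case Nil thus ?case by (auto simp: cr_simps RV.span_zero)
  next
    case (Cons a Us)
    show ?case
    proof
      fix x assume "x \<in> C.Span \<rat> (a # Us)"
      then obtain k y where ky: "k \<in> \<rat>" "y \<in> C.Span \<rat> Us" "x = k * a + y"
        by (auto simp: C.line_extension_mem_iff cr_simps)
      obtain q where q: "k = of_rat q" using ky(1) by (auto elim: Rats_cases)
      have "of_rat q * a \<in> RV.span (set (a # Us))" by (rule RV.span_scale) (simp add: RV.span_base)
      moreover have "y \<in> RV.span (set (a # Us))" using ky(2) Cons.IH RV.span_mono[of "set Us" "set (a # Us)"] by auto
      ultimately show "x \<in> RV.span (set (a # Us))" unfolding ky q by (rule RV.span_add)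
    qed
  qed
  thus ?thesis using that[of "set Us"] Us by simp
qed

lemma rat_polys_span:
  "{poly (rp h) c | h. Polynomial.degree h < d} \<subseteq> RV.span ((\<lambda>k. c ^ k) ` {..<d})"
proof
  fix x assume "x \<in> {poly (rp h) c | h. Polynomial.degree h < d}"
  then obtain h where h: "x = poly (rp h) c" "Polynomial.degree h < d" by auto
  have "x = (\<Sum>i\<le>Polynomial.degree h. of_rat (poly.coeff h i) * c ^ i)" unfolding h by (simp add: poly_altdef)
  also have "\<dots> \<in> RV.span ((\<lambda>k. c ^ k) ` {..<d})"
    using h(2) by (intro RV.span_sum RV.span_scale RV.span_base) auto
  finally show "x \<in> RV.span ((\<lambda>k. c ^ k) ` {..<d})" .
qed

lemma rat_polys_reduce:
  assumes g: "g \<noteq> 0" "poly (rp g) c = 0"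
  shows "\<exists>r. (r = 0 \<or> Polynomial.degree r < Polynomial.degree g) \<and> poly (rp r) c = poly (rp h) c"
proof (intro exI conjI)
  have "h = (h div g) * g + h mod g" by simp
  hence "rp h = rp (h div g) * rp g + rp (h mod g)" by (metis rp_add rp_mult)
  thus "poly (rp (h mod g)) c = poly (rp h) c" using g by simp
  show "h mod g = 0 \<or> Polynomial.degree (h mod g) < Polynomial.degree g" using degree_mod_less[OF g(1)] .
qed

lemma span_subset_rat_polys:
  "RV.span ((\<lambda>k. c ^ k) ` S) \<subseteq> {poly (rp h) c | h. True}"
proof (rule RV.span_minimal)
  show "(\<lambda>k. c ^ k) ` S \<subseteq> {poly (rp h) c | h. True}"
  proof
    fix x assume "x \<in> (\<lambda>k. c ^ k) ` S"
    then obtain k where "x = poly (rp (Polynomial.monom 1 k)) c" by (auto simp: poly_monom)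
    thus "x \<in> {poly (rp h) c | h. True}" by blast
  qed
  show "RV.subspace {poly (rp h) c | h. True}"
  proof (rule RV.subspaceI)
    have "0 = poly (rp 0) c" by simp
    thus "0 \<in> {poly (rp h) c | h. True}" by blast
  next
    fix x y assume "x \<in> {poly (rp h) c | h. True}" "y \<in> {poly (rp h) c | h. True}"
    then obtain h1 h2 where "x = poly (rp h1) c" "y = poly (rp h2) c" by blast
    hence "x + y = poly (rp (h1 + h2)) c" by (simp add: rp_add)
    thus "x + y \<in> {poly (rp h) c | h. True}" by blast
  next
    fix q x assume "x \<in> {poly (rp h) c | h. True}"
    then obtain h1 where "x = poly (rp h1) c" by blast
    hence "of_rat q * x = poly (rp (Polynomial.smult q h1)) c" by (simp add: rp_smult)
    thus "of_rat q * x \<in> {poly (rp h) c | h. True}" by blast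
  qed
qed

text \<open>Degrees of elements are bounded by the dimension, so some \<open>a\<close> has maximal
  degree \<open>d\<close>. For \<open>b\<close> outside Q[a], the field Q[t] of
  \<open>primitive_element_two\<close> would contain the d + 1 independent elements 1, ..., a^(d-1),
  b, although its dimension is at most the degree of \<open>t\<close>, hence at most
  \<open>d\<close>.\<close>

theorem primitive_element:
  assumes K: "number_field K"
  obtains c where "c \<in> K" "c \<noteq> 0" "\<And>y. y \<in> K \<Longrightarrow> \<exists>h. y = poly (rp h) c" "\<exists>p. p \<noteq> 0 \<and> poly (rp p) c = 0"
proof -
  interpret K: complex_subfield K using K by (simp add: number_field_def complex_subfield_def)
  obtain B where B: "finite B" "K \<subseteq> RV.span B" using number_field_subset_span[OF K] .
  define N where "N = Suc (card B)"
  have root: "\<exists>p. p \<noteq> 0 \<and> Polynomial.degree p < N \<and> poly (rp p) c = 0" if c: "c \<in> K" for c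
  proof (rule ccontr)
    assume "\<not> ?thesis"
    hence *: "inj_on (\<lambda>k. c ^ k) {..<N}" "RV.independent ((\<lambda>k. c ^ k) ` {..<N})"
      using powers_independent_or_root[of c N] by blast+
    have "(\<lambda>k. c ^ k) ` {..<N} \<subseteq> RV.span B" using B(2) K.power_K[OF c] by auto
    from RV.independent_span_bound[OF B(1) *(2) this] show False using card_image[OF *(1)] by (simp add: N_def)
  qed
  have "\<exists>c. c \<in> K \<and> (\<forall>c'. c' \<in> K \<longrightarrow> rat_deg c' \<le> rat_deg c)"
  proof (rule ex_has_greatest_nat)
    show "(1::complex) \<in> K" by (rule K.one_K)
    show "\<forall>c'. c' \<in> K \<longrightarrow> rat_deg c' < N"
      using root rat_deg_le by (meson order_le_less_trans)
  qed
  then obtain a where a: "a \<in> K" "\<And>c. c \<in> K \<Longrightarrow> rat_deg c \<le> rat_deg a" by blast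
  obtain pa where pa: "pa \<noteq> 0" "Polynomial.degree pa = rat_deg a" "poly (rp pa) a = 0"
    using rat_deg_obtain[of a] root[OF a(1)] by blast
  have ind: "inj_on (\<lambda>k. a ^ k) {..<rat_deg a}" "RV.independent ((\<lambda>k. a ^ k) ` {..<rat_deg a})"
  proof -
    have "\<not> (\<exists>p. p \<noteq> 0 \<and> Polynomial.degree p < rat_deg a \<and> poly (rp p) a = 0)"
      using rat_deg_le[of _ a] by (meson not_le)
    thus "inj_on (\<lambda>k. a ^ k) {..<rat_deg a}" "RV.independent ((\<lambda>k. a ^ k) ` {..<rat_deg a})"
      using powers_independent_or_root[of a "rat_deg a"] by blast+
  qed
  have gen: "b \<in> {poly (rp h) a | h. True}" if b: "b \<in> K" for b
  proof (rule ccontr)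
    assume no: "b \<notin> {poly (rp h) a | h. True}"
    hence nospan: "b \<notin> RV.span ((\<lambda>k. a ^ k) ` {..<rat_deg a})" using span_subset_rat_polys by blast
    obtain pb where pb: "pb \<noteq> 0" "poly (rp pb) b = 0" using root[OF b] by blast
    have "complex_subfield {poly (rp h) (a + of_rat l * b) | h. True}" for l
      by (rule complex_subfield_rat_polys[OF K]) (rule K.add_K[OF a(1) K.mult_K[OF K.of_rat_K b]])
    from primitive_element_two[OF pa(1,3) pb this] obtain l where
      l: "a \<in> {poly (rp h) (a + of_rat l * b) | h. True}" "b \<in> {poly (rp h) (a + of_rat l * b) | h. True}" .
    define t where "t = a + of_rat l * b"
    have tK: "t \<in> K" unfolding t_def by (rule K.add_K[OF a(1) K.mult_K[OF K.of_rat_K b]])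
    interpret F: complex_subfield "{poly (rp h) t | h. True}" by (rule complex_subfield_rat_polys[OF K tK])
    obtain pt where pt: "pt \<noteq> 0" "Polynomial.degree pt = rat_deg t" "poly (rp pt) t = 0"
      using rat_deg_obtain[of t] root[OF tK] by blast
    have dt: "rat_deg t > 0"
    proof (rule ccontr)
      assume "\<not> ?thesis"
      then obtain q where "pt = [:q:]" using pt(2) by (metis degree_eq_zeroE gr0I)
      thus False using pt by (auto simp: rp_pCons)
    qed
    have sub: "{poly (rp h) t | h. True} \<subseteq> RV.span ((\<lambda>k. t ^ k) ` {..<rat_deg t})"
    proof
      fix x assume "x \<in> {poly (rp h) t | h. True}"
      then obtain h where "x = poly (rp h) t" by blast
      then obtain r where "r = 0 \<or> Polynomial.degree r < rat_deg t" "x = poly (rp r) t"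
        using rat_polys_reduce[OF pt(1,3)] pt(2) by metis
      hence "x \<in> {poly (rp h) t | h. Polynomial.degree h < rat_deg t}" using dt by force
      thus "x \<in> RV.span ((\<lambda>k. t ^ k) ` {..<rat_deg t})" using rat_polys_span by blast
    qed
    define A where "A = insert b ((\<lambda>k. a ^ k) ` {..<rat_deg a})"
    have "b \<notin> (\<lambda>k. a ^ k) ` {..<rat_deg a}"
      using nospan RV.span_superset[of "(\<lambda>k. a ^ k) ` {..<rat_deg a}"] by auto
    hence cardA: "card A = Suc (rat_deg a)" unfolding A_def using card_image[OF ind(1)] by simp
    have "RV.independent A" unfolding A_def using ind(2) nospan by (simp add: RV.independent_insert)
    moreover have "A \<subseteq> {poly (rp h) t | h. True}"
    proof -
      have "a ^ k \<in> {poly (rp h) t | h. True}" for k by (rule F.power_K) (use l(1) in \<open>simp add: t_def\<close>)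
      moreover have "b \<in> {poly (rp h) t | h. True}" using l(2) by (simp add: t_def)
      ultimately show ?thesis unfolding A_def by (intro insert_subsetI image_subsetI)
    qed
    hence "A \<subseteq> RV.span ((\<lambda>k. t ^ k) ` {..<rat_deg t})" using sub by (rule subset_trans)
    ultimately have "card A \<le> card ((\<lambda>k. t ^ k) ` {..<rat_deg t})"
      using RV.independent_span_bound[OF finite_imageI[OF finite_lessThan], of A] by simp
    also have "\<dots> \<le> rat_deg t" using card_image_le[of "{..<rat_deg t}"] by simp
    also have "\<dots> \<le> rat_deg a" by (rule a(2)[OF tK])
    finally show False using cardA by simp
  qed
  show ?thesis
  proof (cases "a = 0")
    case False
    thus ?thesis using that[of a] a(1) gen pa by blast
  next
    \<comment> \<open>Here every element of \<open>K\<close> is rational. The generator 0 is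
      replaced by 1, since powers of the generator are divided out later.\<close>
    case True
    show ?thesis
    proof (rule that[of 1])
      show "\<exists>h. y = poly (rp h) 1" if y: "y \<in> K" for y
      proof -
        obtain h where "y = poly (rp h) 0" using gen[OF y] True by blast
        hence "y = poly (rp [:poly.coeff h 0:]) 1" by (simp add: rp_pCons poly_0_coeff_0)
        thus ?thesis by blast
      qed
      show "\<exists>p. p \<noteq> 0 \<and> poly (rp p) 1 = 0" by (rule exI[of _ "[:-1, 1:]"]) (simp add: rp_pCons)
    qed (use K.one_K in auto)
  qed
qed

section \<open>Embeddings into the complex numbers and characteristic polynomials\<close>

locale primitive_field = complex_subfield K for K +
  fixes \<theta> :: complex and g :: "rat poly"
  assumes theta_K: "\<theta> \<in> K" and theta_nz: "\<theta> \<noteq> 0"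
    and gen: "\<And>y. y \<in> K \<Longrightarrow> \<exists>h. y = poly (rp h) \<theta>"
    and g_monic: "Polynomial.lead_coeff g = 1" and g_root: "poly (rp g) \<theta> = 0"
    and g_min: "\<And>h. h \<noteq> 0 \<Longrightarrow> poly (rp h) \<theta> = 0 \<Longrightarrow> Polynomial.degree g \<le> Polynomial.degree h"

lemma primitive_field_exists:
  assumes "number_field K" obtains c g where "primitive_field K c g"
proof -
  obtain c where c: "c \<in> K" "c \<noteq> 0" "\<And>y. y \<in> K \<Longrightarrow> \<exists>h. y = poly (rp h) c" "\<exists>p. p \<noteq> 0 \<and> poly (rp p) c = 0"
    using primitive_element[OF assms] by metis
  obtain p where p: "p \<noteq> 0" "Polynomial.degree p = rat_deg c" "poly (rp p) c = 0" using rat_deg_obtain[OF c(4)] .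
  have "primitive_field K c (Polynomial.smult (inverse (Polynomial.lead_coeff p)) p)"
  proof (intro primitive_field.intro complex_subfield.intro primitive_field_axioms.intro)
    show "subfield K complex_ring" using assms by (simp add: number_field_def)
    show "Polynomial.degree (Polynomial.smult (inverse (Polynomial.lead_coeff p)) p) \<le> Polynomial.degree h"
      if "h \<noteq> 0" "poly (rp h) c = 0" for h using rat_deg_le[OF that] p by simp
    show "Polynomial.lead_coeff (Polynomial.smult (inverse (Polynomial.lead_coeff p)) p) = 1" using p(1) by simp
    show "poly (rp (Polynomial.smult (inverse (Polynomial.lead_coeff p)) p)) c = 0" using p(3) by (simp add: rp_smult)
  qed (rule c; assumption)+
  thus ?thesis by (rule that)
qed

context primitive_field
begin

lemma g_nz: "g \<noteq> 0" using g_monic by auto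

abbreviation "n \<equiv> Polynomial.degree g"

lemma n_pos: "n > 0"
proof (rule ccontr)
  assume "\<not> n > 0"
  then obtain c where c: "g = [:c:]" by (metis degree_eq_zeroE gr0I)
  thus False using g_root g_nz by (auto simp: rp_pCons)
qed

lemma rat_poly_K: "poly (rp h) \<theta> \<in> K"
  by (rule poly_K[OF polys_of_rat theta_K])

lemma g_dvd: assumes "poly (rp h) \<theta> = 0" shows "g dvd h"
proof -
  have "h = (h div g) * g + h mod g" by simp
  hence "rp h = rp (h div g) * rp g + rp (h mod g)" by (metis rp_add rp_mult)
  hence "poly (rp (h mod g)) \<theta> = 0" using assms g_root by simp
  hence "h mod g = 0" using g_min[of "h mod g"] degree_mod_less[OF g_nz, of h] by force
  thus ?thesis by (simp add: mod_eq_0_iff_dvd)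
qed

definition Z :: "complex set" where "Z = {z. poly (rp g) z = 0}"

lemma theta_Z: "\<theta> \<in> Z" by (simp add: Z_def g_root)

lemma finite_Z: "finite Z" unfolding Z_def by (rule poly_roots_finite) (simp add: g_nz)

text \<open>Split off the greatest common divisor, g = d e. If \<open>d\<close> is not constant,
  then \<open>e\<close> has too small a degree to vanish at \<theta>, so \<open>d\<close> vanishes
  there, and with it the nonzero derivative of \<open>g\<close>, against the minimality of
  \<open>g\<close>.\<close>

lemma coprime_pderiv: "coprime g (pderiv g)"
proof (rule ccontr)
  define d where "d = gcd g (pderiv g)"
  assume "\<not> coprime g (pderiv g)"
  hence nd: "gcd g (pderiv g) \<noteq> 1" by (simp add: coprime_iff_gcd_eq_1)
  obtain e where e: "g = d * e" using gcd_dvd1[of g "pderiv g"] unfolding d_def[symmetric] dvd_def by blast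
  have nz: "d \<noteq> 0" "e \<noteq> 0" using e g_nz by auto
  have "Polynomial.degree d > 0"
  proof (rule ccontr)
    assume "\<not> ?thesis"
    hence "is_unit d" using is_unit_iff_degree[OF nz(1)] by blast
    thus False using nd is_unit_gcd_iff[of g "pderiv g"] unfolding d_def by blast
  qed
  hence "Polynomial.degree e < n" using e nz by (simp add: degree_mult_eq)
  hence "poly (rp e) \<theta> \<noteq> 0" using g_min[OF nz(2)] by force
  hence "poly (rp d) \<theta> = 0" using g_root by (simp add: e rp_mult)
  moreover have "rp d dvd rp (pderiv g)" by (rule rp_dvd) (simp add: d_def)
  ultimately have "poly (rp (pderiv g)) \<theta> = 0" by (auto elim: dvdE)
  moreover have "pderiv g \<noteq> 0" using n_pos by (simp add: pderiv_eq_0_iff)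
  ultimately show False using g_min[of "pderiv g"] n_pos by (simp add: degree_pderiv)
qed

lemma rp_g_prod: "rp g = (\<Prod>z\<in>Z. [:- z, 1:])"
proof -
  obtain a b where ab: "a * g + b * pderiv g = 1"
    using coprime_pderiv by (metis bezout_coefficients_fst_snd coprime_iff_gcd_eq_1)
  have "rsquarefree (rp g)" unfolding rsquarefree_roots
  proof (intro allI notI)
    fix z assume *: "poly (rp g) z = 0 \<and> poly (pderiv (rp g)) z = 0"
    have "rp a * rp g + rp b * pderiv (rp g) = 1" using arg_cong[OF ab, of rp] by (simp add: rp_add rp_mult rp_pderiv rp_1)
    hence "poly (rp a * rp g + rp b * pderiv (rp g)) z = 1" by simp
    thus False using * by simp
  qed
  from complex_poly_decompose_rsquarefree[OF this] show ?thesis using g_monic by (simp add: Z_def)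
qed

lemma card_Z: "card Z = n"
proof -
  have "Polynomial.degree (rp g) = card Z" unfolding rp_g_prod by (subst degree_prod_eq_sum_degree) auto
  thus ?thesis by simp
qed

text \<open>The embedding of \<open>K\<close> that sends \<theta> to \<open>z\<close>. The chosen
  polynomial is determined only modulo \<open>g\<close>, which does not affect its value at a root
  of \<open>g\<close>; see \<open>sg_poly\<close>.\<close>

definition sg :: "complex \<Rightarrow> complex \<Rightarrow> complex" where
  "sg z y = poly (rp (SOME h. poly (rp h) \<theta> = y)) z"

lemma sg_poly: assumes "z \<in> Z" shows "sg z (poly (rp h) \<theta>) = poly (rp h) z"
proof -
  define k where "k = (SOME k. poly (rp k) \<theta> = poly (rp h) \<theta>)"
  have "poly (rp k) \<theta> = poly (rp h) \<theta>" unfolding k_def by (rule someI) simp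
  hence "g dvd k - h" by (intro g_dvd) (simp add: rp_diff)
  hence "rp g dvd rp k - rp h" using rp_dvd rp_diff by metis
  then obtain q where "rp k - rp h = rp g * q" by (elim dvdE)
  hence "poly (rp k - rp h) z = poly (rp g * q) z" by simp
  hence "poly (rp k) z = poly (rp h) z" using assms by (simp add: Z_def)
  thus ?thesis unfolding sg_def k_def[symmetric] by simp
qed

lemma sg_theta: assumes "y \<in> K" shows "sg \<theta> y = y"
proof -
  obtain h where "y = poly (rp h) \<theta>" using gen[OF assms] by blast
  thus ?thesis using sg_poly[OF theta_Z] by simp
qed

lemma sg_of_rat: "z \<in> Z \<Longrightarrow> sg z (of_rat q) = of_rat q"
  using sg_poly[of z "[:q:]"] by (simp add: rp_pCons)

lemma sg_theta_eq: "z \<in> Z \<Longrightarrow> sg z \<theta> = z"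
  using sg_poly[of z "[:0, 1:]"] by (simp add: rp_pCons)

lemma sg_add: assumes "z \<in> Z" "x \<in> K" "y \<in> K" shows "sg z (x + y) = sg z x + sg z y"
proof -
  obtain h k where hk: "x = poly (rp h) \<theta>" "y = poly (rp k) \<theta>" using gen assms by blast
  have "x + y = poly (rp (h + k)) \<theta>" by (simp add: hk rp_add)
  hence "sg z (x + y) = poly (rp (h + k)) z" using sg_poly[OF assms(1)] by metis
  thus ?thesis unfolding hk sg_poly[OF assms(1)] by (simp add: rp_add)
qed

lemma sg_mult: assumes "z \<in> Z" "x \<in> K" "y \<in> K" shows "sg z (x * y) = sg z x * sg z y"
proof -
  obtain h k where hk: "x = poly (rp h) \<theta>" "y = poly (rp k) \<theta>" using gen assms by blast
  have "x * y = poly (rp (h * k)) \<theta>" by (simp add: hk rp_mult)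
  hence "sg z (x * y) = poly (rp (h * k)) z" using sg_poly[OF assms(1)] by metis
  thus ?thesis unfolding hk sg_poly[OF assms(1)] by (simp add: rp_mult)
qed

lemma sg_0: "z \<in> Z \<Longrightarrow> sg z 0 = 0" and sg_1: "z \<in> Z \<Longrightarrow> sg z 1 = 1"
  using sg_of_rat[of z 0] sg_of_rat[of z 1] by auto

lemma sg_eq_0: assumes "z \<in> Z" "x \<in> K" shows "sg z x = 0 \<longleftrightarrow> x = 0"
proof
  assume *: "sg z x = 0"
  show "x = 0"
  proof (rule ccontr)
    assume "x \<noteq> 0"
    hence "sg z (x * inverse x) = 1" using sg_1[OF assms(1)] by simp
    thus False using sg_mult[OF assms inverse_K[OF assms(2)]] * by simp
  qed
qed (use sg_0 assms in simp)

text \<open>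
  The rational matrix \<open>M\<close> of multiplication by \<open>y\<close> on the basis of the powers of \<open>\<theta>\<close> becomes
  diagonal after conjugation with the Vandermonde matrix \<open>V\<close> of the conjugates of \<open>\<theta>\<close>.
\<close>

lemma characteristic_polynomial:
  assumes y: "y \<in> K"
  obtains c :: "rat poly" where "rp c = (\<Prod>z\<in>Z. [:- sg z y, 1:])"
proof -
  obtain h where h: "y = poly (rp h) \<theta>" using gen[OF y] by blast
  obtain zs where zs: "set zs = Z" "distinct zs" using finite_distinct_list[OF finite_Z] by blast
  have len: "length zs = n" using zs card_Z distinct_card by metis
  have zsZ: "zs ! k \<in> Z" if "k < n" for k using that zs len nth_mem by metis
  define R where "R i = (Polynomial.monom 1 i * h) mod g" for i
  define M where "M = Matrix.mat n n (\<lambda>(i, j). poly.coeff (R i) j)"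
  define MC where "MC = map_mat (of_rat :: rat \<Rightarrow> complex) M"
  define V where "V = Matrix.mat n n (\<lambda>(j, k). (zs ! k) ^ j)"
  define D where "D = Matrix.mat n n (\<lambda>(j, k). if j = k then sg (zs ! k) y else 0)"
  have carr: "M \<in> carrier_mat n n" "MC \<in> carrier_mat n n" "V \<in> carrier_mat n n" "D \<in> carrier_mat n n"
    by (auto simp: M_def MC_def V_def D_def)
  have R_eval: "(\<Sum>j<n. of_rat (poly.coeff (R i) j) * z ^ j) = z ^ i * sg z y" if "z \<in> Z" for z i
  proof -
    have dR: "Polynomial.degree (R i) < n \<or> R i = 0" unfolding R_def using degree_mod_less[OF g_nz] by blast
    have "Polynomial.monom 1 i * h = ((Polynomial.monom 1 i * h) div g) * g + R i" by (simp add: R_def)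
    hence "rp (Polynomial.monom 1 i * h) = rp ((Polynomial.monom 1 i * h) div g) * rp g + rp (R i)" by (metis rp_add rp_mult)
    hence "poly (rp (Polynomial.monom 1 i * h)) z = poly (rp (R i)) z" using that by (simp add: Z_def)
    hence "poly (rp (R i)) z = z ^ i * sg z y" using sg_poly[OF that, of h] by (simp add: rp_mult poly_monom h)
    moreover have "poly (rp (R i)) z = (\<Sum>j<n. of_rat (poly.coeff (R i) j) * z ^ j)"
    proof -
      have "poly (rp (R i)) z = (\<Sum>j\<le>Polynomial.degree (R i). of_rat (poly.coeff (R i) j) * z ^ j)" by (simp add: poly_altdef)
      also have "\<dots> = (\<Sum>j<n. of_rat (poly.coeff (R i) j) * z ^ j)"
        by (rule sum.mono_neutral_left) (use dR n_pos in \<open>auto simp: coeff_eq_0\<close>)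
      finally show ?thesis .
    qed
    ultimately show ?thesis by simp
  qed
  have MV: "MC * V = V * D"
  proof (rule eq_matI)
    fix i k assume "i < dim_row (V * D)" "k < dim_col (V * D)"
    hence ik: "i < n" "k < n" using carr by auto
    have "(MC * V) $$ (i, k) = (\<Sum>j<n. of_rat (poly.coeff (R i) j) * (zs ! k) ^ j)"
      using ik carr by (simp add: scalar_prod_def MC_def M_def V_def lessThan_atLeast0)
    also have "\<dots> = (zs ! k) ^ i * sg (zs ! k) y" by (rule R_eval[OF zsZ[OF ik(2)]])
    also have "\<dots> = (\<Sum>j<n. (zs ! j) ^ i * (if j = k then sg (zs ! k) y else 0))"
      using ik by (simp add: if_distrib[of "\<lambda>x. _ * x"] sum.delta cong: if_cong)
    also have "\<dots> = (V * D) $$ (i, k)"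
      using ik carr by (simp add: scalar_prod_def V_def D_def lessThan_atLeast0)
    finally show "(MC * V) $$ (i, k) = (V * D) $$ (i, k)" .
  qed (use carr in auto)
  \<comment> \<open>A vector in the kernel of the transpose lists the coefficients of a polynomial
    of degree less than \<open>n\<close> that vanishes at all \<open>n\<close> conjugates.\<close>
  have "Determinant.det V \<noteq> 0"
  proof
    assume "Determinant.det V = 0"
    hence "Determinant.det (transpose_mat V) = 0" using det_transpose[OF carr(3)] by simp
    then obtain u where u: "u \<in> carrier_vec n" "u \<noteq> 0\<^sub>v n" "transpose_mat V *\<^sub>v u = 0\<^sub>v n"
      using det_0_iff_vec_prod_zero[of "transpose_mat V" n] carr by auto
    define p where "p = (\<Sum>j<n. Polynomial.monom (u $ j) j)"
    have cf: "poly.coeff p i = (if i < n then u $ i else 0)" for i by (simp add: p_def coeff_sum)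
    have "poly p z = 0" if "z \<in> Z" for z
    proof -
      have "z \<in> set zs" using that zs by simp
      then obtain k where k: "k < n" "z = zs ! k" unfolding in_set_conv_nth len by blast
      have "(transpose_mat V *\<^sub>v u) $ k = 0" using u k by simp
      hence "(\<Sum>j<n. (zs ! k) ^ j * u $ j) = 0" using k u carr by (simp add: scalar_prod_def V_def lessThan_atLeast0)
      thus ?thesis using k by (simp add: p_def poly_sum poly_monom mult.commute)
    qed
    hence "Z \<subseteq> {z. poly p z = 0}" by blast
    have "p = 0"
    proof (rule ccontr)
      assume "p \<noteq> 0"
      hence "card Z \<le> Polynomial.degree p" using card_mono[OF poly_roots_finite \<open>Z \<subseteq> _\<close>] card_poly_roots_bound[of p] by simp
      moreover have "Polynomial.degree p < n" using \<open>p \<noteq> 0\<close> cf by (metis leading_coeff_0_iff)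
      ultimately show False using card_Z by simp
    qed
    hence "u = 0\<^sub>v n" using cf u(1) by (intro eq_vecI) (auto, metis coeff_0)
    thus False using u(2) by simp
  qed
  from det_non_zero_imp_unit[OF carr(3) this] obtain W where W: "W \<in> carrier_mat n n" "V * W = 1\<^sub>m n" "W * V = 1\<^sub>m n"
    by (auto simp: Units_def ring_mat_def)
  have "MC = V * D * W"
  proof -
    have "V * D * W = MC * (V * W)" unfolding MV[symmetric] using carr W(1) by (simp add: assoc_mult_mat[of _ n n _ n _ n])
    thus ?thesis using W carr by simp
  qed
  hence "similar_mat MC D" using carr W by (intro similar_matI[of _ _ V W n]) auto
  hence "char_poly MC = char_poly D" by (rule char_poly_similar)
  also have "\<dots> = (\<Prod>a\<leftarrow>diag_mat D. [:- a, 1:])"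
    by (rule char_poly_upper_triangular[OF carr(4)]) (auto simp: D_def upper_triangular_def)
  also have "diag_mat D = map (\<lambda>z. sg z y) zs"
    unfolding diag_mat_def using carr len by (intro nth_equalityI) (auto simp: D_def)
  also have "(\<Prod>a\<leftarrow>map (\<lambda>z. sg z y) zs. [:- a, 1:]) = (\<Prod>z\<in>Z. [:- sg z y, 1:])"
    using prod.distinct_set_conv_list[OF zs(2), of "\<lambda>z. [:- sg z y, 1:]"] zs(1) by (simp add: o_def)
  also have "char_poly MC = rp (char_poly M)" unfolding MC_def by (rule of_rat_hom.char_poly_hom[OF carr(1)])
  finally show ?thesis using that by blast
qed

text \<open>\<open>Sp j\<close> is the rational span of the powers of \<theta> below
  \<open>j\<close>. Each step of this flag adds one dimension while j < n, because a dependency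
  would be a polynomial of degree \<open>j\<close> vanishing at \<theta>.\<close>

lemma nf_degree_eq: "nf_degree K = n"
proof -
  interpret C: field complex_ring by (rule field_from_type_algebra)
  define Sp where "Sp j = {poly (rp q) \<theta> | q. \<forall>i\<ge>j. poly.coeff q i = 0}" for j
  have line: "C.line_extension \<rat> (\<theta> ^ j) (Sp j) = Sp (Suc j)" for j
  proof (intro equalityI subsetI)
    fix x assume "x \<in> C.line_extension \<rat> (\<theta> ^ j) (Sp j)"
    then obtain k y where "k \<in> \<rat>" "y \<in> Sp j" "x = k * \<theta> ^ j + y"
      by (auto simp: C.line_extension_mem_iff cr_simps)
    then obtain c q where cq: "x = of_rat c * \<theta> ^ j + poly (rp q) \<theta>" "\<forall>i\<ge>j. poly.coeff q i = 0"
      by (auto simp: Sp_def elim!: Rats_cases)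
    have "x = poly (rp (Polynomial.monom c j + q)) \<theta>" by (simp add: cq rp_add poly_monom)
    moreover have "\<forall>i\<ge>Suc j. poly.coeff (Polynomial.monom c j + q) i = 0" using cq by auto
    ultimately show "x \<in> Sp (Suc j)" unfolding Sp_def by blast
  next
    fix x assume "x \<in> Sp (Suc j)"
    then obtain q where q: "x = poly (rp q) \<theta>" "\<forall>i\<ge>Suc j. poly.coeff q i = 0" by (auto simp: Sp_def)
    define r where "r = q - Polynomial.monom (poly.coeff q j) j"
    have "\<forall>i\<ge>j. poly.coeff r i = 0"
    proof (intro allI impI)
      fix i assume "j \<le> i" thus "poly.coeff r i = 0" using q(2) by (cases "i = j") (auto simp: r_def)
    qed
    hence "poly (rp r) \<theta> \<in> Sp j" unfolding Sp_def by blast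
    moreover have "x = of_rat (poly.coeff q j) * \<theta> ^ j + poly (rp r) \<theta>"
      by (simp add: q r_def rp_diff poly_monom)
    ultimately show "x \<in> C.line_extension \<rat> (\<theta> ^ j) (Sp j)"
      unfolding C.line_extension_mem_iff cr_simps by (intro bexI[of _ "of_rat (poly.coeff q j)"] bexI[of _ "poly (rp r) \<theta>"]) auto
  qed
  have "C.dimension j \<rat> (Sp j)" if "j \<le> n" for j
    using that
  proof (induction j)
    case 0
    have "Sp 0 = {0}" by (auto simp: Sp_def poly_eq_iff[symmetric, where q = 0, simplified] intro!: exI[of _ 0])
    thus ?case using C.zero_dim[of \<rat>] by (simp add: cr_simps)
  next
    case (Suc j)
    have "\<theta> ^ j \<notin> Sp j"
    proof
      assume "\<theta> ^ j \<in> Sp j"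
      then obtain q where q: "\<theta> ^ j = poly (rp q) \<theta>" "\<forall>i\<ge>j. poly.coeff q i = 0" by (auto simp: Sp_def)
      define r where "r = Polynomial.monom 1 j - q"
      have "poly.coeff r j = 1" using q(2) by (simp add: r_def)
      hence "r \<noteq> 0" by auto
      moreover have "poly (rp r) \<theta> = 0" using q by (simp add: r_def rp_diff poly_monom)
      ultimately have "n \<le> Polynomial.degree r" using g_min by blast
      moreover have "Polynomial.degree r \<le> j" by (rule degree_le) (use q in \<open>auto simp: r_def\<close>)
      ultimately show False using Suc.prems by simp
    qed
    moreover have "\<theta> ^ j \<in> carrier complex_ring" by (simp add: cr_simps)
    ultimately show ?case using C.Suc_dim[of "\<theta> ^ j" "Sp j" j \<rat>] Suc line by simp
  qed
  moreover have "Sp n = K"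
  proof (intro equalityI subsetI)
    fix y assume "y \<in> K"
    then obtain h where "y = poly (rp h) \<theta>" using gen by blast
    then obtain r where r: "r = 0 \<or> Polynomial.degree r < n" "y = poly (rp r) \<theta>"
      using rat_polys_reduce[OF g_nz g_root] by metis
    hence "\<forall>i\<ge>n. poly.coeff r i = 0" by (auto simp: coeff_eq_0)
    thus "y \<in> Sp n" using r(2) unfolding Sp_def by blast
  qed (auto simp: Sp_def rat_poly_K)
  ultimately have "C.dimension n \<rat> K" by force
  thus ?thesis unfolding nf_degree_def using C.dimI[OF subfield_Rats] by (simp add: over_def)
qed

end

subsection \<open>Places above a place of the rational numbers\<close>

locale abs_field = complex_subfield K for K +
  fixes v :: "complex \<Rightarrow> real"
  assumes av: "absolute_value (nf_ring K) v"
begin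

lemma av_nonneg: "x \<in> K \<Longrightarrow> 0 \<le> v x"
  and av_eq_0: "x \<in> K \<Longrightarrow> v x = 0 \<longleftrightarrow> x = 0"
  and av_mult: "x \<in> K \<Longrightarrow> y \<in> K \<Longrightarrow> v (x * y) = v x * v y"
  and av_add: "x \<in> K \<Longrightarrow> y \<in> K \<Longrightarrow> v (x + y) \<le> v x + v y"
  using av by (auto simp: absolute_value_def nf_ring_simps)

lemma av_pos: "x \<in> K \<Longrightarrow> x \<noteq> 0 \<Longrightarrow> 0 < v x"
  using av_nonneg av_eq_0 by (metis order_le_less)

lemma av_zero: "v 0 = 0" using av_eq_0 zero_K by simp

lemma av_one: "v 1 = 1"
  using av_mult[OF one_K one_K] av_eq_0[OF one_K] by auto

lemma av_uminus: assumes "x \<in> K" shows "v (- x) = v x"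
proof -
  have m: "(-1) \<in> K" using uminus_K[OF one_K] by simp
  have "v (-1) * v (-1) = 1" using av_mult[OF m m] av_one by simp
  hence "v (-1) = 1" using av_nonneg[OF m] by (simp add: power2_eq_1_iff flip: power2_eq_square)
  thus ?thesis using av_mult[OF m assms] by simp
qed

lemma av_diff: "x \<in> K \<Longrightarrow> y \<in> K \<Longrightarrow> v (x - y) \<le> v x + v y"
  using av_add[of x "- y"] av_uminus[of y] uminus_K by simp

lemma av_minus_commute: "x \<in> K \<Longrightarrow> y \<in> K \<Longrightarrow> v (x - y) = v (y - x)"
  using av_uminus[of "x - y"] diff_K by simp

lemma av_abs_diff: assumes "x \<in> K" "y \<in> K" shows "\<bar>v x - v y\<bar> \<le> v (x - y)"
  using av_add[of "x - y" y] av_add[of "y - x" x] av_minus_commute[of x y] assms diff_K by fastforce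

lemma av_power: "x \<in> K \<Longrightarrow> v (x ^ k) = v x ^ k"
  by (induction k) (auto simp: av_one av_mult power_K)

lemma av_inverse: assumes "x \<in> K" shows "v (inverse x) = inverse (v x)"
proof (cases "x = 0")
  case False
  have "v x * v (inverse x) = 1" using av_mult[OF assms inverse_K[OF assms]] False av_one by simp
  thus ?thesis using inverse_unique by metis
qed (simp add: av_zero)

lemma av_divide: "x \<in> K \<Longrightarrow> y \<in> K \<Longrightarrow> v (x / y) = v x / v y"
  by (simp add: divide_inverse av_mult av_inverse inverse_K)

lemma av_sum: "(\<And>i. i \<in> S \<Longrightarrow> f i \<in> K) \<Longrightarrow> v (sum f S) \<le> (\<Sum>i\<in>S. v (f i))"
proof (induction S rule: infinite_finite_induct)
  case (insert x F)
  have "v (sum f (insert x F)) \<le> v (f x) + v (sum f F)" using insert by (auto intro!: av_add sum_K)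
  also have "v (sum f F) \<le> (\<Sum>i\<in>F. v (f i))" using insert by simp
  finally show ?case using insert by simp
qed (auto simp: av_zero)

lemma av_prod: "(\<And>i. i \<in> S \<Longrightarrow> f i \<in> K) \<Longrightarrow> v (prod f S) = (\<Prod>i\<in>S. v (f i))"
  by (induction S rule: infinite_finite_induct) (auto simp: av_one av_mult prod_K)

definition conv :: "(nat \<Rightarrow> complex) \<Rightarrow> complex \<Rightarrow> bool" where
  "conv s l \<longleftrightarrow> (\<forall>m. s m \<in> K) \<and> l \<in> K \<and> (\<lambda>m. v (s m - l)) \<longlonglongrightarrow> 0"

lemma conv_K: "conv s l \<Longrightarrow> s m \<in> K" "conv s l \<Longrightarrow> l \<in> K"
  by (auto simp: conv_def)

lemma conv_const: "l \<in> K \<Longrightarrow> conv (\<lambda>_. l) l"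
  by (simp add: conv_def av_zero)

lemma conv_v: assumes "conv s l" shows "(\<lambda>m. v (s m)) \<longlonglongrightarrow> v l"
proof -
  have "(\<lambda>m. v (s m) - v l) \<longlonglongrightarrow> 0"
    by (rule null_comparison[of "\<lambda>m. v (s m - l)"]) (use assms av_abs_diff in \<open>auto simp: conv_def\<close>)
  thus ?thesis by (simp add: LIM_zero_iff)
qed

lemma conv_add: assumes "conv s l" "conv t r" shows "conv (\<lambda>m. s m + t m) (l + r)"
  unfolding conv_def
proof (intro conjI allI)
  have k: "s m \<in> K" "t m \<in> K" "l \<in> K" "r \<in> K" for m using assms by (auto simp: conv_def)
  show "s m + t m \<in> K" for m using k add_K by blast
  show "l + r \<in> K" using k add_K by blast
  show "(\<lambda>m. v (s m + t m - (l + r))) \<longlonglongrightarrow> 0"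
  proof (rule null_comparison[of "\<lambda>m. v (s m - l) + v (t m - r)"])
    show "(\<lambda>m. v (s m - l) + v (t m - r)) \<longlonglongrightarrow> 0"
      using assms tendsto_add[of "\<lambda>m. v (s m - l)" 0 sequentially "\<lambda>m. v (t m - r)" 0] by (simp add: conv_def)
    show "\<bar>v (s m + t m - (l + r))\<bar> \<le> v (s m - l) + v (t m - r)" for m
    proof -
      have e: "s m + t m - (l + r) = (s m - l) + (t m - r)" by simp
      have "v (s m + t m - (l + r)) \<le> v (s m - l) + v (t m - r)"
        unfolding e by (rule av_add[OF diff_K[OF k(1,3)] diff_K[OF k(2,4)]])
      moreover have "0 \<le> v (s m + t m - (l + r))"
        by (rule av_nonneg[OF diff_K[OF add_K[OF k(1,2)] add_K[OF k(3,4)]]])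
      ultimately show ?thesis by simp
    qed
  qed
qed

lemma conv_mult: assumes "conv s l" "conv t r" shows "conv (\<lambda>m. s m * t m) (l * r)"
  unfolding conv_def
proof (intro conjI allI)
  have k: "s m \<in> K" "t m \<in> K" "l \<in> K" "r \<in> K" for m using assms by (auto simp: conv_def)
  show "s m * t m \<in> K" for m using k mult_K by blast
  show "l * r \<in> K" using k mult_K by blast
  have 1: "(\<lambda>m. v (s m - l)) \<longlonglongrightarrow> 0" "(\<lambda>m. v (t m - r)) \<longlonglongrightarrow> 0" using assms by (auto simp: conv_def)
  show "(\<lambda>m. v (s m * t m - l * r)) \<longlonglongrightarrow> 0"
  proof (rule null_comparison[of "\<lambda>m. v (s m - l) * v (t m) + v l * v (t m - r)"])
    have "(\<lambda>m. v (s m - l) * v (t m) + v l * v (t m - r)) \<longlonglongrightarrow> 0 * v r + v l * 0"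
      by (intro tendsto_intros 1 conv_v[OF assms(2)])
    thus "(\<lambda>m. v (s m - l) * v (t m) + v l * v (t m - r)) \<longlonglongrightarrow> 0" by simp
    show "\<bar>v (s m * t m - l * r)\<bar> \<le> v (s m - l) * v (t m) + v l * v (t m - r)" for m
    proof -
      have "s m * t m - l * r = (s m - l) * t m + l * (t m - r)" by (simp add: algebra_simps)
      hence "v (s m * t m - l * r) \<le> v ((s m - l) * t m) + v (l * (t m - r))"
        using av_add[of "(s m - l) * t m" "l * (t m - r)"] k(1,2)[of m] k(3,4) by (simp add: mult_K diff_K)
      also have "\<dots> = v (s m - l) * v (t m) + v l * v (t m - r)" using k(1,2)[of m] k(3,4) by (simp add: av_mult diff_K)
      finally show ?thesis using av_nonneg[of "s m * t m - l * r"] k(1,2)[of m] k(3,4) by (simp add: diff_K mult_K)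
    qed
  qed
qed

lemma conv_uminus: "conv s l \<Longrightarrow> conv (\<lambda>m. - s m) (- l)"
  using conv_mult[OF conv_const[of "-1"], of s l] uminus_K[OF one_K] by simp

lemma conv_diff: "conv s l \<Longrightarrow> conv t r \<Longrightarrow> conv (\<lambda>m. s m - t m) (l - r)"
  using conv_add[OF _ conv_uminus, of s l t r] by simp

lemma conv_power: "conv s l \<Longrightarrow> conv (\<lambda>m. s m ^ k) (l ^ k)"
  by (induction k) (auto intro: conv_const one_K conv_mult)

lemma conv_sum: "finite S \<Longrightarrow> (\<And>i. i \<in> S \<Longrightarrow> conv (s i) (l i)) \<Longrightarrow> conv (\<lambda>m. \<Sum>i\<in>S. s i m) (\<Sum>i\<in>S. l i)"
  by (induction S rule: finite_induct) (auto intro: conv_const zero_K conv_add)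

lemma conv_zero_iff: "(\<And>m. s m \<in> K) \<Longrightarrow> conv s 0 \<longleftrightarrow> (\<lambda>m. v (s m)) \<longlonglongrightarrow> 0"
  by (simp add: conv_def zero_K)

lemma conv_prod_coeff:
  assumes "finite S" "\<And>i. i \<in> S \<Longrightarrow> conv (c i) (d i)"
  shows "conv (\<lambda>m. poly.coeff (\<Prod>i\<in>S. [:- c i m, 1:]) j) (poly.coeff (\<Prod>i\<in>S. [:- d i, 1:]) j)"
  using assms
proof (induction S arbitrary: j rule: finite_induct)
  case empty
  thus ?case by (auto intro!: conv_const simp: zero_K one_K)
next
  case (insert x F)
  have e: "poly.coeff ([:- b, 1:] * p) j = - b * poly.coeff p j + (case j of 0 \<Rightarrow> 0 | Suc i \<Rightarrow> poly.coeff p i)" for b :: complex and p j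
    by (simp add: Polynomial.coeff_pCons split: nat.splits)
  have "conv (\<lambda>m. - c x m * poly.coeff (\<Prod>i\<in>F. [:- c i m, 1:]) j + (case j of 0 \<Rightarrow> 0 | Suc i \<Rightarrow> poly.coeff (\<Prod>i\<in>F. [:- c i m, 1:]) i))
    (- d x * poly.coeff (\<Prod>i\<in>F. [:- d i, 1:]) j + (case j of 0 \<Rightarrow> 0 | Suc i \<Rightarrow> poly.coeff (\<Prod>i\<in>F. [:- d i, 1:]) i))"
    using insert by (intro conv_add conv_mult conv_uminus) (auto split: nat.splits intro: conv_const zero_K)
  thus ?case unfolding prod.insert[OF insert(1,2)] e .
qed

text \<open>This sequence turns the mere comparison of \<open>v x\<close> with 1 into the limits 0
  and 1; it produces the approximating sequences of weak approximation.\<close>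

lemma conv_ratio:
  assumes x: "x \<in> K"
  shows "v x < 1 \<Longrightarrow> conv (\<lambda>m. x ^ m / (1 + x ^ m)) 0" and "v x > 1 \<Longrightarrow> conv (\<lambda>m. x ^ m / (1 + x ^ m)) 1"
proof -
  have k: "x ^ m / (1 + x ^ m) \<in> K" for m using x by (intro divide_K add_K power_K one_K)
  have xm: "x ^ m \<in> K" "1 + x ^ m \<in> K" "v (x ^ m) = v x ^ m" for m using x power_K add_K one_K av_power by auto
  {
    assume v1: "v x < 1"
    have lim: "(\<lambda>m. v x ^ m) \<longlonglongrightarrow> 0" using av_nonneg[OF x] v1 by (intro LIMSEQ_realpow_zero) auto
    have "(\<lambda>m. v x ^ m / (1 - v x ^ m)) \<longlonglongrightarrow> 0 / (1 - 0)" by (intro tendsto_intros lim) simp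
    \<comment> \<open>The index is shifted because the denominator 1 - (v x)^m of the majorant is 0
      at \<open>m = 0\<close>.\<close>
    hence lim2: "(\<lambda>m. v x ^ Suc m / (1 - v x ^ Suc m)) \<longlonglongrightarrow> 0" using LIMSEQ_Suc by fastforce
    have "(\<lambda>m. v (x ^ Suc m / (1 + x ^ Suc m))) \<longlonglongrightarrow> 0"
    proof (rule null_comparison[OF lim2])
      fix m
      have lt: "v x ^ Suc m < 1" using av_nonneg[OF x] v1 power_Suc_less_one[of "v x" m] by (cases "v x = 0") auto
      have "1 \<le> v (1 + x ^ Suc m) + v x ^ Suc m"
        using av_diff[OF xm(2) xm(1), of "Suc m" "Suc m"] av_one unfolding xm(3) by (simp del: power_Suc)
      hence "1 - v x ^ Suc m \<le> v (1 + x ^ Suc m)" by simp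
      hence "v x ^ Suc m / v (1 + x ^ Suc m) \<le> v x ^ Suc m / (1 - v x ^ Suc m)"
        using lt av_nonneg[OF x] by (intro divide_left_mono mult_pos_pos) (auto simp del: power_Suc)
      thus "\<bar>v (x ^ Suc m / (1 + x ^ Suc m))\<bar> \<le> v x ^ Suc m / (1 - v x ^ Suc m)"
        unfolding av_divide[OF xm(1,2)] xm(3) using av_nonneg[OF x] av_nonneg[OF xm(2)] by (simp del: power_Suc)
    qed
    hence "(\<lambda>m. v (x ^ m / (1 + x ^ m))) \<longlonglongrightarrow> 0" by (rule LIMSEQ_imp_Suc)
    thus "conv (\<lambda>m. x ^ m / (1 + x ^ m)) 0" using k by (simp add: conv_zero_iff)
  }
  assume v1: "v x > 1"
  have lim0: "(\<lambda>m. (1 / v x) ^ m) \<longlonglongrightarrow> 0" using v1 by (intro LIMSEQ_realpow_zero) auto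
  have "(\<lambda>m. (1 / v x) ^ m / (1 - (1 / v x) ^ m)) \<longlonglongrightarrow> 0 / (1 - 0)"
    by (rule tendsto_divide[OF lim0 tendsto_diff[OF tendsto_const lim0]]) simp
  hence "(\<lambda>m. (1 / v x) ^ Suc m / (1 - (1 / v x) ^ Suc m)) \<longlonglongrightarrow> 0" using LIMSEQ_Suc by fastforce
  moreover have "(1 / v x) ^ Suc m / (1 - (1 / v x) ^ Suc m) = 1 / (v x ^ Suc m - 1)" for m
  proof -
    have "v x ^ Suc m > 1" using v1 by (intro one_less_power) auto
    thus ?thesis using v1 by (simp add: power_one_over field_simps del: power_Suc)
  qed
  ultimately have lim2: "(\<lambda>m. 1 / (v x ^ Suc m - 1)) \<longlonglongrightarrow> 0" by simp
  have "(\<lambda>m. v (x ^ Suc m / (1 + x ^ Suc m) - 1)) \<longlonglongrightarrow> 0"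
  proof (rule null_comparison[OF lim2])
    fix m
    have gt: "v x ^ Suc m > 1" using v1 by (intro one_less_power) auto
    have ge: "v x ^ Suc m - 1 \<le> v (1 + x ^ Suc m)"
      using av_diff[OF xm(2) one_K, of "Suc m"] av_one xm(3)[of "Suc m"] by (simp del: power_Suc)
    have nz: "1 + x ^ Suc m \<noteq> 0" using ge gt av_zero by (metis diff_gt_0_iff_gt not_le)
    have "x ^ Suc m / (1 + x ^ Suc m) - 1 = - inverse (1 + x ^ Suc m)" using nz by (simp add: field_simps del: power_Suc)
    hence "v (x ^ Suc m / (1 + x ^ Suc m) - 1) = 1 / v (1 + x ^ Suc m)"
      using av_uminus[OF inverse_K[OF xm(2)]] av_inverse[OF xm(2)] by (simp add: divide_inverse del: power_Suc)
    also have "\<dots> \<le> 1 / (v x ^ Suc m - 1)" using ge gt by (intro divide_left_mono mult_pos_pos) (auto simp del: power_Suc)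
    finally show "\<bar>v (x ^ Suc m / (1 + x ^ Suc m) - 1)\<bar> \<le> 1 / (v x ^ Suc m - 1)"
      using av_nonneg[OF diff_K[OF k one_K], of "Suc m"] by (simp del: power_Suc)
  qed
  hence "(\<lambda>m. v (x ^ m / (1 + x ^ m) - 1)) \<longlonglongrightarrow> 0" by (rule LIMSEQ_imp_Suc)
  thus "conv (\<lambda>m. x ^ m / (1 + x ^ m)) 1" using k one_K by (simp add: conv_def)
qed

lemma av_powi: assumes "x \<in> K" shows "x powi j \<in> K" "v (x powi j) = v x powi j"
  using assms by (auto simp: power_int_def power_K inverse_K av_power av_inverse)

end

text \<open>Up to inversion some \<open>y\<close> satisfies v' y < v y. The gap between the
  logarithms of v(y^k) and v'(y^k) grows with \<open>k\<close> until it exceeds the one of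
  \<open>q0\<close>. Since \<open>q0\<close> has the same size for both absolute values, dividing by
  a power of it moves the number 1 into the gap.\<close>

lemma abs_field_separate:
  assumes v: "abs_field K v" and v': "abs_field K v'" and eq: "\<And>q. v (of_rat q) = v' (of_rat q)"
    and q: "v (of_rat q0) > 1" and x0: "x0 \<in> K" "v x0 \<noteq> v' x0"
  shows "\<exists>x\<in>K. v x > 1 \<and> v' x < 1"
proof -
  interpret v: abs_field K v by fact
  interpret v': abs_field K v' by fact
  have "x0 \<noteq> 0" using x0 v.av_zero v'.av_zero by auto
  have "\<exists>y\<in>K. y \<noteq> 0 \<and> v' y < v y"
  proof (cases "v' x0 < v x0")
    case False
    hence "v x0 < v' x0" using x0 by simp
    hence "v' (inverse x0) < v (inverse x0)"
      using x0 v.av_inverse v'.av_inverse v.av_pos[OF x0(1) \<open>x0 \<noteq> 0\<close>] by (simp add: less_imp_inverse_less)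
    thus ?thesis using v.inverse_K[OF x0(1)] \<open>x0 \<noteq> 0\<close> by (intro bexI[of _ "inverse x0"]) auto
  qed (use x0 \<open>x0 \<noteq> 0\<close> in auto)
  then obtain y where y: "y \<in> K" "y \<noteq> 0" "v' y < v y" by blast
  define a b c where "a = ln (v y)" and "b = ln (v' y)" and "c = ln (v (of_rat q0))"
  have pos: "0 < v y" "0 < v' y" using v.av_pos v'.av_pos y by auto
  have ab: "b < a" "0 < c" using y pos q by (auto simp: a_def b_def c_def)
  obtain k :: nat where k: "c / (a - b) < real k" using reals_Archimedean2 by blast
  hence k': "c < real k * (a - b)" using ab by (simp add: field_simps)
  \<comment> \<open>The largest integer with j c strictly below k a; then k (a - b) > c puts j c
    strictly above k b.\<close>
  define j where "j = \<lceil>real k * a / c\<rceil> - 1"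
  have j: "of_int j < real k * a / c" "real k * a / c \<le> of_int j + 1" unfolding j_def by linarith+
  have j1: "of_int j * c < real k * a" using j(1) ab by (simp add: field_simps)
  have j2: "real k * b < of_int j * c"
  proof -
    have "real k * a \<le> (of_int j + 1) * c" using j(2) ab by (simp add: field_simps)
    thus ?thesis using k' by (simp add: algebra_simps)
  qed
  define r where "r = complex_of_rat q0"
  define x where "x = y ^ k * r powi (- j)"
  have r: "r \<in> K" "v r = exp c" "v' r = exp c" using q eq v.of_rat_K by (auto simp: r_def c_def)
  have e: "exp c powi (- j) = exp (- of_int j * c)" using exp_power_int[of c "- j"] by simp
  have "v x = exp (real k * a - of_int j * c)"
  proof -
    have "v x = v y ^ k * exp (- of_int j * c)"
      unfolding x_def using y r v.av_powi v.power_K v.av_power e by (simp add: v.av_mult)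
    also have "v y ^ k = exp (real k * a)" using pos by (simp add: a_def exp_of_nat_mult)
    finally show ?thesis by (simp add: exp_add[symmetric])
  qed
  moreover have "v' x = exp (real k * b - of_int j * c)"
  proof -
    have "v' x = v' y ^ k * exp (- of_int j * c)"
      unfolding x_def using y r v'.av_powi v.power_K v'.av_power e by (simp add: v'.av_mult)
    also have "v' y ^ k = exp (real k * b)" using pos by (simp add: b_def exp_of_nat_mult)
    finally show ?thesis by (simp add: exp_add[symmetric])
  qed
  ultimately have "v x > 1" "v' x < 1" using j1 j2 by auto
  moreover have "x \<in> K" unfolding x_def using y r v.av_powi v.power_K v.mult_K by blast
  ultimately show ?thesis by blast
qed

text \<open>Induction in the style of Artin and Whaples. Let \<open>x\<close> work for
  \<open>V\<close> and let \<open>y\<close> separate \<open>v\<close> from the new \<open>u\<close>.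
  If u x \<le> 1, then x^m y works for large \<open>m\<close>. Otherwise x^m is replaced by x^m / (1
  + x^m), which tends to 1 at \<open>v\<close> and \<open>u\<close> and to 0 on
  \<open>V\<close>.\<close>

lemma weak_approximation_aux:
  assumes v: "abs_field K v" and q: "v (of_rat q0) > 1" and V: "finite V"
    "\<And>v'. v' \<in> V \<Longrightarrow> abs_field K v'" "\<And>v' q. v' \<in> V \<Longrightarrow> v (of_rat q) = v' (of_rat q)"
    "\<And>v'. v' \<in> V \<Longrightarrow> \<exists>x\<in>K. v x \<noteq> v' x"
  shows "\<exists>x\<in>K. v x > 1 \<and> (\<forall>v'\<in>V. v' x < 1)"
  using V
proof (induction V rule: finite_induct)
  case empty
  interpret v: abs_field K v by fact
  show ?case using q v.of_rat_K by auto
next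
  case (insert u V)
  interpret v: abs_field K v by fact
  interpret u: abs_field K u using insert by simp
  obtain x where x: "x \<in> K" "v x > 1" "\<forall>v'\<in>V. v' x < 1" using insert by auto
  obtain x0 where "x0 \<in> K" "v x0 \<noteq> u x0" using insert.prems(3)[of u] by auto
  then obtain y where y: "y \<in> K" "v y > 1" "u y < 1"
    using abs_field_separate[OF v u.abs_field_axioms _ q] insert.prems(2)[of u] by blast
  have ev: "\<forall>\<^sub>F m in sequentially. \<forall>v'\<in>V. v' (z m) < 1" if "\<And>v'. v' \<in> V \<Longrightarrow> (\<lambda>m. v' (z m)) \<longlonglongrightarrow> 0" for z
    using insert(1) that by (intro eventually_ball_finite ballI order_tendstoD(2)[where y = 0]) auto
  show ?case
  proof (cases "u x \<le> 1")
    case True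
    have "\<forall>\<^sub>F m in sequentially. \<forall>v'\<in>V. v' (x ^ m * y) < 1"
    proof (rule ev)
      fix v' assume v': "v' \<in> V"
      interpret v': abs_field K v' using insert v' by simp
      have "(\<lambda>m. v' x ^ m * v' y) \<longlonglongrightarrow> 0 * v' y"
        using x v' v'.av_nonneg[OF x(1)] by (intro tendsto_intros LIMSEQ_realpow_zero) auto
      thus "(\<lambda>m. v' (x ^ m * y)) \<longlonglongrightarrow> 0" using x y v.power_K by (simp add: v'.av_mult v'.av_power)
    qed
    then obtain m where m: "\<forall>v'\<in>V. v' (x ^ m * y) < 1" by (auto simp: eventually_sequentially)
    have "1 * v y \<le> v x ^ m * v y" using x y by (intro mult_right_mono one_le_power) auto
    moreover have "v (x ^ m * y) = v x ^ m * v y" using x y v.power_K by (simp add: v.av_mult v.av_power)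
    ultimately have "v (x ^ m * y) > 1" using y by linarith
    moreover have "u (x ^ m * y) < 1"
    proof -
      have "u (x ^ m * y) \<le> 1 * u y"
        using x y v.power_K True u.av_nonneg by (simp add: u.av_mult u.av_power mult_left_le_one_le power_le_one)
      thus ?thesis using y by simp
    qed
    ultimately show ?thesis using m x y v.mult_K v.power_K by blast
  next
    case False
    define z where "z m = x ^ m / (1 + x ^ m) * y" for m
    have "\<forall>\<^sub>F m in sequentially. \<forall>v'\<in>V. v' (z m) < 1"
    proof (rule ev)
      fix v' assume v': "v' \<in> V"
      interpret v': abs_field K v' using insert v' by simp
      have "v'.conv z (0 * y)" unfolding z_def using v'.conv_ratio(1) x y v' by (intro v'.conv_mult v'.conv_const) auto
      thus "(\<lambda>m. v' (z m)) \<longlonglongrightarrow> 0" using v'.conv_v v'.av_zero by fastforce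
    qed
    moreover have "\<forall>\<^sub>F m in sequentially. v (z m) > 1"
    proof -
      have "v.conv z (1 * y)" unfolding z_def using v.conv_ratio(2) x y by (intro v.conv_mult v.conv_const) auto
      thus ?thesis using order_tendstoD(1)[OF v.conv_v] y by fastforce
    qed
    moreover have "\<forall>\<^sub>F m in sequentially. u (z m) < 1"
    proof -
      have "u.conv z (1 * y)" unfolding z_def using u.conv_ratio(2) x y False by (intro u.conv_mult u.conv_const) auto
      thus ?thesis using order_tendstoD(2)[OF u.conv_v] y by fastforce
    qed
    ultimately have "\<forall>\<^sub>F m in sequentially. v (z m) > 1 \<and> u (z m) < 1 \<and> (\<forall>v'\<in>V. v' (z m) < 1)"
      by eventually_elim auto
    then obtain m where "v (z m) > 1 \<and> u (z m) < 1 \<and> (\<forall>v'\<in>V. v' (z m) < 1)" by (auto simp: eventually_sequentially)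
    moreover have "z m \<in> K" unfolding z_def using x y v.closed_K by simp
    ultimately show ?thesis by auto
  qed
qed

lemma (in complex_subfield) polys_synthetic_div: "p \<in> polys \<Longrightarrow> c \<in> K \<Longrightarrow> synthetic_div p c \<in> polys"
  by (induction p) (auto simp: polys_pCons polys_zero poly_K)

text \<open>A quantitative form of interpolation: a polynomial of degree less than |S| depends
  linearly on its values on \<open>S\<close>. In the induction, division by X - s0 leaves a quotient
  whose values on the remaining points are at most 2M / |s - s0|, and \<open>D\<close> collects
  these factors.\<close>

lemma (in abs_field) coeff_bound_by_values:
  assumes "finite S" "S \<subseteq> K"
  shows "\<exists>C\<ge>0. \<forall>q M. q \<in> polys \<longrightarrow> (\<forall>i\<ge>card S. poly.coeff q i = 0) \<longrightarrow> (\<forall>s\<in>S. v (poly q s) \<le> M)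
    \<longrightarrow> 0 \<le> M \<longrightarrow> (\<forall>k. v (poly.coeff q k) \<le> C * M)"
  using assms
proof (induction S rule: finite_induct)
  case empty
  show ?case by (intro exI[of _ 0]) (auto simp: av_zero)
next
  case (insert s0 S)
  then obtain C where C: "C \<ge> 0" "\<And>q M k. q \<in> polys \<Longrightarrow> (\<forall>i\<ge>card S. poly.coeff q i = 0) \<Longrightarrow> (\<forall>s\<in>S. v (poly q s) \<le> M)
    \<Longrightarrow> 0 \<le> M \<Longrightarrow> v (poly.coeff q k) \<le> C * M" by auto
  have s0: "s0 \<in> K" "S \<subseteq> K" using insert by auto
  define D where "D = (\<Sum>s\<in>S. 2 / v (s - s0))"
  have D0: "D \<ge> 0" unfolding D_def using s0 by (intro sum_nonneg divide_nonneg_nonneg av_nonneg) (auto intro: diff_K)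
  define C' where "C' = 1 + v s0 * (C * D) + C * D"
  have "C' \<ge> 0" unfolding C'_def using C D0 av_nonneg s0 by simp
  moreover have "v (poly.coeff q k) \<le> C' * M"
    if q: "q \<in> polys" "\<forall>i\<ge>card (insert s0 S). poly.coeff q i = 0" "\<forall>s\<in>insert s0 S. v (poly q s) \<le> M" "0 \<le> M" for q M k
  proof -
    define r where "r = synthetic_div q s0"
    have r: "r \<in> polys" unfolding r_def using q s0 polys_synthetic_div by blast
    have qr: "q = [:- s0, 1:] * r + [:poly q s0:]" unfolding r_def by (rule synthetic_div_correct'[symmetric])
    have coeffq: "poly.coeff q k = - s0 * poly.coeff r k + (case k of 0 \<Rightarrow> 0 | Suc i \<Rightarrow> poly.coeff r i) + (if k = 0 then poly q s0 else 0)" for k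
      by (subst qr) (simp add: Polynomial.coeff_pCons split: nat.splits)
    have "\<forall>i\<ge>card S. poly.coeff r i = 0"
    proof (cases "r = 0")
      case False
      have "Polynomial.degree q \<le> card S"
        using q(2) insert(1,2) by (intro degree_le) auto
      moreover have "Polynomial.degree q \<noteq> 0" using False by (auto simp: r_def synthetic_div_eq_0_iff)
      ultimately have "Polynomial.degree r < card S" unfolding r_def degree_synthetic_div by linarith
      thus ?thesis by (auto simp: coeff_eq_0)
    qed simp
    moreover have "\<forall>s\<in>S. v (poly r s) \<le> D * M"
    proof
      fix s assume s: "s \<in> S"
      have sK: "s \<in> K" "s \<noteq> s0" using s s0 insert by auto
      have "poly q s = (s - s0) * poly r s + poly q s0" by (subst qr) (simp add: algebra_simps)
      hence "(s - s0) * poly r s = poly q s - poly q s0" by (metis add_diff_cancel_right')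
      hence "v (s - s0) * v (poly r s) = v (poly q s - poly q s0)"
        using av_mult[OF diff_K[OF sK(1) s0(1)] poly_K[OF r sK(1)]] by simp
      also have "\<dots> \<le> v (poly q s) + v (poly q s0)" using q poly_K s0 sK by (intro av_diff) auto
      also have "\<dots> \<le> 2 * M" using bspec[OF q(3), of s] bspec[OF q(3), of s0] s by simp
      finally have "v (poly r s) \<le> 2 / v (s - s0) * M"
        using av_pos[OF diff_K[OF sK(1) s0(1)]] sK by (simp add: field_simps)
      also have "2 / v (s - s0) \<le> D" unfolding D_def
        by (rule member_le_sum[OF s]) (use insert(1) s0 in \<open>auto intro!: divide_nonneg_nonneg av_nonneg diff_K\<close>)
      finally show "v (poly r s) \<le> D * M" using q(4) by (simp add: mult_right_mono)
    qed
    ultimately have br: "v (poly.coeff r k) \<le> C * (D * M)" for k using C(2)[OF r] D0 q(4) by simp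
    have rK: "poly.coeff r k \<in> K" for k using r by (simp add: polys_def)
    have qs0: "poly q s0 \<in> K" "v (poly q s0) \<le> M" using q poly_K s0 by auto
    have "v (poly.coeff q k) \<le> v (- s0 * poly.coeff r k) + v (case k of 0 \<Rightarrow> 0 | Suc i \<Rightarrow> poly.coeff r i) + v (if k = 0 then poly q s0 else 0)"
    proof -
      have k: "- s0 * poly.coeff r k \<in> K" "(case k of 0 \<Rightarrow> 0 | Suc i \<Rightarrow> poly.coeff r i) \<in> K" "(if k = 0 then poly q s0 else 0) \<in> K"
        using s0 rK qs0 by (auto intro!: mult_K uminus_K zero_K split: nat.splits)
      show ?thesis unfolding coeffq using av_add[OF add_K[OF k(1,2)] k(3)] av_add[OF k(1,2)] by linarith
    qed
    also have "v (- s0 * poly.coeff r k) \<le> v s0 * (C * (D * M))"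
      using av_mult[OF uminus_K[OF s0(1)] rK] av_uminus[OF s0(1)] mult_left_mono[OF br av_nonneg[OF s0(1)]] by simp
    also have "v (case k of 0 \<Rightarrow> 0 | Suc i \<Rightarrow> poly.coeff r i) \<le> C * (D * M)"
      using br C(1) D0 q(4) by (auto simp: av_zero split: nat.splits)
    also have "v (if k = 0 then poly q s0 else 0) \<le> M" using qs0 q(4) by (simp add: av_zero)
    finally show ?thesis by (simp add: C'_def algebra_simps)
  qed
  ultimately show ?case by blast
qed

text \<open>The field \<open>A\<close> has to contain the conjugates. It is instantiated by the
  complex numbers with \<open>cmod\<close> and, for each prime, by the algebraic numbers with an
  extension of the p-adic absolute value. Nontriviality on the rationals supplies the
  \<open>q0\<close> of weak approximation.\<close>

locale local_field = primitive_field K \<theta> g + L: abs_field A w for K \<theta> g A w +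
  assumes Z_A: "Z \<subseteq> A" and nontrivial: "\<exists>q. w (of_rat q) > 1"
begin

lemma sg_A: assumes "z \<in> Z" shows "sg z y \<in> A"
  unfolding sg_def by (rule L.poly_K[OF L.polys_of_rat]) (use assms Z_A in auto)

definition place_over :: "(complex \<Rightarrow> real) \<Rightarrow> bool" where
  "place_over v \<longleftrightarrow> abs_field K v \<and> (\<forall>q. v (of_rat q) = w (of_rat q))"

definition conj_abs :: "complex \<Rightarrow> complex \<Rightarrow> real" where
  "conj_abs z y = w (sg z y)"

lemma place_over_conj_abs: assumes z: "z \<in> Z" shows "place_over (conj_abs z)"
  unfolding place_over_def
proof (intro conjI allI)
  show "conj_abs z (of_rat q) = w (of_rat q)" for q by (simp add: conj_abs_def sg_of_rat[OF z])
  show "abs_field K (conj_abs z)"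
  proof (intro abs_field.intro abs_field_axioms.intro)
    show "complex_subfield K" by (rule complex_subfield_axioms)
    show "absolute_value (nf_ring K) (conj_abs z)" unfolding absolute_value_def nf_ring_simps conj_abs_def
      using L.av_nonneg[OF sg_A[OF z]] L.av_eq_0[OF sg_A[OF z]] sg_eq_0[OF z] L.av_mult[OF sg_A[OF z] sg_A[OF z]]
        L.av_add[OF sg_A[OF z] sg_A[OF z]] sg_mult[OF z] sg_add[OF z] by simp
  qed
qed

lemma char_poly_root: assumes "y \<in> K" "rp c = (\<Prod>z\<in>Z. [:- sg z y, 1:])" shows "poly (rp c) y = 0"
  unfolding assms(2) poly_prod using theta_Z sg_theta[OF assms(1)] finite_Z
  by (auto intro!: prod_zero bexI[of _ \<theta>])

lemma char_poly_degree: assumes "rp c = (\<Prod>z\<in>Z. [:- sg z y, 1:])"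
  shows "Polynomial.degree c = n" "poly.coeff c n = 1"
proof -
  have "Polynomial.degree (rp c) = n" unfolding assms card_Z[symmetric] by (subst degree_prod_eq_sum_degree) auto
  thus d: "Polynomial.degree c = n" by simp
  have "Polynomial.lead_coeff (rp c) = 1" unfolding assms by (simp add: lead_coeff_prod)
  thus "poly.coeff c n = 1" using d by simp
qed

lemma char_poly_expand:
  assumes "rp c = (\<Prod>z\<in>Z. [:- sg z y, 1:])"
  shows "poly (rp c) x = (\<Sum>j<n. of_rat (poly.coeff c j) * x ^ j) + x ^ n"
  using char_poly_degree[OF assms] by (simp add: poly_altdef atMost_Suc lessThan_Suc_atMost[symmetric])

text \<open>Otherwise weak approximation provides \<open>x\<close> with v x > 1 all of whose
  conjugates are small for \<open>w\<close>. Then the lower coefficients of the characteristic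
  polynomial of x^k tend to 0 for \<open>w\<close>, hence also for \<open>v\<close>, because they
  are rational. For large \<open>k\<close> the monic equation contradicts v(x^k) \<ge> 1.\<close>

lemma place_over_cases:
  assumes v: "place_over v" obtains z where "z \<in> Z" "\<And>y. y \<in> K \<Longrightarrow> v y = conj_abs z y"
proof -
  have "\<exists>z\<in>Z. \<forall>y\<in>K. v y = conj_abs z y"
  proof (rule ccontr)
    assume no: "\<not> ?thesis"
    interpret v: abs_field K v using v by (simp add: place_over_def)
    obtain q0 where q0: "w (of_rat q0) > 1" using nontrivial by blast
    have "\<exists>x\<in>K. v x > 1 \<and> (\<forall>v'\<in>conj_abs ` Z. v' x < 1)"
    proof (rule weak_approximation_aux)
      show "abs_field K v" by (rule v.abs_field_axioms)
      show "v (of_rat q0) > 1" using v q0 by (simp add: place_over_def)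
      show "finite (conj_abs ` Z)" using finite_Z by simp
    qed (use place_over_conj_abs v no in \<open>auto simp: place_over_def\<close>)
    then obtain x where x: "x \<in> K" "v x > 1" "\<And>z. z \<in> Z \<Longrightarrow> w (sg z x) < 1" by (auto simp: conj_abs_def)
    have "\<exists>c. rp c = (\<Prod>z\<in>Z. [:- sg z (x ^ k), 1:])" for k
      using characteristic_polynomial[OF power_K[OF x(1)], of k] by metis
    then obtain c where c: "\<And>k. rp (c k) = (\<Prod>z\<in>Z. [:- sg z (x ^ k), 1:])" by metis
    have sgp: "sg z (x ^ k) = sg z x ^ k" if "z \<in> Z" for z k
      by (induction k) (use that sg_1 sg_mult x power_K in auto)
    have "L.conv (\<lambda>k. sg z (x ^ k)) 0" if z: "z \<in> Z" for z
    proof -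
      have "(\<lambda>k. w (sg z x) ^ k) \<longlonglongrightarrow> 0" using x(3)[OF z] L.av_nonneg[OF sg_A[OF z]] by (intro LIMSEQ_realpow_zero) auto
      thus ?thesis using sg_A[OF z] by (simp add: L.conv_zero_iff sgp[OF z] L.av_power L.power_K)
    qed
    hence cv: "L.conv (\<lambda>k. poly.coeff (rp (c k)) j) (poly.coeff (\<Prod>z\<in>Z. [:- 0, 1:]) j)" for j
      unfolding c by (intro L.conv_prod_coeff finite_Z)
    have "poly.coeff (\<Prod>z\<in>Z. [:- 0, 1:] :: complex poly) j = 0" if "j < n" for j
      using that by (simp add: card_Z monom_altdef[symmetric, of "1::complex", simplified])
    hence "L.conv (\<lambda>k. of_rat (poly.coeff (c k) j)) 0" if "j < n" for j
      using cv[of j] that by simp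
    hence "(\<lambda>k. w (of_rat (poly.coeff (c k) j))) \<longlonglongrightarrow> 0" if "j < n" for j
      using that L.of_rat_K L.conv_zero_iff by simp
    hence lim: "(\<lambda>k. v (of_rat (poly.coeff (c k) j))) \<longlonglongrightarrow> 0" if "j < n" for j
      using that v by (simp add: place_over_def)
    have "(\<lambda>k. \<Sum>j<n. v (of_rat (poly.coeff (c k) j))) \<longlonglongrightarrow> (\<Sum>j<n. 0)"
      by (intro tendsto_sum lim) simp
    hence "(\<lambda>k. \<Sum>j<n. v (of_rat (poly.coeff (c k) j))) \<longlonglongrightarrow> 0" by simp
    from order_tendstoD(2)[OF this, of 1] obtain k where k: "(\<Sum>j<n. v (of_rat (poly.coeff (c k) j))) < 1"
      by (auto simp: eventually_sequentially)
    define y where "y = x ^ k"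
    have y: "y \<in> K" "v y \<ge> 1" using x power_K by (auto simp: y_def v.av_power intro!: one_le_power)
    have "(\<Sum>j<n. of_rat (poly.coeff (c k) j) * y ^ j) + y ^ n = 0"
      using char_poly_expand[OF c] char_poly_root[OF y(1)] c unfolding y_def by metis
    hence "y ^ n = - (\<Sum>j<n. of_rat (poly.coeff (c k) j) * y ^ j)" by (simp add: eq_neg_iff_add_eq_0 add.commute)
    moreover have "(\<Sum>j<n. of_rat (poly.coeff (c k) j) * y ^ j) \<in> K" by (intro sum_K mult_K of_rat_K power_K y)
    ultimately have "v y ^ n = v (\<Sum>j<n. of_rat (poly.coeff (c k) j) * y ^ j)"
      using v.av_uminus v.av_power[OF y(1)] by metis
    also have "\<dots> \<le> (\<Sum>j<n. v (of_rat (poly.coeff (c k) j) * y ^ j))"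
      using y closed_K by (intro v.av_sum) auto
    also have "\<dots> = (\<Sum>j<n. v (of_rat (poly.coeff (c k) j)) * v y ^ j)"
      using y closed_K by (intro sum.cong refl) (simp add: v.av_mult v.av_power)
    also have "\<dots> \<le> (\<Sum>j<n. v (of_rat (poly.coeff (c k) j)) * v y ^ n)"
      using y of_rat_K v.av_nonneg by (intro sum_mono mult_left_mono power_increasing) auto
    also have "\<dots> = (\<Sum>j<n. v (of_rat (poly.coeff (c k) j))) * v y ^ n" by (simp add: sum_distrib_right)
    also have "\<dots> < 1 * v y ^ n" using k y by (intro mult_strict_right_mono) auto
    finally show False by simp
  qed
  thus ?thesis using that by blast
qed

text \<open>Up to sign, \<open>r\<close> is the constant coefficient of the characteristic
  polynomial. The second property pins it down as a complex number independent of \<open>w\<close>,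
  which is how the values for different primes are later identified.\<close>

lemma norm_rational:
  assumes x: "x \<in> K" "x \<noteq> 0"
  obtains r :: rat where "r \<noteq> 0" "of_rat r = (\<Prod>z\<in>Z. sg z x)" "(\<Sum>z\<in>Z. ln (conj_abs z x)) = ln (w (of_rat r))"
proof -
  obtain c where c: "rp c = (\<Prod>z\<in>Z. [:- sg z x, 1:])" using characteristic_polynomial[OF x(1)] .
  have "of_rat (poly.coeff c 0) = poly (rp c) 0" by (simp add: poly_0_coeff_0)
  also have "\<dots> = (\<Prod>z\<in>Z. - sg z x)" unfolding c by (simp add: poly_prod)
  also have "\<dots> = (-1) ^ n * (\<Prod>z\<in>Z. sg z x)" by (simp add: prod_uminus card_Z)
  finally have 1: "of_rat ((-1) ^ n * poly.coeff c 0) = (\<Prod>z\<in>Z. sg z x)" by (simp add: of_rat_mult of_rat_power)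
  have nz: "sg z x \<noteq> 0" if "z \<in> Z" for z using sg_eq_0[OF that x(1)] x(2) by simp
  have "of_rat ((-1) ^ n * poly.coeff c 0) \<noteq> (0::complex)" unfolding 1 using finite_Z nz by simp
  moreover have "(\<Sum>z\<in>Z. ln (conj_abs z x)) = ln (w (of_rat ((-1) ^ n * poly.coeff c 0)))"
  proof -
    have "ln (\<Prod>z\<in>Z. w (sg z x)) = (\<Sum>z\<in>Z. ln (w (sg z x)))"
    proof (rule ln_prod)
      show "w (sg z x) \<noteq> 0" if "z \<in> Z" for z using L.av_pos[OF sg_A[OF that] nz[OF that]] by simp
    qed (use finite_Z L.av_pos[OF sg_A nz] in auto)
    thus ?thesis unfolding 1 conj_abs_def using L.av_prod[of Z "\<lambda>z. sg z x"] sg_A by simp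
  qed
  ultimately show ?thesis by (intro that[OF _ 1]) force+
qed

end

lemma weak_approximation:
  assumes "abs_field K v" "v (of_rat q0) > 1" "finite V"
    "\<And>v'. v' \<in> V \<Longrightarrow> abs_field K v'" "\<And>v' q. v' \<in> V \<Longrightarrow> v (of_rat q) = v' (of_rat q)"
    "\<And>v'. v' \<in> V \<Longrightarrow> \<exists>x\<in>K. v x \<noteq> v' x"
  shows "\<exists>u. abs_field.conv K v u 1 \<and> (\<forall>v'\<in>V. abs_field.conv K v' u 0)"
proof -
  obtain x where x: "x \<in> K" "v x > 1" "\<forall>v'\<in>V. v' x < 1" using weak_approximation_aux[of K v q0 V] assms by blast
  show ?thesis
  proof (intro exI conjI ballI)
    show "abs_field.conv K v (\<lambda>m. x ^ m / (1 + x ^ m)) 1" using abs_field.conv_ratio(2)[OF assms(1)] x by blast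
    show "abs_field.conv K v' (\<lambda>m. x ^ m / (1 + x ^ m)) 0" if "v' \<in> V" for v'
      using abs_field.conv_ratio(1)[OF assms(4)] x that by blast
  qed
qed

lemma sum_lessThan_add: "(\<Sum>j<k + a. f j) = (\<Sum>j<k. f j) + (\<Sum>i<a. f (k + i))" for f :: "nat \<Rightarrow> 'a::comm_monoid_add"
  by (induction a) (auto simp: add.assoc)

lemma (in abs_field) conv_bounded_mult:
  assumes "\<And>m. b m \<in> K" "(\<lambda>m. v (b m)) \<longlonglongrightarrow> B" "conv t 0"
  shows "conv (\<lambda>m. b m * t m) 0"
proof -
  have t: "t m \<in> K" for m using assms(3) by (simp add: conv_def)
  have "(\<lambda>m. v (b m) * v (t m)) \<longlonglongrightarrow> B * 0"
    by (intro tendsto_mult assms(2)) (use assms(3) t in \<open>simp add: conv_zero_iff\<close>)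
  thus ?thesis using assms(1) t by (simp add: conv_zero_iff mult_K av_mult)
qed

context local_field
begin

lemma sg_diff: "z \<in> Z \<Longrightarrow> x \<in> K \<Longrightarrow> y \<in> K \<Longrightarrow> sg z (x - y) = sg z x - sg z y"
  using sg_add[of z "x - y" y] diff_K[of x y] by (simp add: algebra_simps)

text \<open>The embeddings of \<open>K\<close> that induce \<open>v\<close>, identified with the
  images of \<theta>; by \<open>loc_degree_eq\<close> their number is the local degree.\<close>

definition Zv :: "(complex \<Rightarrow> real) \<Rightarrow> complex set" where
  "Zv v = {z \<in> Z. \<forall>y\<in>K. v y = conj_abs z y}"

lemma Zv_subset: "Zv v \<subseteq> Z" by (auto simp: Zv_def)

lemma finite_Zv: "finite (Zv v)" using finite_subset[OF Zv_subset finite_Z] .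

lemma card_Zv_le: "card (Zv v) \<le> n" using card_mono[OF finite_Z Zv_subset] card_Z by simp

context
  fixes v assumes v: "place_over v"
begin

interpretation v: abs_field K v using v by (simp add: place_over_def)

lemma v_rat: "v (of_rat q) = w (of_rat q)" using v by (simp add: place_over_def)

abbreviation "a \<equiv> card (Zv v)"

lemma a_pos: "a > 0"
proof -
  obtain z where "z \<in> Z" "\<And>y. y \<in> K \<Longrightarrow> v y = conj_abs z y" using place_over_cases[OF v] by metis
  hence "z \<in> Zv v" by (simp add: Zv_def)
  thus ?thesis using finite_Zv by (auto simp: card_gt_0_iff)
qed

text \<open>At every point of \<open>Zv v\<close> the polynomial has the \<open>w\<close>-value
  v(q(\<theta>)), so interpolation at these \<open>a\<close> points bounds its coefficients. This
  yields both the independence of the first \<open>a\<close> powers of \<theta> over the completed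
  rationals and the convergence of coefficients.\<close>

lemma coeff_bound:
  "\<exists>C\<ge>0. \<forall>q k. (\<forall>i\<ge>a. poly.coeff q i = 0) \<longrightarrow> v (of_rat (poly.coeff q k)) \<le> C * v (poly (rp q) \<theta>)"
proof -
  have "Zv v \<subseteq> A" using Zv_subset Z_A by blast
  from L.coeff_bound_by_values[OF finite_Zv this] obtain C where
    C: "C \<ge> 0" "\<And>q M k. q \<in> L.polys \<Longrightarrow> (\<forall>i\<ge>a. poly.coeff q i = 0) \<Longrightarrow> (\<forall>s\<in>Zv v. w (poly q s) \<le> M)
    \<Longrightarrow> 0 \<le> M \<Longrightarrow> w (poly.coeff q k) \<le> C * M" by auto
  have "v (of_rat (poly.coeff q k)) \<le> C * v (poly (rp q) \<theta>)" if q: "\<forall>i\<ge>a. poly.coeff q i = 0" for q k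
  proof -
    have "w (poly.coeff (rp q) k) \<le> C * v (poly (rp q) \<theta>)"
    proof (rule C(2))
      show "rp q \<in> L.polys" by (rule L.polys_of_rat)
      show "\<forall>i\<ge>a. poly.coeff (rp q) i = 0" using q by simp
      show "0 \<le> v (poly (rp q) \<theta>)" by (rule v.av_nonneg[OF rat_poly_K])
      show "\<forall>s\<in>Zv v. w (poly (rp q) s) \<le> v (poly (rp q) \<theta>)"
      proof
        fix s assume s: "s \<in> Zv v"
        hence "v (poly (rp q) \<theta>) = w (sg s (poly (rp q) \<theta>))" using rat_poly_K by (simp add: Zv_def conj_abs_def)
        moreover have "s \<in> Z" using s Zv_subset by blast
        ultimately show "w (poly (rp q) s) \<le> v (poly (rp q) \<theta>)" using sg_poly[of s q] by simp
      qed
    qed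
    thus ?thesis by (simp add: v_rat)
  qed
  thus ?thesis using C(1) by blast
qed

text \<open>
  Let \<open>u\<close> tend to \<open>\<theta>\<close> at \<open>v\<close> and to \<open>0\<close> at the other places above the same place of \<open>\<rat>\<close>. Then
  \<open>n - a\<close> conjugates of \<open>u\<close> tend to \<open>0\<close>, so the characteristic polynomial of \<open>u\<close> is close to
  \<open>x ^ (n - a)\<close> times a monic polynomial of degree \<open>a\<close>, which nearly annihilates \<open>\<theta>\<close> at \<open>v\<close>.
\<close>

lemma theta_power_approx:
  assumes e: "e > 0"
  shows "\<exists>r. (\<forall>i\<ge>a. poly.coeff r i = 0) \<and> v (\<theta> ^ a - poly (rp r) \<theta>) < e"
proof -
  obtain q0 where q0: "w (of_rat q0) > 1" using nontrivial by blast
  have "\<exists>u. v.conv u 1 \<and> (\<forall>v'\<in>conj_abs ` (Z - Zv v). abs_field.conv K v' u 0)"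
  proof (rule weak_approximation[of K v q0 "conj_abs ` (Z - Zv v)"])
    show "abs_field K v" by (rule v.abs_field_axioms)
    show "v (of_rat q0) > 1" using q0 v_rat by simp
    show "finite (conj_abs ` (Z - Zv v))" using finite_Z by simp
    show "abs_field K v'" if "v' \<in> conj_abs ` (Z - Zv v)" for v'
      using that place_over_conj_abs by (auto simp: place_over_def)
    show "v (of_rat q) = v' (of_rat q)" if "v' \<in> conj_abs ` (Z - Zv v)" for v' q
      using that place_over_conj_abs v_rat by (auto simp: place_over_def)
    show "\<exists>x\<in>K. v x \<noteq> v' x" if "v' \<in> conj_abs ` (Z - Zv v)" for v'
      using that by (auto simp: Zv_def)
  qed
  then obtain u where u: "v.conv u 1" "\<And>v'. v' \<in> conj_abs ` (Z - Zv v) \<Longrightarrow> abs_field.conv K v' u 0" by blast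
  define s where "s m = \<theta> * u m" for m
  have cs: "v.conv s \<theta>" unfolding s_def using v.conv_mult[OF v.conv_const[OF theta_K] u(1)] by simp
  have sK: "s m \<in> K" for m using v.conv_K(1)[OF cs] .
  \<comment> \<open>The limits of the conjugates of \<open>s m\<close>: an embedding in
    \<open>Zv v\<close> carries s m - \<theta> to a number of the same size, while at the other
    embeddings the factor \<open>u m\<close> dominates.\<close>
  define d where "d z = (if z \<in> Zv v then z else 0)" for z
  have lim: "L.conv (\<lambda>m. sg z (s m)) (d z)" if z: "z \<in> Z" for z
  proof (cases "z \<in> Zv v")
    case True
    have "w (sg z (s m) - z) = v (s m - \<theta>)" for m
    proof -
      have "sg z (s m) - z = sg z (s m - \<theta>)" using sg_diff[OF z sK theta_K] sg_theta_eq[OF z] by simp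
      thus ?thesis using True diff_K[OF sK theta_K] by (simp add: Zv_def conj_abs_def)
    qed
    thus ?thesis using cs True sg_A[OF z] Z_A z by (auto simp: L.conv_def v.conv_def d_def)
  next
    case False
    interpret z: abs_field K "conj_abs z" using place_over_conj_abs[OF z] by (simp add: place_over_def)
    have "z.conv u 0" using u(2) z False by blast
    hence "z.conv s (\<theta> * 0)" unfolding s_def by (intro z.conv_mult z.conv_const theta_K)
    hence "(\<lambda>m. conj_abs z (s m)) \<longlonglongrightarrow> 0" using z.conv_zero_iff sK by simp
    thus ?thesis using False sg_A[OF z] by (simp add: L.conv_zero_iff d_def conj_abs_def)
  qed
  have "\<exists>c. rp c = (\<Prod>z\<in>Z. [:- sg z (s m), 1:])" for m
    using characteristic_polynomial[OF sK, of m] by metis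
  then obtain c where c: "\<And>m. rp (c m) = (\<Prod>z\<in>Z. [:- sg z (s m), 1:])" by metis
  define C where "C m j = complex_of_rat (poly.coeff (c m) j)" for m j
  define P where "P = (\<Prod>z\<in>Z. [:- d z, 1:])"
  have cC: "L.conv (\<lambda>m. C m j) (poly.coeff P j)" for j
  proof -
    have "L.conv (\<lambda>m. poly.coeff (rp (c m)) j) (poly.coeff P j)"
      unfolding c P_def by (intro L.conv_prod_coeff finite_Z lim)
    thus ?thesis by (simp add: C_def)
  qed
  have CK: "C m j \<in> K" for m j unfolding C_def by (rule of_rat_K)
  have vC: "(\<lambda>m. v (C m j)) \<longlonglongrightarrow> w (poly.coeff P j)" for j
    using L.conv_v[OF cC[of j]] by (simp add: C_def v_rat)
  have P0: "poly.coeff P j = 0" if "j < n - a" for j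
  proof -
    have "P = (\<Prod>z\<in>Z - Zv v. [:- d z, 1:]) * (\<Prod>z\<in>Zv v. [:- d z, 1:])"
      unfolding P_def by (rule prod.subset_diff[OF Zv_subset finite_Z])
    also have "(\<Prod>z\<in>Z - Zv v. [:- d z, 1:]) = (\<Prod>z\<in>Z - Zv v. [:0, 1:])"
      by (rule prod.cong) (auto simp: d_def)
    also have "\<dots> = Polynomial.monom 1 (n - a)"
      using card_Diff_subset[OF finite_Zv Zv_subset] by (simp add: card_Z monom_altdef)
    finally have "P = Polynomial.monom 1 (n - a) * (\<Prod>z\<in>Zv v. [:- d z, 1:])" .
    thus ?thesis using that by (simp add: coeff_monom_mult)
  qed
  define k where "k = n - a"
  have n: "n = k + a" using card_Zv_le by (simp add: k_def)
  have small: "v.conv (\<lambda>m. C m j) 0" if "j < k" for j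
    using vC[of j] P0[of j] that CK by (simp add: v.conv_zero_iff k_def L.av_zero)
  \<comment> \<open>The characteristic polynomial of \<open>s m\<close>, evaluated at \<theta>. It
    vanishes at \<open>s m\<close>, which tends to \<theta>, and the sizes of its coefficients
    converge, so \<open>F m\<close> tends to 0.\<close>
  define F where "F m = (\<Sum>j<n. C m j * \<theta> ^ j) + \<theta> ^ n" for m
  have F_eq: "F m = (\<Sum>j<n. C m j * (\<theta> ^ j - s m ^ j)) + (\<theta> ^ n - s m ^ n)" for m
  proof -
    have "(\<Sum>j<n. C m j * s m ^ j) + s m ^ n = 0"
      using char_poly_expand[OF c, of m "s m"] char_poly_root[OF sK c] by (simp add: C_def)
    thus ?thesis by (simp add: F_def algebra_simps sum_subtractf)
  qed
  have diff0: "v.conv (\<lambda>m. \<theta> ^ j - s m ^ j) 0" for j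
    using v.conv_diff[OF v.conv_const[OF power_K[OF theta_K]] v.conv_power[OF cs], of j j] by simp
  have "v.conv (\<lambda>m. (\<Sum>j<n. C m j * (\<theta> ^ j - s m ^ j)) + (\<theta> ^ n - s m ^ n)) ((\<Sum>j<n. 0) + 0)"
    by (intro v.conv_add v.conv_sum diff0 finite_lessThan v.conv_bounded_mult[OF CK vC])
  hence F0: "v.conv F 0" unfolding F_eq[abs_def] by simp
  have "v.conv (\<lambda>m. inverse (\<theta> ^ k) * (F m - (\<Sum>j<k. C m j * \<theta> ^ j))) (inverse (\<theta> ^ k) * (0 - (\<Sum>j<k. 0 * \<theta> ^ j)))"
    by (intro v.conv_mult v.conv_diff v.conv_sum F0 small v.conv_const finite_lessThan inverse_K power_K theta_K) auto
  moreover have "inverse (\<theta> ^ k) * (F m - (\<Sum>j<k. C m j * \<theta> ^ j)) = \<theta> ^ a + (\<Sum>i<a. C m (k + i) * \<theta> ^ i)" for m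
  proof -
    have "F m - (\<Sum>j<k. C m j * \<theta> ^ j) = (\<Sum>i<a. C m (k + i) * \<theta> ^ (k + i)) + \<theta> ^ (k + a)"
      unfolding F_def n sum_lessThan_add by simp
    also have "\<dots> = \<theta> ^ k * (\<theta> ^ a + (\<Sum>i<a. C m (k + i) * \<theta> ^ i))"
      by (simp add: power_add algebra_simps sum_distrib_left)
    finally show ?thesis using theta_nz by simp
  qed
  ultimately have "v.conv (\<lambda>m. \<theta> ^ a + (\<Sum>i<a. C m (k + i) * \<theta> ^ i)) 0" by simp
  hence "(\<lambda>m. v (\<theta> ^ a + (\<Sum>i<a. C m (k + i) * \<theta> ^ i))) \<longlonglongrightarrow> 0"
    by (simp add: v.conv_def)
  from order_tendstoD(2)[OF this e] obtain m where m: "v (\<theta> ^ a + (\<Sum>i<a. C m (k + i) * \<theta> ^ i)) < e"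
    by (auto simp: eventually_sequentially)
  define r where "r = - (\<Sum>i<a. Polynomial.monom (poly.coeff (c m) (k + i)) i)"
  have cr: "poly.coeff r j = (if j < a then - poly.coeff (c m) (k + j) else 0)" for j
    by (simp add: r_def coeff_sum)
  have "rp r = - (\<Sum>i<a. Polynomial.monom (C m (k + i)) i)"
    by (rule poly_eqI) (simp add: cr coeff_sum C_def of_rat_minus)
  hence "poly (rp r) \<theta> = - (\<Sum>i<a. C m (k + i) * \<theta> ^ i)" by (simp add: poly_sum poly_monom)
  thus ?thesis using m cr by (intro exI[of _ r]) simp
qed

text \<open>Horner induction over a polynomial expression of \<open>y\<close>. Multiplying the
  approximation by \<theta> creates at most one term of degree \<open>a\<close>, with coefficient
  \<open>t\<close>, which \<open>theta_power_approx\<close> trades for lower powers. Each of the two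
  errors is kept below e/2.\<close>

lemma rat_polys_dense:
  assumes y: "y \<in> K" and e: "e > 0"
  shows "\<exists>q. (\<forall>i\<ge>a. poly.coeff q i = 0) \<and> v (y - poly (rp q) \<theta>) < e"
proof -
  obtain h where "y = poly (rp h) \<theta>" using gen[OF y] by blast
  moreover have "\<forall>e>0. \<exists>q. (\<forall>i\<ge>a. poly.coeff q i = 0) \<and> v (poly (rp h) \<theta> - poly (rp q) \<theta>) < e"
  proof (induction h)
    case 0
    show ?case by (intro allI impI exI[of _ 0]) (simp add: v.av_zero)
  next
    case (pCons c h)
    show ?case
    proof (intro allI impI)
      fix e :: real assume e: "e > 0"
      have vt: "v \<theta> > 0" using v.av_pos theta_K theta_nz by blast
      obtain q where q: "\<forall>i\<ge>a. poly.coeff q i = 0" "v (poly (rp h) \<theta> - poly (rp q) \<theta>) < e / (2 * v \<theta>)"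
        using pCons.IH e vt by (meson divide_pos_pos mult_pos_pos zero_less_numeral)
      define t where "t = poly.coeff q (a - 1)"
      have vt0: "0 \<le> v (of_rat t)" by (rule v.av_nonneg[OF of_rat_K])
      obtain r where r: "\<forall>i\<ge>a. poly.coeff r i = 0" "v (\<theta> ^ a - poly (rp r) \<theta>) < e / (2 * (v (of_rat t) + 1))"
        using theta_power_approx[of "e / (2 * (v (of_rat t) + 1))"] e vt0 by auto
      define q' where "q' = pCons c q - Polynomial.monom t a + Polynomial.smult t r"
      have "\<forall>i\<ge>a. poly.coeff q' i = 0"
      proof (intro allI impI)
        fix i assume i: "a \<le> i"
        then obtain j where j: "i = Suc j" using a_pos by (cases i) auto
        show "poly.coeff q' i = 0"
        proof (cases "i = a")
          case True
          have "poly.coeff (pCons c q) i = poly.coeff q (i - 1)" using j by simp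
          thus ?thesis using r(1) True by (simp add: q'_def t_def)
        next
          case False
          thus ?thesis using r(1) q(1) i j by (simp add: q'_def)
        qed
      qed
      moreover have "v (poly (rp (pCons c h)) \<theta> - poly (rp q') \<theta>) < e"
      proof -
        have "poly (rp (pCons c h)) \<theta> - poly (rp q') \<theta>
          = \<theta> * (poly (rp h) \<theta> - poly (rp q) \<theta>) + of_rat t * (\<theta> ^ a - poly (rp r) \<theta>)"
          by (simp add: q'_def rp_add rp_diff rp_pCons rp_smult poly_monom algebra_simps)
        hence "v (poly (rp (pCons c h)) \<theta> - poly (rp q') \<theta>)
          \<le> v (\<theta> * (poly (rp h) \<theta> - poly (rp q) \<theta>)) + v (of_rat t * (\<theta> ^ a - poly (rp r) \<theta>))"
          using v.av_add[of "\<theta> * (poly (rp h) \<theta> - poly (rp q) \<theta>)" "of_rat t * (\<theta> ^ a - poly (rp r) \<theta>)"]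
          by (simp add: mult_K diff_K theta_K rat_poly_K of_rat_K power_K)
        also have "\<dots> = v \<theta> * v (poly (rp h) \<theta> - poly (rp q) \<theta>) + v (of_rat t) * v (\<theta> ^ a - poly (rp r) \<theta>)"
          by (simp add: v.av_mult mult_K diff_K theta_K rat_poly_K of_rat_K power_K)
        also have "v \<theta> * v (poly (rp h) \<theta> - poly (rp q) \<theta>) < v \<theta> * (e / (2 * v \<theta>))"
          by (rule mult_strict_left_mono[OF q(2) vt])
        also have "v \<theta> * (e / (2 * v \<theta>)) = e / 2" using vt by simp
        also have "v (of_rat t) * v (\<theta> ^ a - poly (rp r) \<theta>) \<le> v (of_rat t) * (e / (2 * (v (of_rat t) + 1)))"
          using r(2) vt0 by (intro mult_left_mono) auto
        also have "\<dots> \<le> e / 2" using vt0 e by (simp add: field_simps)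
        finally show ?thesis by simp
      qed
      ultimately show "\<exists>q. (\<forall>i\<ge>a. poly.coeff q i = 0) \<and> v (poly (rp (pCons c h)) \<theta> - poly (rp q) \<theta>) < e" by blast
    qed
  qed
  ultimately show ?thesis using e by blast
qed

end

end

section \<open>The completion of \<open>K\<close> at a place and the rationals inside it\<close>

context abs_field
begin

lemma valued_field_nf_ring: "valued_field (nf_ring K) v"
  using field_nf_ring av by (simp add: valued_field_def valued_field_axioms_def)

sublocale VF: valued_field "nf_ring K" v by (rule valued_field_nf_ring)

lemma nf_uminus: "x \<in> K \<Longrightarrow> \<ominus>\<^bsub>nf_ring K\<^esub> x = - x"
  by (rule VF.minus_equality) (auto simp: nf_ring_simps uminus_K)

lemma nf_minus: "x \<in> K \<Longrightarrow> y \<in> K \<Longrightarrow> x \<ominus>\<^bsub>nf_ring K\<^esub> y = x - y"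
  by (simp add: a_minus_def nf_uminus nf_ring_simps)

lemma nf_inverse: "x \<in> K \<Longrightarrow> x \<noteq> 0 \<Longrightarrow> inv\<^bsub>nf_ring K\<^esub> x = inverse x"
  by (rule VF.inv_char) (auto simp: nf_ring_simps inverse_K)

lemma CS_iff: "s \<in> VF.CS \<longleftrightarrow> (\<forall>m. s m \<in> K) \<and> (\<forall>e>0. \<exists>N. \<forall>i\<ge>N. \<forall>j\<ge>N. v (s i - s j) < e)"
  by (auto simp: Cauchy_seqs_def nf_ring_simps nf_minus)

lemma CS_K: "s \<in> VF.CS \<Longrightarrow> s m \<in> K" by (simp add: CS_iff)

lemma CS_const: "x \<in> K \<Longrightarrow> (\<lambda>_. x) \<in> VF.CS"
  using VF.CS_const by (simp add: nf_ring_simps)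

lemma CS_add: "s \<in> VF.CS \<Longrightarrow> t \<in> VF.CS \<Longrightarrow> (\<lambda>m. s m + t m) \<in> VF.CS"
  using VF.CS_add by (simp add: nf_ring_simps)

lemma CS_mult: "s \<in> VF.CS \<Longrightarrow> t \<in> VF.CS \<Longrightarrow> (\<lambda>m. s m * t m) \<in> VF.CS"
  using VF.CS_mult by (simp add: nf_ring_simps)

lemma CS_uminus: "s \<in> VF.CS \<Longrightarrow> (\<lambda>m. - s m) \<in> VF.CS"
  using CS_mult[OF CS_const[of "-1"], of s] uminus_K[OF one_K] by simp

lemma CS_diff: "s \<in> VF.CS \<Longrightarrow> t \<in> VF.CS \<Longrightarrow> (\<lambda>m. s m - t m) \<in> VF.CS"
  using CS_add[OF _ CS_uminus] by fastforce

abbreviation "Kv \<equiv> loc_field K v"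

lemma Kv_eq: "Kv = completion (nf_ring K) v" by (simp add: loc_field_def)

lemma field_Kv: "field Kv" unfolding Kv_eq by (rule VF.field_completion)

lemma cls_add: "s \<in> VF.CS \<Longrightarrow> t \<in> VF.CS \<Longrightarrow> VF.cls s \<oplus>\<^bsub>Kv\<^esub> VF.cls t = VF.cls (\<lambda>m. s m + t m)"
  and cls_mult: "s \<in> VF.CS \<Longrightarrow> t \<in> VF.CS \<Longrightarrow> VF.cls s \<otimes>\<^bsub>Kv\<^esub> VF.cls t = VF.cls (\<lambda>m. s m * t m)"
  and cls_one: "\<one>\<^bsub>Kv\<^esub> = VF.cls (\<lambda>_. 1)"
  and cls_zero: "\<zero>\<^bsub>Kv\<^esub> = VF.cls (\<lambda>_. 0)"
  using VF.cls_add VF.cls_mult VF.cls_one VF.cls_zero by (simp_all add: Kv_eq nf_ring_simps)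

lemma cls_closed: "s \<in> VF.CS \<Longrightarrow> VF.cls s \<in> carrier Kv"
  using VF.cls_closed by (simp add: Kv_eq)

lemma cls_eq_iff: "s \<in> VF.CS \<Longrightarrow> t \<in> VF.CS \<Longrightarrow> VF.cls s = VF.cls t \<longleftrightarrow> (\<lambda>m. v (s m - t m)) \<longlonglongrightarrow> 0"
  using VF.cls_eq_iff[of s t] by (simp add: nf_minus CS_K)

lemma loc_base_iff: "c \<in> loc_base K v \<longleftrightarrow> (\<exists>s\<in>VF.CS. (\<forall>m. s m \<in> \<rat>) \<and> c = VF.cls s)"
proof
  assume "c \<in> loc_base K v"
  then obtain s where s: "c \<in> carrier Kv" "s \<in> c" "\<forall>m. s m \<in> \<rat>" by (auto simp: loc_base_def)
  obtain t where t: "t \<in> VF.CS" "c = VF.cls t" using VF.completion_cases[OF s(1)[unfolded Kv_eq]] by metis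
  have "s \<in> VF.CS \<and> (\<lambda>m. v (s m \<ominus>\<^bsub>nf_ring K\<^esub> t m)) \<longlonglongrightarrow> 0" using s(2) VF.mem_cls[OF t(1)] t(2) by blast
  hence "s \<in> VF.CS" "VF.cls s = VF.cls t" using VF.cls_eq_iff[OF _ t(1)] by blast+
  thus "\<exists>s\<in>VF.CS. (\<forall>m. s m \<in> \<rat>) \<and> c = VF.cls s" using s t by blast
next
  assume "\<exists>s\<in>VF.CS. (\<forall>m. s m \<in> \<rat>) \<and> c = VF.cls s"
  then obtain s where s: "s \<in> VF.CS" "\<forall>m. s m \<in> \<rat>" "c = VF.cls s" by blast
  have "s \<in> c" using VF.mem_cls[OF s(1), of s] s by (simp add: nf_minus CS_K av_zero)
  thus "c \<in> loc_base K v" using s cls_closed by (auto simp: loc_base_def)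
qed

text \<open>For inverses, the termwise inverse of a rational Cauchy sequence that is not null is
  again rational and represents the inverse class.\<close>

lemma subfield_loc_base: "subfield (loc_base K v) Kv"
proof -
  interpret F: field Kv by (rule field_Kv)
  have minus: "\<ominus>\<^bsub>Kv\<^esub> VF.cls s = VF.cls (\<lambda>m. - s m)" if "s \<in> VF.CS" for s
    by (rule F.minus_equality) (use that in \<open>auto simp: cls_add cls_zero CS_uminus cls_closed\<close>)
  have inv: "\<exists>t\<in>VF.CS. (\<forall>m. t m \<in> \<rat>) \<and> inv\<^bsub>Kv\<^esub> VF.cls s = VF.cls t"
    if s: "s \<in> VF.CS" "\<forall>m. s m \<in> \<rat>" "VF.cls s \<noteq> \<zero>\<^bsub>Kv\<^esub>" for s
  proof -
    have "\<not> (\<lambda>m. v (s m)) \<longlonglongrightarrow> 0" using s cls_eq_iff[OF s(1) CS_const[OF zero_K]] by (simp add: cls_zero)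
    hence nn: "s \<notin> VF.NS" by (simp add: VF.NS_iff)
    define t where "t = (\<lambda>m. if s m = \<zero>\<^bsub>nf_ring K\<^esub> then \<zero>\<^bsub>nf_ring K\<^esub> else inv\<^bsub>nf_ring K\<^esub> (s m))"
    have t: "t \<in> VF.CS" "\<forall>\<^sub>F m in sequentially. s m \<otimes>\<^bsub>nf_ring K\<^esub> t m = \<one>\<^bsub>nf_ring K\<^esub>"
      using VF.CS_inverse[OF s(1) nn] by (auto simp: t_def)
    have te: "t m = inverse (s m)" for m using CS_K[OF s(1)] by (simp add: t_def nf_ring_simps nf_inverse)
    have "(\<lambda>m. v (s m * t m - 1)) \<longlonglongrightarrow> 0"
      by (rule tendsto_eventually) (use t(2) in eventually_elim, simp add: nf_ring_simps av_zero)
    hence "VF.cls s \<otimes>\<^bsub>Kv\<^esub> VF.cls t = \<one>\<^bsub>Kv\<^esub>"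
      using cls_eq_iff[OF CS_mult[OF s(1) t(1)] CS_const[OF one_K]] by (simp add: cls_mult s t cls_one)
    hence "inv\<^bsub>Kv\<^esub> VF.cls s = VF.cls t" using cls_closed s t by (intro F.comm_inv_char) auto
    thus ?thesis using t(1) te s(2) by (intro bexI[of _ t]) auto
  qed
  show ?thesis
  proof (rule F.subfieldI'[OF F.subringI])
    show "loc_base K v \<subseteq> carrier Kv" by (auto simp: loc_base_def)
    show "\<one>\<^bsub>Kv\<^esub> \<in> loc_base K v" unfolding loc_base_iff cls_one
      by (rule bexI[of _ "\<lambda>_. 1"]) (auto simp: CS_const one_K)
    show "\<ominus>\<^bsub>Kv\<^esub> h \<in> loc_base K v" if h: "h \<in> loc_base K v" for h
    proof -
      obtain s where s: "s \<in> VF.CS" "\<forall>m. s m \<in> \<rat>" "h = VF.cls s" using h unfolding loc_base_iff by blast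
      thus ?thesis unfolding loc_base_iff using minus[OF s(1)] CS_uminus[OF s(1)] by (intro bexI[of _ "\<lambda>m. - s m"]) auto
    qed
    show "h1 \<otimes>\<^bsub>Kv\<^esub> h2 \<in> loc_base K v" "h1 \<oplus>\<^bsub>Kv\<^esub> h2 \<in> loc_base K v"
      if h: "h1 \<in> loc_base K v" "h2 \<in> loc_base K v" for h1 h2
    proof -
      obtain s where s: "s \<in> VF.CS" "\<forall>m. s m \<in> \<rat>" "h1 = VF.cls s" using h unfolding loc_base_iff by blast
      obtain t where t: "t \<in> VF.CS" "\<forall>m. t m \<in> \<rat>" "h2 = VF.cls t" using h unfolding loc_base_iff by blast
      show "h1 \<otimes>\<^bsub>Kv\<^esub> h2 \<in> loc_base K v" unfolding loc_base_iff
        using s t cls_mult[OF s(1) t(1)] CS_mult[OF s(1) t(1)] by (intro bexI[of _ "\<lambda>m. s m * t m"]) auto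
      show "h1 \<oplus>\<^bsub>Kv\<^esub> h2 \<in> loc_base K v" unfolding loc_base_iff
        using s t cls_add[OF s(1) t(1)] CS_add[OF s(1) t(1)] by (intro bexI[of _ "\<lambda>m. s m + t m"]) auto
    qed
    show "inv\<^bsub>Kv\<^esub> k \<in> loc_base K v" if k: "k \<in> loc_base K v - {\<zero>\<^bsub>Kv\<^esub>}" for k
    proof -
      obtain s where s: "s \<in> VF.CS" "\<forall>m. s m \<in> \<rat>" "k = VF.cls s" using DiffD1[OF k] unfolding loc_base_iff by blast
      have "VF.cls s \<noteq> \<zero>\<^bsub>Kv\<^esub>" using k s(3) by simp
      then obtain t where "t \<in> VF.CS" "\<forall>m. t m \<in> \<rat>" "inv\<^bsub>Kv\<^esub> VF.cls s = VF.cls t" using inv[OF s(1,2)] by blast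
      thus ?thesis unfolding loc_base_iff s by blast
    qed
  qed
qed

end

context local_field
begin

text \<open>The class \<open>t\<close> of \<theta> has independent powers below the claimed
  dimension because of \<open>coeff_bound\<close>. They span: density approximates any Cauchy
  sequence by polynomial expressions of bounded length, and \<open>coeff_bound\<close> makes the
  coefficients Cauchy.\<close>

lemma loc_degree_eq:
  assumes v: "place_over v" shows "loc_degree K v = card (Zv v)"
proof -
  interpret v: abs_field K v using v by (simp add: place_over_def)
  interpret F: field v.Kv by (rule v.field_Kv)
  define t where "t = v.VF.cls (\<lambda>_. \<theta>)"
  have tpow: "t [^]\<^bsub>v.Kv\<^esub> j = v.VF.cls (\<lambda>_. \<theta> ^ j)" for j :: nat
    by (induction j) (auto simp: v.cls_one t_def v.cls_mult v.CS_const theta_K power_K mult.commute)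
  \<comment> \<open>The span of the first \<open>j\<close> powers of \<open>t\<close> over
    \<open>loc_base K v\<close>, described by sequences of rational polynomials whose coefficients
    are Cauchy one by one.\<close>
  define Sp where "Sp j = {v.VF.cls s | s. s \<in> v.VF.CS \<and> (\<exists>q :: nat \<Rightarrow> rat poly.
      (\<forall>m. \<forall>i\<ge>j. poly.coeff (q m) i = 0) \<and> (\<forall>i. (\<lambda>m. of_rat (poly.coeff (q m) i)) \<in> v.VF.CS) \<and> s = (\<lambda>m. poly (rp (q m)) \<theta>))}" for j
  have SpI: "v.VF.cls (\<lambda>m. poly (rp (q m)) \<theta>) \<in> Sp j"
    if "(\<lambda>m. poly (rp (q m)) \<theta>) \<in> v.VF.CS" "\<And>m i. i \<ge> j \<Longrightarrow> poly.coeff (q m) i = 0"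
      "\<And>i. (\<lambda>m. of_rat (poly.coeff (q m) i)) \<in> v.VF.CS" for q j
    unfolding Sp_def using that by blast
  have SpE: "\<exists>q. x = v.VF.cls (\<lambda>m. poly (rp (q m)) \<theta>) \<and> (\<lambda>m. poly (rp (q m)) \<theta>) \<in> v.VF.CS \<and>
      (\<forall>m. \<forall>i\<ge>j. poly.coeff (q m) i = 0) \<and> (\<forall>i. (\<lambda>m. of_rat (poly.coeff (q m) i)) \<in> v.VF.CS)"
    if "x \<in> Sp j" for x j
    using that unfolding Sp_def by blast
  have pow_CS: "(\<lambda>_. \<theta> ^ j) \<in> v.VF.CS" for j by (rule v.CS_const[OF power_K[OF theta_K]])
  have line: "F.line_extension (loc_base K v) (t [^]\<^bsub>v.Kv\<^esub> j) (Sp j) = Sp (Suc j)" for j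
  proof (intro equalityI subsetI)
    fix x assume "x \<in> F.line_extension (loc_base K v) (t [^]\<^bsub>v.Kv\<^esub> j) (Sp j)"
    then obtain k y where ky: "k \<in> loc_base K v" "y \<in> Sp j" "x = k \<otimes>\<^bsub>v.Kv\<^esub> t [^]\<^bsub>v.Kv\<^esub> j \<oplus>\<^bsub>v.Kv\<^esub> y"
      unfolding F.line_extension_mem_iff by blast
    obtain s where s: "s \<in> v.VF.CS" "\<forall>m. s m \<in> \<rat>" "k = v.VF.cls s" using ky(1) v.loc_base_iff by blast
    obtain q where q: "y = v.VF.cls (\<lambda>m. poly (rp (q m)) \<theta>)" "(\<lambda>m. poly (rp (q m)) \<theta>) \<in> v.VF.CS"
      "\<And>m i. i \<ge> j \<Longrightarrow> poly.coeff (q m) i = 0" "\<And>i. (\<lambda>m. of_rat (poly.coeff (q m) i)) \<in> v.VF.CS"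
      using SpE[OF ky(2)] by blast
    have "\<exists>b. \<forall>m. s m = of_rat (b m)" using s(2) by (intro choice) (auto elim: Rats_cases)
    then obtain b where b: "\<And>m. s m = of_rat (b m)" by blast
    define r where "r m = Polynomial.monom (b m) j + q m" for m
    have re: "poly (rp (r m)) \<theta> = s m * \<theta> ^ j + poly (rp (q m)) \<theta>" for m
      by (simp add: r_def rp_add poly_monom b)
    have rCS: "(\<lambda>m. poly (rp (r m)) \<theta>) \<in> v.VF.CS" unfolding re by (intro v.CS_add v.CS_mult s pow_CS q)
    have "x = v.VF.cls (\<lambda>m. poly (rp (r m)) \<theta>)"
      unfolding ky(3) s(3) tpow q(1) re using s q(2) pow_CS by (simp add: v.cls_mult v.cls_add v.CS_mult)
    also have "\<dots> \<in> Sp (Suc j)"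
    proof (rule SpI[OF rCS])
      show "poly.coeff (r m) i = 0" if "i \<ge> Suc j" for m i using that q(3) by (simp add: r_def)
      show "(\<lambda>m. of_rat (poly.coeff (r m) i)) \<in> v.VF.CS" for i
      proof (cases "i = j")
        case True
        have "(\<lambda>m. s m + of_rat (poly.coeff (q m) i)) \<in> v.VF.CS" by (intro v.CS_add s q)
        thus ?thesis by (simp add: r_def True b of_rat_add)
      next
        case False thus ?thesis using q(4)[of i] by (simp add: r_def)
      qed
    qed
    finally show "x \<in> Sp (Suc j)" .
  next
    fix x assume "x \<in> Sp (Suc j)"
    then obtain q where q: "x = v.VF.cls (\<lambda>m. poly (rp (q m)) \<theta>)" "(\<lambda>m. poly (rp (q m)) \<theta>) \<in> v.VF.CS"
      "\<And>m i. i \<ge> Suc j \<Longrightarrow> poly.coeff (q m) i = 0" "\<And>i. (\<lambda>m. of_rat (poly.coeff (q m) i)) \<in> v.VF.CS"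
      using SpE by blast
    define s where "s m = complex_of_rat (poly.coeff (q m) j)" for m
    have s: "s \<in> v.VF.CS" using q(4)[of j] by (simp add: s_def[abs_def])
    define r where "r m = q m - Polynomial.monom (poly.coeff (q m) j) j" for m
    have re: "poly (rp (r m)) \<theta> = poly (rp (q m)) \<theta> - s m * \<theta> ^ j" for m
      by (simp add: r_def rp_diff poly_monom s_def)
    have rCS: "(\<lambda>m. poly (rp (r m)) \<theta>) \<in> v.VF.CS" unfolding re by (intro v.CS_diff v.CS_mult s pow_CS q)
    have "v.VF.cls (\<lambda>m. poly (rp (r m)) \<theta>) \<in> Sp j"
    proof (rule SpI[OF rCS])
      show "poly.coeff (r m) i = 0" if "i \<ge> j" for m i using that q(3) by (cases "i = j") (auto simp: r_def)
      show "(\<lambda>m. of_rat (poly.coeff (r m) i)) \<in> v.VF.CS" for i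
        using q(4)[of i] v.CS_const[OF zero_K] by (cases "i = j") (auto simp: r_def)
    qed
    moreover have "v.VF.cls s \<in> loc_base K v" unfolding v.loc_base_iff by (rule bexI[OF _ s]) (simp add: s_def)
    moreover have "x = v.VF.cls s \<otimes>\<^bsub>v.Kv\<^esub> t [^]\<^bsub>v.Kv\<^esub> j \<oplus>\<^bsub>v.Kv\<^esub> v.VF.cls (\<lambda>m. poly (rp (r m)) \<theta>)"
    proof -
      have "v.VF.cls s \<otimes>\<^bsub>v.Kv\<^esub> t [^]\<^bsub>v.Kv\<^esub> j \<oplus>\<^bsub>v.Kv\<^esub> v.VF.cls (\<lambda>m. poly (rp (r m)) \<theta>)
        = v.VF.cls (\<lambda>m. s m * \<theta> ^ j + poly (rp (r m)) \<theta>)"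
        unfolding tpow using s rCS pow_CS by (simp add: v.cls_mult v.cls_add v.CS_mult)
      also have "\<dots> = x" unfolding re q(1) by simp
      finally show ?thesis by simp
    qed
    ultimately show "x \<in> F.line_extension (loc_base K v) (t [^]\<^bsub>v.Kv\<^esub> j) (Sp j)"
      unfolding F.line_extension_mem_iff by blast
  qed
  obtain C where C: "C \<ge> 0" "\<And>q k. (\<forall>i\<ge>card (Zv v). poly.coeff q i = 0) \<Longrightarrow> v (of_rat (poly.coeff q k)) \<le> C * v (poly (rp q) \<theta>)"
    using coeff_bound[OF v] by blast
  have notin: "t [^]\<^bsub>v.Kv\<^esub> j \<notin> Sp j" if j: "j < card (Zv v)" for j
  proof
    assume "t [^]\<^bsub>v.Kv\<^esub> j \<in> Sp j"
    then obtain q where q: "v.VF.cls (\<lambda>_. \<theta> ^ j) = v.VF.cls (\<lambda>m. poly (rp (q m)) \<theta>)" "(\<lambda>m. poly (rp (q m)) \<theta>) \<in> v.VF.CS"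
      "\<And>m i. i \<ge> j \<Longrightarrow> poly.coeff (q m) i = 0" unfolding tpow using SpE by blast
    have lim: "(\<lambda>m. v (\<theta> ^ j - poly (rp (q m)) \<theta>)) \<longlonglongrightarrow> 0" using q(1) v.cls_eq_iff[OF pow_CS q(2)] by simp
    have "1 \<le> C * v (\<theta> ^ j - poly (rp (q m)) \<theta>)" for m
    proof -
      define r where "r = Polynomial.monom 1 j - q m"
      have "poly.coeff r i = 0" if "i \<ge> card (Zv v)" for i using that j q(3) by (simp add: r_def)
      hence "v (of_rat (poly.coeff r j)) \<le> C * v (poly (rp r) \<theta>)" using C(2) by blast
      moreover have "poly.coeff r j = 1" using q(3) by (simp add: r_def)
      moreover have "poly (rp r) \<theta> = \<theta> ^ j - poly (rp (q m)) \<theta>" by (simp add: r_def rp_diff poly_monom)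
      ultimately show ?thesis by (simp add: v.av_one)
    qed
    hence "1 \<le> C * 0" by (intro LIMSEQ_le_const[OF tendsto_mult[OF tendsto_const lim]]) auto
    thus False by simp
  qed
  have tc: "t [^]\<^bsub>v.Kv\<^esub> j \<in> carrier v.Kv" for j :: nat unfolding tpow by (rule v.cls_closed[OF pow_CS])
  have dim: "F.dimension j (loc_base K v) (Sp j)" if "j \<le> card (Zv v)" for j
    using that
  proof (induction j)
    case 0
    have "x = \<zero>\<^bsub>v.Kv\<^esub>" if x0: "x \<in> Sp 0" for x
    proof -
      obtain q where "x = v.VF.cls (\<lambda>m. poly (rp (q m)) \<theta>)" "\<And>m i. poly.coeff (q m) i = 0" using SpE[OF x0] by blast
      moreover hence "q m = 0" for m by (simp add: poly_eq_iff)
      ultimately show ?thesis by (simp add: v.cls_zero)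
    qed
    moreover have "\<zero>\<^bsub>v.Kv\<^esub> \<in> Sp 0"
      using SpI[of "\<lambda>_. 0" 0] v.CS_const[OF zero_K] by (simp add: v.cls_zero)
    ultimately have "Sp 0 = {\<zero>\<^bsub>v.Kv\<^esub>}" by blast
    thus ?case using F.zero_dim by simp
  next
    case (Suc j)
    have "F.dimension (Suc j) (loc_base K v) (F.line_extension (loc_base K v) (t [^]\<^bsub>v.Kv\<^esub> j) (Sp j))"
      by (rule F.Suc_dim[OF tc notin]) (use Suc in auto)
    thus ?case unfolding line .
  qed
  have "carrier v.Kv \<subseteq> Sp (card (Zv v))"
  proof
    fix x assume "x \<in> carrier v.Kv"
    then obtain s where s: "s \<in> v.VF.CS" "x = v.VF.cls s" using v.VF.completion_cases[of x] unfolding v.Kv_eq by metis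
    have "\<exists>q. (\<forall>i\<ge>card (Zv v). poly.coeff q i = 0) \<and> v (s m - poly (rp q) \<theta>) < 1 / real (Suc m)" for m
      by (rule rat_polys_dense[OF v v.CS_K[OF s(1)]]) simp
    then obtain q where q: "\<And>m i. i \<ge> card (Zv v) \<Longrightarrow> poly.coeff (q m) i = 0"
        "\<And>m. v (s m - poly (rp (q m)) \<theta>) < 1 / real (Suc m)" by metis
    have lim: "(\<lambda>m. v (s m - poly (rp (q m)) \<theta>)) \<longlonglongrightarrow> 0"
      by (rule null_comparison[OF LIMSEQ_Suc[OF lim_1_over_n]])
         (use q(2) v.av_nonneg[OF diff_K[OF v.CS_K[OF s(1)] rat_poly_K]] in \<open>simp add: less_imp_le\<close>)
    have null: "(\<lambda>m. s m - poly (rp (q m)) \<theta>) \<in> v.VF.NS"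
      using lim v.CS_K[OF s(1)] by (intro v.VF.NS_I) (auto simp: nf_ring_simps diff_K rat_poly_K)
    have "(\<lambda>m. s m - (s m - poly (rp (q m)) \<theta>)) \<in> v.VF.CS"
      by (rule v.CS_diff[OF s(1) subsetD[OF v.VF.NS_subset null]])
    hence qCS: "(\<lambda>m. poly (rp (q m)) \<theta>) \<in> v.VF.CS" by simp
    have "x = v.VF.cls (\<lambda>m. poly (rp (q m)) \<theta>)" using lim v.cls_eq_iff[OF s(1) qCS] s(2) by simp
    also have "\<dots> \<in> Sp (card (Zv v))"
    proof (rule SpI[OF qCS q(1)])
      fix k
      \<comment> \<open>The bound is applied to the differences q i - q j. Dividing by C + 1 instead
        of \<open>C\<close> allows \<open>C = 0\<close>.\<close>
      show "(\<lambda>m. of_rat (poly.coeff (q m) k)) \<in> v.VF.CS" unfolding v.CS_iff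
      proof (intro conjI allI impI)
        fix e :: real assume e: "e > 0"
        have "e / (C + 1) > 0" using e C(1) by simp
        then obtain N where N: "\<And>i j. i \<ge> N \<Longrightarrow> j \<ge> N \<Longrightarrow> v (poly (rp (q i)) \<theta> - poly (rp (q j)) \<theta>) < e / (C + 1)"
          using qCS unfolding v.CS_iff by meson
        have "v (of_rat (poly.coeff (q i) k) - of_rat (poly.coeff (q j) k)) < e" if "i \<ge> N" "j \<ge> N" for i j
        proof -
          have "v (of_rat (poly.coeff (q i - q j) k)) \<le> C * v (poly (rp (q i - q j)) \<theta>)" by (rule C(2)) (simp add: q(1))
          also have "\<dots> \<le> C * (e / (C + 1))" using N[OF that] C(1) by (intro mult_left_mono) (auto simp: rp_diff)
          also have "\<dots> < e" using e C(1) by (simp add: field_simps)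
          finally show ?thesis by (simp add: of_rat_diff)
        qed
        thus "\<exists>N. \<forall>i\<ge>N. \<forall>j\<ge>N. v (of_rat (poly.coeff (q i) k) - of_rat (poly.coeff (q j) k)) < e" by blast
      qed (rule of_rat_K)
    qed auto
    finally show "x \<in> Sp (card (Zv v))" .
  qed
  moreover have "Sp (card (Zv v)) \<subseteq> carrier v.Kv" unfolding Sp_def using v.cls_closed by auto
  ultimately have "Sp (card (Zv v)) = carrier v.Kv" by blast
  hence "F.dimension (card (Zv v)) (loc_base K v) (carrier v.Kv)" using dim[of "card (Zv v)"] by simp
  thus ?thesis unfolding loc_degree_def using F.dimI[OF v.subfield_loc_base] by (simp add: over_def)
qed

end

subsection \<open>The product formula\<close>

context
  fixes p :: nat assumes p: "Factorial_Ring.prime p"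
begin

lemma prime_int_p: "Factorial_Ring.prime (int p)" using p by simp

lemma p_gt_1: "real p > 1" using prime_gt_1_nat[OF p] by simp

lemma multiplicity_mult: "a \<noteq> 0 \<Longrightarrow> b \<noteq> 0 \<Longrightarrow> multiplicity (int p) (a * b) = multiplicity (int p) a + multiplicity (int p) b"
  using prime_elem_multiplicity_mult_distrib[OF prime_imp_prime_elem[OF prime_int_p]] .

text \<open>\<open>padic_abs\<close> is defined through lowest terms. Cross multiplication shows
  that any fraction computes it, so sums and products can use common denominators.\<close>

lemma padic_abs_divide:
  assumes "a \<noteq> 0" "b \<noteq> 0"
  shows "padic_abs p (of_int a / of_int b) = real p powi (int (multiplicity (int p) b) - int (multiplicity (int p) a))"
proof -
  obtain c d where cd: "quotient_of (of_int a / of_int b) = (c, d)" by (metis surj_pair)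
  have d: "d > 0" using quotient_of_denom_pos[OF cd] .
  have "of_int a / of_int b = (of_int c / of_int d :: rat)" using quotient_of_div[OF cd] .
  hence "of_int a * of_int d = (of_int c * of_int b :: rat)" using assms d by (simp add: field_simps)
  hence e: "a * d = c * b" by (simp flip: of_int_mult)
  hence c: "c \<noteq> 0" using assms d by auto
  have "multiplicity (int p) a + multiplicity (int p) d = multiplicity (int p) c + multiplicity (int p) b"
    using multiplicity_mult[of a d] multiplicity_mult[of c b] assms c d e by simp
  hence "int (multiplicity (int p) d) - int (multiplicity (int p) c) = int (multiplicity (int p) b) - int (multiplicity (int p) a)"
    by linarith
  moreover have "of_int a / of_int b \<noteq> (0::rat)" using assms by simp
  ultimately show ?thesis unfolding padic_abs_def cd by (simp only: if_False fst_conv snd_conv)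
qed

lemma padic_abs_of_int: "a \<noteq> 0 \<Longrightarrow> padic_abs p (of_int a) = real p powi (- int (multiplicity (int p) a))"
  using padic_abs_divide[of a 1] by simp

lemma padic_abs_0: "padic_abs p 0 = 0" by (simp add: padic_abs_def)

lemma padic_abs_pos: "q \<noteq> 0 \<Longrightarrow> 0 < padic_abs p q"
  using p_gt_1 by (simp add: padic_abs_def)

lemma padic_abs_nonneg: "0 \<le> padic_abs p q"
  using padic_abs_pos[of q] by (cases "q = 0") (auto simp: padic_abs_0)

lemma rat_frac: "q \<noteq> 0 \<Longrightarrow> \<exists>a b. q = of_int a / of_int b \<and> b \<noteq> 0 \<and> a \<noteq> 0" for q :: rat
  using quotient_of_div[of q "fst (quotient_of q)" "snd (quotient_of q)"] quotient_of_denom_pos'[of q]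
  by (intro exI[of _ "fst (quotient_of q)"] exI[of _ "snd (quotient_of q)"]) auto

lemma padic_abs_mult: "padic_abs p (q * r) = padic_abs p q * padic_abs p r"
proof (cases "q = 0 \<or> r = 0")
  case False
  obtain a b where q: "q = of_int a / of_int b" "b \<noteq> 0" "a \<noteq> 0" using rat_frac[of q] False by blast
  obtain c d where r: "r = of_int c / of_int d" "d \<noteq> 0" "c \<noteq> 0" using rat_frac[of r] False by blast
  have "padic_abs p (of_int (a * c) / of_int (b * d)) = real p powi (int (multiplicity (int p) (b * d)) - int (multiplicity (int p) (a * c)))"
    by (rule padic_abs_divide) (use q r in auto)
  also have "\<dots> = padic_abs p q * padic_abs p r"
    unfolding q(1) r(1) padic_abs_divide[OF q(3,2)] padic_abs_divide[OF r(3,2)]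
    using q r p_gt_1 by (simp add: multiplicity_mult power_int_add[symmetric] algebra_simps)
  finally show ?thesis by (simp add: q(1) r(1))
qed (auto simp: padic_abs_0)

lemma padic_abs_int_le_1: "padic_abs p (of_int a) \<le> 1"
proof (cases "a = 0")
  case False
  show ?thesis unfolding padic_abs_of_int[OF False] using p_gt_1
    by (simp add: power_int_minus inverse_le_1_iff one_le_power)
qed (simp add: padic_abs_0)

lemma padic_abs_add_int:
  assumes "a \<noteq> 0" "b \<noteq> 0" "a + b \<noteq> 0"
  shows "padic_abs p (of_int (a + b)) \<le> max (padic_abs p (of_int a)) (padic_abs p (of_int b))"
proof -
  define m where "m = min (multiplicity (int p) a) (multiplicity (int p) b)"
  have "int p ^ m dvd a" "int p ^ m dvd b" by (auto simp: m_def intro: multiplicity_dvd')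
  hence "int p ^ m dvd a + b" by simp
  hence le: "m \<le> multiplicity (int p) (a + b)"
    using assms(3) prime_int_p by (intro multiplicity_geI) auto
  have "padic_abs p (of_int (a + b)) \<le> real p powi (- int m)"
    unfolding padic_abs_of_int[OF assms(3)] using le p_gt_1 by (intro power_int_increasing) auto
  also have "\<dots> \<le> max (padic_abs p (of_int a)) (padic_abs p (of_int b))"
    unfolding padic_abs_of_int[OF assms(1)] padic_abs_of_int[OF assms(2)] m_def by (cases "multiplicity (int p) a \<le> multiplicity (int p) b") auto
  finally show ?thesis .
qed

lemma padic_abs_add: "padic_abs p (q + r) \<le> padic_abs p q + padic_abs p r"
proof (cases "q = 0 \<or> r = 0 \<or> q + r = 0")
  case True
  thus ?thesis using padic_abs_nonneg[of q] padic_abs_nonneg[of r] by (auto simp: padic_abs_0)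
next
  case False
  obtain a b where q: "q = of_int a / of_int b" "b \<noteq> 0" "a \<noteq> 0" using rat_frac[of q] False by blast
  obtain c d where r: "r = of_int c / of_int d" "d \<noteq> 0" "c \<noteq> 0" using rat_frac[of r] False by blast
  have e: "q = of_int (a * d) * (1 / of_int (b * d))" "r = of_int (c * b) * (1 / of_int (b * d))"
    "q + r = of_int (a * d + c * b) * (1 / of_int (b * d))" using q r by (auto simp: field_simps)
  have nz: "a * d + c * b \<noteq> 0"
  proof
    assume h: "a * d + c * b = 0"
    have "q + r = 0" unfolding e(3) h by simp
    with False show "False" by simp
  qed
  have pos: "0 < padic_abs p (1 / of_int (b * d))" by (rule padic_abs_pos) (use q r in auto)
  have "padic_abs p (of_int (a * d + c * b)) \<le> max (padic_abs p (of_int (a * d))) (padic_abs p (of_int (c * b)))"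
    by (rule padic_abs_add_int) (use q r nz in auto)
  also have "\<dots> \<le> padic_abs p (of_int (a * d)) + padic_abs p (of_int (c * b))"
    using padic_abs_pos[of "of_int (a * d)"] padic_abs_pos[of "of_int (c * b)"] q r by auto
  finally show ?thesis unfolding e padic_abs_mult distrib_right[symmetric] using pos by (intro mult_right_mono) auto
qed

lemma padic_abs_neq_1: "q \<noteq> 0 \<Longrightarrow> padic_abs p q \<noteq> 1 \<Longrightarrow>
  int p dvd fst (quotient_of q) \<or> int p dvd snd (quotient_of q)"
proof (rule ccontr)
  assume q: "q \<noteq> 0" "padic_abs p q \<noteq> 1" "\<not> (int p dvd fst (quotient_of q) \<or> int p dvd snd (quotient_of q))"
  hence "multiplicity (int p) (fst (quotient_of q)) = 0" "multiplicity (int p) (snd (quotient_of q)) = 0"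
    using not_dvd_imp_multiplicity_0 by blast+
  thus False using q by (simp add: padic_abs_def)
qed

lemma ln_padic_abs:
  assumes "a \<noteq> 0" "b \<noteq> 0"
  shows "ln (padic_abs p (of_int a / of_int b)) = (real (multiplicity (int p) b) - real (multiplicity (int p) a)) * ln (real p)"
  unfolding padic_abs_divide[OF assms] using p_gt_1 by (simp add: powr_real_of_int'[symmetric] ln_powr)

end

lemma finite_padic_abs_neq_1: assumes "q \<noteq> 0" shows "finite {p. Factorial_Ring.prime p \<and> padic_abs p q \<noteq> 1}"
proof -
  obtain a b where ab: "quotient_of q = (a, b)" by (metis surj_pair)
  have nz: "a \<noteq> 0" "b \<noteq> 0" using quotient_of_div[OF ab] quotient_of_denom_pos[OF ab] assms by auto
  have "{p. Factorial_Ring.prime p \<and> padic_abs p q \<noteq> 1} \<subseteq> {p. p \<le> nat (\<bar>a\<bar> + \<bar>b\<bar>)}"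
  proof safe
    fix p assume p: "Factorial_Ring.prime p" "padic_abs p q \<noteq> 1"
    from padic_abs_neq_1[OF p(1) assms p(2)] ab have "int p dvd a \<or> int p dvd b" by simp
    hence "int p \<le> \<bar>a\<bar> \<or> int p \<le> \<bar>b\<bar>"
      using dvd_imp_le_int[OF nz(1), of "int p"] dvd_imp_le_int[OF nz(2), of "int p"] by auto
    thus "p \<le> nat (\<bar>a\<bar> + \<bar>b\<bar>)" by linarith
  qed
  thus ?thesis using finite_subset by blast
qed

lemma finite_padic_abs_gt_1: "finite {p. Factorial_Ring.prime p \<and> padic_abs p q > 1}"
proof (cases "q = 0")
  case False
  show ?thesis by (rule finite_subset[OF _ finite_padic_abs_neq_1[OF False]]) auto
next
  case True
  hence "padic_abs p q = 0" for p by (simp add: padic_abs_def)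
  thus ?thesis by simp
qed

lemma ln_abs_int_prime_factors:
  assumes P: "finite P" "\<And>p. p \<in> P \<Longrightarrow> Factorial_Ring.prime p" "\<And>p. Factorial_Ring.prime p \<Longrightarrow> int p dvd a \<Longrightarrow> p \<in> P" and a: "a \<noteq> 0"
  shows "ln \<bar>real_of_int a\<bar> = (\<Sum>p\<in>P. real (multiplicity (int p) a) * ln (real p))"
proof -
  have sub: "prime_factors a \<subseteq> int ` P"
  proof
    fix \<pi> assume *: "\<pi> \<in> prime_factors a"
    hence pr: "Factorial_Ring.prime \<pi>" "\<pi> dvd a" by auto
    hence "\<pi> = int (nat \<pi>)" using prime_ge_0_int by simp
    moreover from this pr have "nat \<pi> \<in> P" using P(3)[of "nat \<pi>"] by (metis prime_int_nat_transfer prime_nat_int_transfer)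
    ultimately show "\<pi> \<in> int ` P" by blast
  qed
  have "\<bar>a\<bar> = (\<Prod>\<pi>\<in>prime_factors a. \<pi> ^ multiplicity \<pi> a)" using prod_prime_factors[OF a] by simp
  also have "\<dots> = (\<Prod>\<pi>\<in>int ` P. \<pi> ^ multiplicity \<pi> a)"
  proof (rule prod.mono_neutral_left[OF _ sub])
    show "\<forall>i\<in>int ` P - prime_factors a. i ^ multiplicity i a = 1"
    proof
      fix i assume i: "i \<in> int ` P - prime_factors a"
      hence "Factorial_Ring.prime i" using P(2) by auto
      hence "\<not> i dvd a" using i a by (auto simp: prime_factors_dvd)
      thus "i ^ multiplicity i a = 1" by (simp add: not_dvd_imp_multiplicity_0)
    qed
  qed (use P in simp)
  also have "\<dots> = (\<Prod>p\<in>P. int p ^ multiplicity (int p) a)" by (subst prod.reindex) auto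
  finally have "real_of_int \<bar>a\<bar> = (\<Prod>p\<in>P. real p ^ multiplicity (int p) a)" by simp
  hence "ln (real_of_int \<bar>a\<bar>) = ln (\<Prod>p\<in>P. real p ^ multiplicity (int p) a)" by (rule arg_cong)
  also have "\<dots> = (\<Sum>p\<in>P. ln (real p ^ multiplicity (int p) a))"
    using P prime_gt_0_nat by (intro ln_prod) (auto dest!: P(2) prime_gt_0_nat)
  also have "\<dots> = (\<Sum>p\<in>P. real (multiplicity (int p) a) * ln (real p))"
    using P(2) prime_gt_0_nat by (intro sum.cong refl) (auto simp: ln_realpow)
  finally show ?thesis by simp
qed

lemma rational_product_formula:
  assumes q: "q \<noteq> 0" and P: "finite P" "\<And>p. p \<in> P \<Longrightarrow> Factorial_Ring.prime p"
    "\<And>p. Factorial_Ring.prime p \<Longrightarrow> padic_abs p q \<noteq> 1 \<Longrightarrow> p \<in> P"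
  shows "ln \<bar>real_of_rat q\<bar> + (\<Sum>p\<in>P. ln (padic_abs p q)) = 0"
proof -
  obtain a b where ab: "quotient_of q = (a, b)" by (metis surj_pair)
  have e: "q = of_int a / of_int b" and nz: "a \<noteq> 0" "b \<noteq> 0"
    using quotient_of_div[OF ab] quotient_of_denom_pos[OF ab] q by auto
  \<comment> \<open>The enlargement adds only vanishing terms and contains all prime divisors of
    \<open>a\<close> and of \<open>b\<close>, so numerator and denominator can be factored
    separately.\<close>
  define P' where "P' = P \<union> {p. Factorial_Ring.prime p \<and> (int p dvd a \<or> int p dvd b)}"
  have finP': "finite P'"
  proof -
    have "{p. Factorial_Ring.prime p \<and> (int p dvd a \<or> int p dvd b)} \<subseteq> {p. p \<le> nat (\<bar>a\<bar> + \<bar>b\<bar>)}"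
    proof safe
      fix p assume "int p dvd a"
      hence "int p \<le> \<bar>a\<bar>" using dvd_imp_le_int[OF nz(1), of "int p"] by simp
      thus "p \<le> nat (\<bar>a\<bar> + \<bar>b\<bar>)" by linarith
    next
      fix p assume "int p dvd b"
      hence "int p \<le> \<bar>b\<bar>" using dvd_imp_le_int[OF nz(2), of "int p"] by simp
      thus "p \<le> nat (\<bar>a\<bar> + \<bar>b\<bar>)" by linarith
    qed
    thus ?thesis unfolding P'_def using P(1) finite_subset by blast
  qed
  have pr: "Factorial_Ring.prime p" if "p \<in> P'" for p using that P(2) by (auto simp: P'_def)
  have "(\<Sum>p\<in>P. ln (padic_abs p q)) = (\<Sum>p\<in>P'. ln (padic_abs p q))"
  proof (rule sum.mono_neutral_left[OF finP'])
    show "P \<subseteq> P'" by (simp add: P'_def)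
    show "\<forall>p\<in>P' - P. ln (padic_abs p q) = 0"
    proof
      fix p assume "p \<in> P' - P"
      hence "p \<in> P'" "p \<notin> P" by auto
      hence "padic_abs p q = 1" using P(3)[OF pr[of p]] by metis
      thus "ln (padic_abs p q) = 0" by simp
    qed
  qed
  also have "\<dots> = (\<Sum>p\<in>P'. (real (multiplicity (int p) b) - real (multiplicity (int p) a)) * ln (real p))"
    unfolding e by (intro sum.cong refl ln_padic_abs[OF pr nz])
  also have "\<dots> = ln \<bar>real_of_int b\<bar> - ln \<bar>real_of_int a\<bar>"
    using ln_abs_int_prime_factors[OF finP' pr _ nz(1)] ln_abs_int_prime_factors[OF finP' pr _ nz(2)]
    by (simp add: P'_def left_diff_distrib sum_subtractf)
  also have "\<dots> = - ln \<bar>real_of_rat q\<bar>" using nz by (simp add: e of_rat_divide ln_div)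
  finally show ?thesis by simp
qed

section \<open>Absolute values of the algebraic numbers and places above them\<close>

definition algebraic_numbers :: "complex set" where
  "algebraic_numbers = {x \<in> carrier complex_ring. ring.algebraic complex_ring \<rat> x}"

lemma subfield_algebraic_numbers: "subfield algebraic_numbers complex_ring"
  using field.subfield_of_algebraics[OF field_from_type_algebra subfield_Rats] by (simp add: algebraic_numbers_def over_def)

lemma root_algebraic_number:
  assumes "g \<noteq> 0" "poly (rp g) z = 0" shows "z \<in> algebraic_numbers"
proof -
  interpret C: field complex_ring by (rule field_from_type_algebra)
  have ev: "C.eval (map of_rat (rev xs)) z = poly (rp (Poly xs)) z" for xs :: "rat list"
  proof (induction xs rule: rev_induct)
    case (snoc a xs)
    have pw: "z [^]\<^bsub>complex_ring\<^esub> k = z ^ k" for k :: nat by (induction k) (auto simp: cr_simps mult.commute)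
    show ?case using snoc by (simp add: Poly_snoc rp_add poly_monom cr_simps pw)
  qed (simp add: cr_simps)
  define ps where "ps = map (of_rat :: rat \<Rightarrow> complex) (rev (coeffs g))"
  have "C.eval ps z = 0" unfolding ps_def ev by (simp add: assms)
  moreover have "ps \<noteq> []" using assms by (simp add: ps_def)
  moreover have "hd ps \<noteq> 0" using assms by (simp add: ps_def hd_map hd_rev last_coeffs_eq_coeff_degree)
  hence "ps \<in> carrier (\<rat>[X]\<^bsub>complex_ring\<^esub>)" by (auto simp: univ_poly_def polynomial_def ps_def cr_simps)
  ultimately have "(C.algebraic over \<rat>) z" by (intro C.algebraicI) (auto simp: cr_simps)
  thus ?thesis by (simp add: algebraic_numbers_def over_def cr_simps)
qed

text \<open>The p-adic absolute value is carried to the rational complex numbers by the inverse of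
  \<open>of_rat\<close>. Algebraic numbers are algebraic over these, so
  \<open>absolute_value_extension\<close> applies; algebraicity only has to be transferred from the
  complex numbers to the smaller ring.\<close>

lemma padic_extension:
  assumes p: "Factorial_Ring.prime p"
  obtains w where "abs_field algebraic_numbers w" "\<And>q. w (of_rat q) = padic_abs p q"
proof -
  interpret C: field complex_ring by (rule field_from_type_algebra)
  interpret A: complex_subfield algebraic_numbers by (intro complex_subfield.intro subfield_algebraic_numbers)
  interpret L: field "nf_ring algebraic_numbers" by (rule A.field_nf_ring)
  define f where "f x = padic_abs p (the_inv complex_of_rat x)" for x
  have f: "f (of_rat q) = padic_abs p q" for q unfolding f_def by (subst the_inv_f_f) (auto intro: injI)
  have f0: "f 0 = 0" using f[of 0] padic_abs_0[OF p] by simp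
  have ext: "value_extension (nf_ring algebraic_numbers) \<rat> f"
  proof (intro value_extension.intro value_extension_axioms.intro)
    show "field (nf_ring algebraic_numbers)" by (rule A.field_nf_ring)
    have QA: "\<rat> \<subseteq> algebraic_numbers" using A.of_rat_K by (auto elim: Rats_cases)
    show "subfield \<rat> (nf_ring algebraic_numbers)"
    proof (rule L.subfield_iff(1))
      show "field (nf_ring algebraic_numbers\<lparr>carrier := \<rat>\<rparr>)"
        using C.subfield_iff(2)[OF subfield_Rats] by (simp add: nf_ring_def)
      show "\<rat> \<subseteq> carrier (nf_ring algebraic_numbers)" using QA by (simp add: A.nf_ring_simps)
    qed
    show "absolute_value (nf_ring algebraic_numbers\<lparr>carrier := \<rat>\<rparr>) f"
      unfolding absolute_value_def
    proof (intro conjI ballI)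
      fix x assume "x \<in> carrier (nf_ring algebraic_numbers\<lparr>carrier := \<rat>\<rparr>)"
      then obtain q where q: "x = of_rat q" by (auto elim: Rats_cases)
      show "0 \<le> f x" using padic_abs_pos[OF p, of q] by (cases "q = 0") (auto simp: q f f0)
      show "(f x = 0) = (x = \<zero>\<^bsub>nf_ring algebraic_numbers\<lparr>carrier := \<rat>\<rparr>\<^esub>)"
        using padic_abs_pos[OF p, of q] padic_abs_0[OF p] by (cases "q = 0") (auto simp: q f f0 A.nf_ring_simps)
      fix y assume "y \<in> carrier (nf_ring algebraic_numbers\<lparr>carrier := \<rat>\<rparr>)"
      then obtain r where r: "y = of_rat r" by (auto elim: Rats_cases)
      show "f (x \<otimes>\<^bsub>nf_ring algebraic_numbers\<lparr>carrier := \<rat>\<rparr>\<^esub> y) = f x * f y"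
        by (simp add: q r f A.nf_ring_simps padic_abs_mult[OF p] flip: of_rat_mult)
      show "f (x \<oplus>\<^bsub>nf_ring algebraic_numbers\<lparr>carrier := \<rat>\<rparr>\<^esub> y) \<le> f x + f y"
        using padic_abs_add[OF p, of q r] by (simp add: q r f A.nf_ring_simps flip: of_rat_add)
    qed
    show "(L.algebraic over \<rat>) x" if "x \<in> carrier (nf_ring algebraic_numbers)" for x
    proof -
      have "x \<in> algebraic_numbers" using that by (simp only: A.nf_ring_simps)
      hence "(C.algebraic over \<rat>) x" by (simp add: algebraic_numbers_def over_def)
      thus ?thesis using C.algebraic_consistent[OF subfieldE(1)[OF subfield_algebraic_numbers]] by (simp add: nf_ring_def)
    qed
  qed
  obtain w where w: "absolute_value (nf_ring algebraic_numbers) w" "\<forall>c\<in>\<rat>. w c = f c"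
    using value_extension.absolute_value_extension[OF ext] by blast
  show ?thesis
  proof (rule that)
    show "abs_field algebraic_numbers w" using w(1) by (intro abs_field.intro abs_field_axioms.intro A.complex_subfield_axioms)
    show "w (of_rat q) = padic_abs p q" for q using w(2) f by simp
  qed
qed

definition places_over :: "complex set \<Rightarrow> (rat \<Rightarrow> real) \<Rightarrow> (complex \<Rightarrow> real) set" where
  "places_over K f = {v \<in> extensional K. absolute_value (nf_ring K) v \<and> (\<forall>q. v (of_rat q) = f q)}"

lemma (in complex_subfield) absolute_value_restrict:
  "absolute_value (nf_ring K) (restrict v K) \<longleftrightarrow> absolute_value (nf_ring K) v"
  unfolding absolute_value_def nf_ring_simps by (simp add: add_K mult_K)

lemma infinite_places_eq: "infinite_places K = places_over K (\<lambda>q. \<bar>real_of_rat q\<bar>)"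
  by (simp add: infinite_places_def places_over_def)

lemma finite_places_eq: "finite_places K = (\<Union>p\<in>{p. Factorial_Ring.prime p}. places_over K (padic_abs p))"
  by (auto simp: finite_places_def places_over_def)

context local_field
begin

lemma places_over_eq: "places_over K (\<lambda>q. w (of_rat q)) = (\<lambda>z. restrict (conj_abs z) K) ` Z"
proof (intro equalityI subsetI)
  fix v assume v: "v \<in> places_over K (\<lambda>q. w (of_rat q))"
  hence "place_over v" using complex_subfield_axioms
    by (auto simp: places_over_def place_over_def abs_field_def abs_field_axioms_def)
  then obtain z where z: "z \<in> Z" "\<And>y. y \<in> K \<Longrightarrow> v y = conj_abs z y" using place_over_cases by metis
  have "v = restrict (conj_abs z) K"
    using v z(2) by (intro extensionalityI[of _ K]) (auto simp: places_over_def)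
  thus "v \<in> (\<lambda>z. restrict (conj_abs z) K) ` Z" using z(1) by blast
next
  fix v assume "v \<in> (\<lambda>z. restrict (conj_abs z) K) ` Z"
  then obtain z where z: "z \<in> Z" "v = restrict (conj_abs z) K" by blast
  thus "v \<in> places_over K (\<lambda>q. w (of_rat q))"
    using place_over_conj_abs[OF z(1)] by (simp add: places_over_def place_over_def abs_field_def abs_field_axioms_def absolute_value_restrict of_rat_K)
qed

text \<open>The conjugates are grouped by the place that they induce. The group of \<open>v\<close>
  is \<open>Zv v\<close>, which contributes the same logarithm as many times as the local
  degree.\<close>

lemma places_over_sum:
  assumes x: "x \<in> K"
  shows "(\<Sum>v\<in>places_over K (\<lambda>q. w (of_rat q)). real (loc_degree K v) * ln (v x)) = (\<Sum>z\<in>Z. ln (conj_abs z x))"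
proof -
  define g' where "g' z = restrict (conj_abs z) K" for z
  have T: "places_over K (\<lambda>q. w (of_rat q)) = g' ` Z" by (simp add: places_over_eq g'_def)
  have "(\<Sum>z\<in>Z. ln (conj_abs z x)) = (\<Sum>v\<in>g' ` Z. \<Sum>z\<in>{z \<in> Z. g' z = v}. ln (conj_abs z x))"
    using finite_Z by (intro sum.group[symmetric]) auto
  also have "\<dots> = (\<Sum>v\<in>g' ` Z. real (loc_degree K v) * ln (v x))"
  proof (rule sum.cong[OF refl])
    fix v assume v: "v \<in> g' ` Z"
    hence "v \<in> places_over K (\<lambda>q. w (of_rat q))" unfolding T .
    hence pv: "place_over v" "v \<in> extensional K" using complex_subfield_axioms
      by (auto simp: places_over_def place_over_def abs_field_def abs_field_axioms_def)
    have "{z \<in> Z. g' z = v} = Zv v"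
    proof (intro equalityI subsetI)
      fix z assume "z \<in> Zv v"
      hence "z \<in> Z" "\<forall>y\<in>K. v y = conj_abs z y" by (auto simp: Zv_def)
      moreover from this have "g' z = v" using pv(2) by (intro extensionalityI[of _ K]) (auto simp: g'_def)
      ultimately show "z \<in> {z \<in> Z. g' z = v}" by blast
    qed (auto simp: Zv_def g'_def)
    moreover have "(\<Sum>z\<in>Zv v. ln (conj_abs z x)) = (\<Sum>z\<in>Zv v. ln (v x))"
      using x by (intro sum.cong refl) (auto simp: Zv_def)
    ultimately show "(\<Sum>z\<in>{z \<in> Z. g' z = v}. ln (conj_abs z x)) = real (loc_degree K v) * ln (v x)"
      by (simp add: loc_degree_eq[OF pv(1)])
  qed
  finally show ?thesis by (simp add: T)
qed

lemma places_over_degree_pos: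
  assumes "v \<in> places_over K (\<lambda>q. w (of_rat q))" shows "loc_degree K v > 0"
proof -
  have pv: "place_over v" using assms complex_subfield_axioms
    by (auto simp: places_over_def place_over_def abs_field_def abs_field_axioms_def)
  show ?thesis using loc_degree_eq[OF pv] a_pos[OF pv] by simp
qed

lemma finite_places_over: "finite (places_over K (\<lambda>q. w (of_rat q)))"
  unfolding places_over_eq using finite_Z by simp

end

lemma complex_subfield_UNIV: "complex_subfield UNIV"
proof -
  have "subfield UNIV complex_ring"
    using field.carrier_is_subfield[OF field_from_type_algebra[where ?'a = complex]] by (simp only: cr_simps)
  thus ?thesis by (simp add: complex_subfield_def)
qed

lemma (in complex_subfield) places_overD: "v \<in> places_over K f \<Longrightarrow> abs_field K v"
  using complex_subfield_axioms by (simp add: places_over_def abs_field_def abs_field_axioms_def)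

text \<open>By the binomial theorem |x + y|^k is at most a sum of k + 1 terms, each at most the k-th
  power of the maximum. The factor k + 1 is removed by \<open>le_of_power_le_poly\<close> with
  \<open>n = 1\<close>.\<close>

lemma (in abs_field) ultrametric:
  assumes nat: "\<And>k::nat. v (of_nat k) \<le> 1" and xy: "x \<in> K" "y \<in> K"
  shows "v (x + y) \<le> max (v x) (v y)"
proof (rule le_of_power_le_poly[where n = 1])
  define M where "M = max (v x) (v y)"
  have M: "v x \<le> M" "v y \<le> M" "0 \<le> M" using av_nonneg[OF xy(1)] by (auto simp: M_def)
  show "0 \<le> v (x + y)" using xy by (intro av_nonneg add_K)
  show "0 \<le> max (v x) (v y)" using M by (simp add: M_def)
  fix k :: nat assume "k \<ge> 1"
  have "v (x + y) ^ k = v ((x + y) ^ k)" using xy by (simp add: av_power add_K)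
  also have "(x + y) ^ k = (\<Sum>i\<le>k. of_nat (k choose i) * x ^ i * y ^ (k - i))" by (rule binomial_ring)
  also have "v \<dots> \<le> (\<Sum>i\<le>k. v (of_nat (k choose i) * x ^ i * y ^ (k - i)))"
    using xy by (intro av_sum mult_K of_nat_K power_K)
  also have "\<dots> \<le> (\<Sum>i\<le>k. M ^ k)"
  proof (rule sum_mono)
    fix i assume i: "i \<in> {..k}"
    have "v (of_nat (k choose i) * x ^ i * y ^ (k - i)) = v (of_nat (k choose i)) * (v x ^ i * v y ^ (k - i))"
      using xy by (simp add: av_mult av_power mult_K of_nat_K power_K)
    also have "\<dots> \<le> 1 * (M ^ i * M ^ (k - i))"
      using nat av_nonneg xy M of_nat_K by (intro mult_mono power_mono mult_nonneg_nonneg zero_le_power) auto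
    also have "\<dots> = M ^ k" using i by (simp add: power_add[symmetric])
    finally show "v (of_nat (k choose i) * x ^ i * y ^ (k - i)) \<le> M ^ k" .
  qed
  also have "\<dots> = (real k + 1) * M ^ k" by simp
  also have "\<dots> \<le> 3 * (real (k * 1 + 1))\<^sup>2 * M ^ k"
  proof (rule mult_right_mono)
    have "real k + 1 \<le> (real k + 1)\<^sup>2" by (rule self_le_power) auto
    thus "real k + 1 \<le> 3 * (real (k * 1 + 1))\<^sup>2" by (simp add: add.commute)
  qed (use M in simp)
  finally show "v (x + y) ^ k \<le> 3 * (real (k * 1 + 1))\<^sup>2 * max (v x) (v y) ^ k" by (simp add: M_def)
qed

lemma (in abs_field) ultrametric_sum:
  assumes nat: "\<And>k::nat. v (of_nat k) \<le> 1" and f: "\<And>i. i \<in> S \<Longrightarrow> f i \<in> K" "\<And>i. i \<in> S \<Longrightarrow> v (f i) \<le> B" and B: "0 \<le> B"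
  shows "v (sum f S) \<le> B"
  using f
proof (induction S rule: infinite_finite_induct)
  case (insert x F)
  have "v (f x + sum f F) \<le> max (v (f x)) (v (sum f F))" using insert by (intro ultrametric nat sum_K) auto
  thus ?case using insert by fastforce
qed (use B in \<open>auto simp: av_zero\<close>)

section \<open>The product formula for \<open>K\<close>\<close>

context primitive_field
begin

lemma Z_algebraic: "Z \<subseteq> algebraic_numbers"
  using root_algebraic_number[OF g_nz] by (auto simp: Z_def)

lemma local_field_infinite: "local_field K \<theta> g UNIV cmod"
proof (intro local_field.intro local_field_axioms.intro)
  show "abs_field UNIV cmod"
  proof (intro abs_field.intro abs_field_axioms.intro complex_subfield_UNIV)
    show "absolute_value (nf_ring UNIV) cmod"
      unfolding absolute_value_def complex_subfield.nf_ring_simps[OF complex_subfield_UNIV]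
      by (simp add: norm_mult norm_triangle_ineq)
  qed
  show "\<exists>q. 1 < cmod (of_rat q)" by (rule exI[of _ 2]) simp
qed (auto intro: primitive_field_axioms)

lemma cmod_of_rat: "cmod (of_rat q) = \<bar>real_of_rat q\<bar>"
proof -
  have "complex_of_rat q = of_real (real_of_rat q)" by (cases q) (simp add: of_rat_rat)
  thus ?thesis by simp
qed

lemma infinite_places_local:
  assumes "x \<in> K"
  shows "finite (infinite_places K)" "v \<in> infinite_places K \<Longrightarrow> loc_degree K v > 0"
    "(\<Sum>v\<in>infinite_places K. real (loc_degree K v) * ln (v x)) = (\<Sum>z\<in>Z. ln (cmod (sg z x)))"
proof -
  interpret L: local_field K \<theta> g UNIV cmod by (rule local_field_infinite)
  have e: "infinite_places K = places_over K (\<lambda>q. cmod (of_rat q))" unfolding infinite_places_eq cmod_of_rat ..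
  show "finite (infinite_places K)" unfolding e by (rule L.finite_places_over)
  show "v \<in> infinite_places K \<Longrightarrow> loc_degree K v > 0" unfolding e by (rule L.places_over_degree_pos)
  show "(\<Sum>v\<in>infinite_places K. real (loc_degree K v) * ln (v x)) = (\<Sum>z\<in>Z. ln (cmod (sg z x)))"
    unfolding e using L.places_over_sum[OF assms] by (simp add: L.conj_abs_def)
qed

lemma local_field_finite:
  assumes p: "Factorial_Ring.prime p"
  shows "\<exists>w. local_field K \<theta> g algebraic_numbers w \<and> (\<forall>q. w (of_rat q) = padic_abs p q)"
proof -
  obtain w where w: "abs_field algebraic_numbers w" "\<And>q. w (of_rat q) = padic_abs p q" using padic_extension[OF p] by metis
  have "local_field K \<theta> g algebraic_numbers w"
  proof (intro local_field.intro local_field_axioms.intro primitive_field_axioms w Z_algebraic)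
    have "padic_abs p (1 / of_int (int p)) = real p powi (int (multiplicity (int p) (int p)) - int (multiplicity (int p) 1))"
      using padic_abs_divide[OF p, of 1 "int p"] prime_gt_0_nat[OF p] by simp
    also have "\<dots> = real p" using p by (simp add: multiplicity_self)
    finally show "\<exists>q. 1 < w (of_rat q)" using w(2) p_gt_1[OF p] by (intro exI[of _ "1 / of_int (int p)"]) simp
  qed
  thus ?thesis using w(2) by blast
qed

text \<open>Each prime has its own extension \<open>w\<close> and thus its own rational norm. All
  these norms are the same complex product of conjugates, so one \<open>r\<close> serves all
  places.\<close>

lemma norm_of_element:
  assumes x: "x \<in> K" "x \<noteq> 0"
  shows "\<exists>r. r \<noteq> 0 \<and> (\<Sum>v\<in>infinite_places K. real (loc_degree K v) * ln (v x)) = ln \<bar>real_of_rat r\<bar> \<and>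
    (\<forall>p. Factorial_Ring.prime p \<longrightarrow> (\<Sum>v\<in>places_over K (padic_abs p). real (loc_degree K v) * ln (v x)) = ln (padic_abs p r))"
proof -
  interpret L: local_field K \<theta> g UNIV cmod by (rule local_field_infinite)
  obtain r where r: "r \<noteq> 0" "of_rat r = (\<Prod>z\<in>Z. sg z x)" "(\<Sum>z\<in>Z. ln (L.conj_abs z x)) = ln (cmod (of_rat r))"
    using L.norm_rational[OF x] by metis
  have "(\<Sum>v\<in>places_over K (padic_abs p). real (loc_degree K v) * ln (v x)) = ln (padic_abs p r)"
    if p: "Factorial_Ring.prime p" for p
  proof -
    obtain w where w: "local_field K \<theta> g algebraic_numbers w" "\<And>q. w (of_rat q) = padic_abs p q"
      using local_field_finite[OF p] by blast
    interpret W: local_field K \<theta> g algebraic_numbers w by fact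
    obtain s where s: "of_rat s = (\<Prod>z\<in>Z. sg z x)" "(\<Sum>z\<in>Z. ln (W.conj_abs z x)) = ln (w (of_rat s))"
      using W.norm_rational[OF x] by metis
    have "s = r" using s(1) r(2) by (metis of_rat_eq_iff)
    thus ?thesis using W.places_over_sum[OF x(1)] s(2) by (simp add: w(2))
  qed
  thus ?thesis using r(1,3) infinite_places_local(3)[OF x(1)] by (auto simp: L.conj_abs_def cmod_of_rat)
qed

lemma finite_places_local:
  assumes "Factorial_Ring.prime p"
  shows "finite (places_over K (padic_abs p))" "v \<in> places_over K (padic_abs p) \<Longrightarrow> loc_degree K v > 0"
proof -
  obtain w where w: "local_field K \<theta> g algebraic_numbers w" "\<And>q. w (of_rat q) = padic_abs p q"
    using local_field_finite[OF assms] by blast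
  show "finite (places_over K (padic_abs p))" "v \<in> places_over K (padic_abs p) \<Longrightarrow> loc_degree K v > 0"
    using local_field.finite_places_over[OF w(1)] local_field.places_over_degree_pos[OF w(1), of v] by (simp_all add: w(2))
qed

lemma places_over_of_nat_le_1:
  assumes "Factorial_Ring.prime p" "v \<in> places_over K (padic_abs p)" shows "v (of_nat k) \<le> 1"
proof -
  have "v (of_rat (of_int (int k))) = padic_abs p (of_int (int k))" using assms(2) by (simp only: places_over_def mem_Collect_eq)
  thus ?thesis using padic_abs_int_le_1[OF assms(1), of "int k"] by simp
qed

text \<open>If \<open>p\<close> is in no denominator of the coefficients of the characteristic
  polynomial, then v x > 1 is impossible: the equation for x^n and the ultrametric inequality would
  bound (v x)^n by (v x)^(n-1).\<close>

lemma finite_primes_gt_1: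
  assumes x: "x \<in> K"
  shows "finite {p. Factorial_Ring.prime p \<and> (\<exists>v\<in>places_over K (padic_abs p). v x > 1)}"
proof -
  obtain c where c: "rp c = (\<Prod>z\<in>Z. [:- sg z x, 1:])" using characteristic_polynomial[OF x] by metis
  interpret L: local_field K \<theta> g UNIV cmod by (rule local_field_infinite)
  have e: "x ^ n = - (\<Sum>j<n. of_rat (poly.coeff c j) * x ^ j)"
    using L.char_poly_expand[OF c, of x] L.char_poly_root[OF x c] by (simp add: eq_neg_iff_add_eq_0 add.commute)
  have "{p. Factorial_Ring.prime p \<and> (\<exists>v\<in>places_over K (padic_abs p). v x > 1)}
    \<subseteq> (\<Union>j<n. {p. Factorial_Ring.prime p \<and> padic_abs p (poly.coeff c j) > 1})"
  proof
    fix p assume "p \<in> {p. Factorial_Ring.prime p \<and> (\<exists>v\<in>places_over K (padic_abs p). v x > 1)}"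
    then obtain v where p: "Factorial_Ring.prime p" and v: "v \<in> places_over K (padic_abs p)" "v x > 1" by blast
    interpret v: abs_field K v by (rule places_overD[OF v(1)])
    show "p \<in> (\<Union>j<n. {p. Factorial_Ring.prime p \<and> padic_abs p (poly.coeff c j) > 1})"
    proof (rule ccontr)
      assume no: "p \<notin> (\<Union>j<n. {p. Factorial_Ring.prime p \<and> padic_abs p (poly.coeff c j) > 1})"
      have SK: "of_rat (poly.coeff c j) * x ^ j \<in> K" for j using x by (intro mult_K of_rat_K power_K)
      have "v (\<Sum>j<n. of_rat (poly.coeff c j) * x ^ j) \<le> v x ^ (n - 1)"
      proof (rule v.ultrametric_sum)
        show "v (of_nat k) \<le> 1" for k by (rule places_over_of_nat_le_1[OF p v(1)])
        show "0 \<le> v x ^ (n - 1)" using v(2) by simp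
        fix j assume j: "j \<in> {..<n}"
        have "padic_abs p (poly.coeff c j) \<le> 1" using no j p by (force simp: not_less)
        moreover have "v (of_rat (poly.coeff c j)) = padic_abs p (poly.coeff c j)"
          using v(1) by (simp add: places_over_def)
        ultimately have "v (of_rat (poly.coeff c j)) \<le> 1" by simp
        hence "v (of_rat (poly.coeff c j)) * v x ^ j \<le> 1 * v x ^ j" using v(2) by (intro mult_right_mono) auto
        also have "\<dots> \<le> v x ^ (n - 1)" using j v(2) by (simp add: power_increasing)
        finally show "v (of_rat (poly.coeff c j) * x ^ j) \<le> v x ^ (n - 1)"
          using x by (simp add: v.av_mult v.av_power of_rat_K power_K)
      qed (rule SK)
      moreover have "v (\<Sum>j<n. of_rat (poly.coeff c j) * x ^ j) = v x ^ n"
      proof -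
        have "(\<Sum>j<n. of_rat (poly.coeff c j) * x ^ j) \<in> K" by (intro sum_K SK)
        from v.av_uminus[OF this] show ?thesis unfolding e[symmetric] v.av_power[OF x] by simp
      qed
      moreover have "v x ^ (n - 1) < v x ^ n" using v(2) n_pos by (intro power_strict_increasing) auto
      ultimately show False by simp
    qed
  qed
  thus ?thesis by (rule finite_subset) (intro finite_UN_I finite_lessThan finite_padic_abs_gt_1)
qed

lemma finite_primes_neq_1:
  assumes x: "x \<in> K" "x \<noteq> 0"
  shows "finite {p. Factorial_Ring.prime p \<and> (\<exists>v\<in>places_over K (padic_abs p). v x \<noteq> 1)}"
proof (rule finite_subset)
  show "{p. Factorial_Ring.prime p \<and> (\<exists>v\<in>places_over K (padic_abs p). v x \<noteq> 1)}
    \<subseteq> {p. Factorial_Ring.prime p \<and> (\<exists>v\<in>places_over K (padic_abs p). v x > 1)}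
    \<union> {p. Factorial_Ring.prime p \<and> (\<exists>v\<in>places_over K (padic_abs p). v (inverse x) > 1)}"
  proof safe
    fix p v assume p: "Factorial_Ring.prime p" and v: "v \<in> places_over K (padic_abs p)" "v x \<noteq> 1"
      and no: "\<not> (\<exists>v\<in>places_over K (padic_abs p). v (inverse x) > 1)"
    interpret v: abs_field K v by (rule places_overD[OF v(1)])
    have pos: "v x > 0" by (rule v.av_pos[OF x])
    have "\<not> inverse (v x) > 1" using no v(1) v.av_inverse[OF x(1)] by metis
    hence "v x \<ge> 1" using pos by (simp add: one_less_inverse_iff)
    thus "\<exists>v\<in>places_over K (padic_abs p). v x > 1" using v by (intro bexI[of _ v]) auto
  qed
  show "finite ({p. Factorial_Ring.prime p \<and> (\<exists>v\<in>places_over K (padic_abs p). v x > 1)}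
    \<union> {p. Factorial_Ring.prime p \<and> (\<exists>v\<in>places_over K (padic_abs p). v (inverse x) > 1)})"
    using finite_primes_gt_1[OF x(1)] finite_primes_gt_1[OF inverse_K[OF x(1)]] by simp
qed

theorem product_formula:
  assumes x: "x \<in> K" "x \<noteq> 0" and P: "finite P" "\<And>p. p \<in> P \<Longrightarrow> Factorial_Ring.prime p"
    "\<And>p v. Factorial_Ring.prime p \<Longrightarrow> v \<in> places_over K (padic_abs p) \<Longrightarrow> v x \<noteq> 1 \<Longrightarrow> p \<in> P"
  shows "(\<Sum>v\<in>infinite_places K. real (loc_degree K v) * ln (v x)) +
    (\<Sum>p\<in>P. \<Sum>v\<in>places_over K (padic_abs p). real (loc_degree K v) * ln (v x)) = 0"
proof -
  obtain r where r: "r \<noteq> 0" "(\<Sum>v\<in>infinite_places K. real (loc_degree K v) * ln (v x)) = ln \<bar>real_of_rat r\<bar>"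
    and "\<forall>p. Factorial_Ring.prime p \<longrightarrow> (\<Sum>v\<in>places_over K (padic_abs p). real (loc_degree K v) * ln (v x)) = ln (padic_abs p r)"
    using norm_of_element[OF x] by (elim exE conjE)
  note r = r(1,2) this(3)[rule_format]
  have "ln \<bar>real_of_rat r\<bar> + (\<Sum>p\<in>P. ln (padic_abs p r)) = 0"
  proof (rule rational_product_formula[OF r(1) P(1,2)])
    \<comment> \<open>For a prime outside \<open>P\<close> all local terms vanish, so the norm
      \<open>r\<close> is a unit there. Hence a set of primes that is complete for \<open>x\<close>
      is complete for \<open>r\<close>.\<close>
    fix p assume p: "Factorial_Ring.prime p" "padic_abs p r \<noteq> 1"
    show "p \<in> P"
    proof (rule ccontr)
      assume "p \<notin> P"
      hence "v x = 1" if "v \<in> places_over K (padic_abs p)" for v using P(3)[OF p(1) that] by metis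
      note this [simp]
      have "(\<Sum>v\<in>places_over K (padic_abs p). real (loc_degree K v) * ln (v x)) = 0" by (intro sum.neutral ballI) simp
      hence "ln (padic_abs p r) = 0" unfolding r(3)[OF p(1)] .
      thus False using p padic_abs_pos[OF p(1) r(1)] by simp
    qed
  qed
  thus ?thesis using r P(2) by simp
qed

end

subsection \<open>The fields \<open>\<Omega>\<^sub>v\<close>\<close>

text \<open>Shows that the choice in the definition is not vacuous. The closure contains a copy of
  the field, the absolute value is transported to it by \<open>the_inv_into\<close>, and the
  extension theorem does the rest.\<close>

lemma (in valued_field) alg_closure_abs:
  "absolute_value alg_closure (alg_closure_abs R v)"
  "x \<in> carrier R \<Longrightarrow> alg_closure_abs R v (indexed_const x) = v x"
proof -
  let ?F = "indexed_const ` carrier R" and ?f = "the_inv_into (carrier R) indexed_const"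
  interpret A: algebraic_closure alg_closure ?F by (rule alg_closureE)
  note hom = alg_closureE(2)
  have f: "?f (indexed_const x) = x" if "x \<in> carrier R" for x
    using the_inv_into_f_f[OF indexed_const_inj_on that] .
  have zero: "indexed_const \<zero> = \<zero>\<^bsub>alg_closure\<^esub>" by (rule ring_hom_zero[OF hom ring_axioms A.ring_axioms])
  have eq0: "indexed_const x = \<zero>\<^bsub>alg_closure\<^esub> \<longleftrightarrow> x = \<zero>" if "x \<in> carrier R" for x
    unfolding zero[symmetric] by (rule inj_on_eq_iff[OF indexed_const_inj_on that zero_closed])
  interpret E: value_extension alg_closure ?F "\<lambda>y. v (?f y)"
  proof (intro value_extension.intro value_extension_axioms.intro A.field_axioms A.subfield_axioms A.algebraic_extension)
    show "absolute_value (alg_closure\<lparr>carrier := ?F\<rparr>) (\<lambda>y. v (?f y))"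
      unfolding absolute_value_def
      by (auto simp: f eq0 v_nonneg v_eq_0 v_mult v_add ring_hom_mult[OF hom, symmetric] ring_hom_add[OF hom, symmetric])
  qed
  have "\<exists>w. absolute_value alg_closure w \<and> (\<forall>x\<in>carrier R. w (indexed_const x) = v x)"
    using E.absolute_value_extension by (auto simp: f)
  from someI_ex[OF this] show "absolute_value alg_closure (alg_closure_abs R v)"
    "x \<in> carrier R \<Longrightarrow> alg_closure_abs R v (indexed_const x) = v x"
    unfolding alg_closure_abs_def by blast+
qed

definition unit_values :: "complex set \<Rightarrow> (complex \<Rightarrow> real) \<Rightarrow> complex poly \<Rightarrow> real set" where
  "unit_values K v T = {Omega_norm K v (Omega_poly K v T z) |z. z \<in> carrier (Omega K v) \<and> Omega_norm K v z = 1}"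

lemma nu_eq: "nu K v T = elog (Sup (unit_values K v T))"
  by (simp add: nu_def unit_values_def)

context abs_field
begin

abbreviation "Cv \<equiv> field.alg_closure Kv"
abbreviation "uv \<equiv> alg_closure_abs Kv (loc_field_abs K v)"
abbreviation "hv x \<equiv> ring.indexed_const Kv (completion_embed (nf_ring K) v x)"
abbreviation "ov \<equiv> completion_embed Cv uv"

lemma valued_field_Kv: "valued_field Kv (loc_field_abs K v)"
  unfolding loc_field_def loc_field_abs_def by (rule VF.valued_field_completion)

lemma valued_field_Cv: "valued_field Cv uv"
proof -
  interpret V: valued_field Kv "loc_field_abs K v" by (rule valued_field_Kv)
  interpret A: algebraic_closure Cv "V.indexed_const ` carrier Kv" by (rule V.alg_closureE)
  show ?thesis by (intro valued_field.intro valued_field_axioms.intro A.field_axioms V.alg_closure_abs)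
qed

lemma algebraically_closed_Cv: "algebraically_closed Cv"
proof -
  interpret V: valued_field Kv "loc_field_abs K v" by (rule valued_field_Kv)
  interpret A: algebraic_closure Cv "V.indexed_const ` carrier Kv" by (rule V.alg_closureE)
  show ?thesis by (rule A.algebraically_closed_axioms)
qed

lemma hv_hom: "(\<lambda>x. hv x) \<in> Ring.ring_hom (nf_ring K) Cv"
proof -
  have "completion_embed (nf_ring K) v \<in> Ring.ring_hom (nf_ring K) Kv" unfolding loc_field_def by (rule VF.completion_embed_hom)
  from ring_hom_trans[OF this field.alg_closureE(2)[OF field_Kv]] show ?thesis by (simp add: comp_def)
qed

lemma uv_hv:
  assumes "x \<in> K" shows "uv (hv x) = v x"
proof -
  have x: "x \<in> carrier (nf_ring K)" using assms by (simp add: nf_ring_simps)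
  have "completion_embed (nf_ring K) v x \<in> carrier Kv"
    unfolding loc_field_def by (rule ring_hom_closed[OF VF.completion_embed_hom x])
  hence "uv (hv x) = loc_field_abs K v (completion_embed (nf_ring K) v x)"
    by (rule valued_field.alg_closure_abs(2)[OF valued_field_Kv])
  also have "\<dots> = v x" unfolding loc_field_abs_def by (rule VF.completion_abs_embed[OF x])
  finally show ?thesis .
qed

interpretation PE: poly_evaluation Cv uv K "\<lambda>x. hv x"
  by (intro poly_evaluation.intro poly_evaluation_axioms.intro valued_field_Cv complex_subfield_axioms hv_hom)

lemma Omega_eq: "Omega K v = completion Cv uv" by (simp add: Omega_def)

interpretation OM: valued_field "Omega K v" "completion_abs Cv uv"
  unfolding Omega_eq by (rule PE.valued_field_completion)

lemma ov_hom: "ov \<in> Ring.ring_hom Cv (Omega K v)"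
  unfolding Omega_eq by (rule PE.completion_embed_hom)

text \<open>At points coming from the algebraic closure, evaluation can be done before passing to
  the completion. So the supremum defining \<open>nu\<close> also bounds the values on the unit
  circle of the closure.\<close>

lemma Omega_poly_ov:
  assumes P: "P \<in> polys" and z: "z \<in> carrier Cv"
  shows "Omega_poly K v P (ov z) = ov (PE.ev P z)"
proof -
  let ?b = "\<lambda>i. hv (poly.coeff P i)"
  have b: "?b i \<in> carrier Cv" for i using P PE.h_closed by (simp add: polys_def)
  note oc = ring_hom_closed[OF ov_hom]
  have pow: "ov (z [^]\<^bsub>Cv\<^esub> i) = ov z [^]\<^bsub>Omega K v\<^esub> i" for i :: nat
    by (induction i) (use z in \<open>simp_all add: ring_hom_one[OF ov_hom] ring_hom_mult[OF ov_hom]\<close>)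
  have "ov (PE.psum ?b n z) = (\<Oplus>\<^bsub>Omega K v\<^esub>i\<in>{..<n}. ov (?b i) \<otimes>\<^bsub>Omega K v\<^esub> (ov z [^]\<^bsub>Omega K v\<^esub> i))" for n
  proof (induction n)
    case 0 show ?case using ring_hom_zero[OF ov_hom PE.ring_axioms OM.ring_axioms] by simp
  next
    case (Suc n)
    have "ov (PE.psum ?b (Suc n) z) = ov (PE.psum ?b n z) \<oplus>\<^bsub>Omega K v\<^esub> (ov (?b n) \<otimes>\<^bsub>Omega K v\<^esub> (ov z [^]\<^bsub>Omega K v\<^esub> n))"
      using b z PE.psum_closed[of ?b z n] by (simp add: ring_hom_add[OF ov_hom] ring_hom_mult[OF ov_hom] pow)
    also have "\<dots> = (\<Oplus>\<^bsub>Omega K v\<^esub>i\<in>{..<Suc n}. ov (?b i) \<otimes>\<^bsub>Omega K v\<^esub> (ov z [^]\<^bsub>Omega K v\<^esub> i))"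
      unfolding Suc lessThan_Suc using b z
      by (subst OM.finsum_insert) (auto simp: oc intro!: OM.a_comm OM.finsum_closed)
    finally show ?case .
  qed
  from this[of "Suc (Polynomial.degree P)"] show ?thesis
    unfolding PE.ev_def Omega_poly_def Omega_embed_def lessThan_Suc_atMost by (rule sym)
qed

context
  assumes weight: "weight K v > 0"
begin

lemma Omega_norm_one_iff:
  assumes "z \<in> carrier (Omega K v)" shows "Omega_norm K v z = 1 \<longleftrightarrow> completion_abs Cv uv z = 1"
proof -
  have "a = 1" if "a powr weight K v = 1" "a \<ge> 0" for a :: real
    using that weight powr_eq_one_iff_gen[of a "weight K v"] by (cases "a = 0") auto
  thus ?thesis unfolding Omega_norm_def using OM.v_nonneg[OF assms] by auto
qed

text \<open>Needed because \<open>Sup\<close> of reals is an upper bound only for bounded sets. On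
  the unit circle the sum of the sizes of the coefficients is a bound.\<close>

lemma bdd_above_unit_values:
  assumes P: "P \<in> polys" shows "bdd_above (unit_values K v P)"
proof (rule bdd_aboveI)
  fix y assume "y \<in> unit_values K v P"
  then obtain z where z: "z \<in> carrier (Omega K v)" "Omega_norm K v z = 1" "y = Omega_norm K v (Omega_poly K v P z)"
    by (auto simp: unit_values_def)
  have z1: "completion_abs Cv uv z = 1" using Omega_norm_one_iff z by simp
  let ?c = "\<lambda>i. Omega_embed K v (poly.coeff P i)"
  have c: "?c i \<in> carrier (Omega K v)" for i
    unfolding Omega_embed_def using P PE.h_closed ring_hom_closed[OF ov_hom] by (simp add: polys_def)
  have "completion_abs Cv uv (Omega_poly K v P z)
    \<le> (\<Sum>i\<le>Polynomial.degree P. completion_abs Cv uv (?c i \<otimes>\<^bsub>Omega K v\<^esub> (z [^]\<^bsub>Omega K v\<^esub> i)))"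
    unfolding Omega_poly_def using c z by (intro OM.v_finsum_le) simp
  also have "\<dots> = (\<Sum>i\<le>Polynomial.degree P. completion_abs Cv uv (?c i))"
    using c z by (intro sum.cong) (simp_all add: OM.v_mult OM.v_pow z1)
  finally have le: "completion_abs Cv uv (Omega_poly K v P z) \<le> (\<Sum>i\<le>Polynomial.degree P. completion_abs Cv uv (?c i))" .
  have "Omega_poly K v P z \<in> carrier (Omega K v)"
    unfolding Omega_poly_def using c z by (intro OM.finsum_closed) simp
  hence "0 \<le> completion_abs Cv uv (Omega_poly K v P z)" by (rule OM.v_nonneg)
  thus "y \<le> (\<Sum>i\<le>Polynomial.degree P. completion_abs Cv uv (?c i)) powr weight K v"
    unfolding z(3) Omega_norm_def using le weight by (intro powr_mono2) auto
qed

lemma unit_value_le_Sup: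
  assumes P: "P \<in> polys" and z: "z \<in> carrier Cv" "uv z = 1"
  shows "uv (PE.ev P z) powr weight K v \<le> Sup (unit_values K v P)"
proof (rule cSup_upper[OF _ bdd_above_unit_values[OF P]])
  have a: "completion_abs Cv uv (ov y) = uv y" if "y \<in> carrier Cv" for y by (rule PE.completion_abs_embed[OF that])
  have "uv (PE.ev P z) powr weight K v = Omega_norm K v (Omega_poly K v P (ov z))"
    unfolding Omega_poly_ov[OF P z(1)] Omega_norm_def a[OF PE.ev_closed[OF P z(1)]] ..
  moreover have "Omega_norm K v (ov z) = 1" "ov z \<in> carrier (Omega K v)"
    using z ring_hom_closed[OF ov_hom] by (simp_all add: Omega_norm_def a)
  ultimately show "uv (PE.ev P z) powr weight K v \<in> unit_values K v P" unfolding unit_values_def by blast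
qed

lemma Sup_unit_values_nonneg: "P \<in> polys \<Longrightarrow> 0 \<le> Sup (unit_values K v P)"
  using unit_value_le_Sup[of P "\<one>\<^bsub>Cv\<^esub>"] PE.v_one by (meson PE.one_closed order_trans powr_ge_zero)

text \<open>\<open>maximum_principle\<close> concerns the unnormalised absolute value of the
  algebraic closure. The supremum \<open>S\<close> enters it as S^(1/k), where \<open>k\<close> is
  the weight, and raising the result to the power \<open>k\<close> restores the normalisation, which
  commutes with max 1.\<close>

theorem norm_at_poly_le:
  assumes v23: "v 2 \<ge> 1 \<or> v 3 \<ge> 1" and P: "P \<in> polys" and x: "x \<in> K"
  shows "norm_at K v (poly P x) \<le> Sup (unit_values K v P) * max 1 (norm_at K v x) ^ Polynomial.degree P"
proof -
  define S where "S = Sup (unit_values K v P)"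
  define k where "k = weight K v"
  have k: "k > 0" using weight by (simp add: k_def)
  have S: "S \<ge> 0" using Sup_unit_values_nonneg[OF P] by (simp add: S_def)
  have "\<one>\<^bsub>Cv\<^esub> \<oplus>\<^bsub>Cv\<^esub> \<one>\<^bsub>Cv\<^esub> = hv (1 + 1)" unfolding PE.h_add[OF one_K one_K] PE.h_one ..
  moreover have "\<one>\<^bsub>Cv\<^esub> \<oplus>\<^bsub>Cv\<^esub> \<one>\<^bsub>Cv\<^esub> \<oplus>\<^bsub>Cv\<^esub> \<one>\<^bsub>Cv\<^esub> = hv (1 + 1 + 1)"
    unfolding PE.h_add[OF one_K one_K] PE.h_add[OF add_K[OF one_K one_K] one_K] PE.h_one ..
  ultimately have "uv (\<one>\<^bsub>Cv\<^esub> \<oplus>\<^bsub>Cv\<^esub> \<one>\<^bsub>Cv\<^esub>) = v 2" "uv (\<one>\<^bsub>Cv\<^esub> \<oplus>\<^bsub>Cv\<^esub> \<one>\<^bsub>Cv\<^esub> \<oplus>\<^bsub>Cv\<^esub> \<one>\<^bsub>Cv\<^esub>) = v 3"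
    using uv_hv[OF add_K[OF one_K one_K]] uv_hv[OF add_K[OF add_K[OF one_K one_K] one_K]] by simp_all
  hence ub: PE.unit_bounded using v23 by (intro PE.unit_boundedI algebraically_closed_Cv) simp
  have "uv (PE.ev P (hv x)) \<le> S powr (1 / k) * max 1 (uv (hv x)) ^ Polynomial.degree P"
  proof (rule PE.maximum_principle[OF ub P PE.h_closed[OF x]])
    fix z assume z: "z \<in> carrier Cv" "uv z = 1"
    have "uv (PE.ev P z) = (uv (PE.ev P z) powr k) powr (1 / k)"
      using k PE.v_nonneg[OF PE.ev_closed[OF P z(1)]] by (simp add: powr_powr)
    also have "\<dots> \<le> S powr (1 / k)"
      using unit_value_le_Sup[OF P z] k by (intro powr_mono2) (auto simp: S_def k_def)
    finally show "uv (PE.ev P z) \<le> S powr (1 / k)" .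
  qed
  moreover have "PE.ev P (hv x) = hv (poly P x)" by (rule PE.ev_h[OF P x])
  ultimately have le: "v (poly P x) \<le> S powr (1 / k) * max 1 (v x) ^ Polynomial.degree P"
    using uv_hv[OF x] uv_hv[OF poly_K[OF P x]] by simp
  have "norm_at K v (poly P x) \<le> (S powr (1 / k) * max 1 (v x) ^ Polynomial.degree P) powr k"
    unfolding norm_at_def k_def[symmetric] using le k av_nonneg[OF poly_K[OF P x]] by (intro powr_mono2) auto
  also have "\<dots> = S * (max 1 (v x) powr k) ^ Polynomial.degree P"
    using k S by (simp add: powr_mult powr_powr flip: powr_realpow) (simp add: powr_powr mult.commute)
  also have "max 1 (v x) powr k = max 1 (norm_at K v x)"
  proof (cases "v x \<le> 1")
    case True
    hence "v x powr k \<le> 1 powr k" using av_nonneg[OF x] k by (intro powr_mono2) auto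
    thus ?thesis using True by (simp add: norm_at_def k_def)
  next
    case False
    hence "1 powr k \<le> v x powr k" using k by (intro powr_mono2) auto
    thus ?thesis using False by (simp add: norm_at_def k_def)
  qed
  finally show ?thesis by (simp add: S_def)
qed

end

end

subsection \<open>The height inequality\<close>

context abs_field
begin

lemma norm_at_pos: "x \<in> K \<Longrightarrow> x \<noteq> 0 \<Longrightarrow> 0 < norm_at K v x"
  using av_pos[of x] by (simp add: norm_at_def)

lemma ln_norm_at: "x \<in> K \<Longrightarrow> x \<noteq> 0 \<Longrightarrow> ln (norm_at K v x) = weight K v * ln (v x)"
  using av_pos[of x] by (simp add: norm_at_def ln_powr)

text \<open>A nonzero value at \<open>x\<close> forces a positive supremum, so the real logarithm
  agrees with \<open>elog\<close>. The bound \<open>d\<close> replaces the exact degree because the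
  polynomial T - f may have smaller degree than \<open>T\<close>.\<close>

lemma ln_norm_at_poly_le:
  assumes weight: "weight K v > 0" and v23: "v 2 \<ge> 1 \<or> v 3 \<ge> 1"
    and P: "P \<in> polys" "Polynomial.degree P \<le> d" and x: "x \<in> K" "poly P x \<noteq> 0"
  shows "0 < Sup (unit_values K v P)"
    and "ln (norm_at K v (poly P x)) \<le> ln (Sup (unit_values K v P)) + real d * max 0 (ln (norm_at K v x))"
proof -
  let ?S = "Sup (unit_values K v P)" and ?M = "max 1 (norm_at K v x)"
  have pos: "0 < norm_at K v (poly P x)" by (rule norm_at_pos[OF poly_K[OF P(1) x(1)] x(2)])
  have le: "norm_at K v (poly P x) \<le> ?S * ?M ^ Polynomial.degree P"
    by (rule norm_at_poly_le[OF weight v23 P(1) x(1)])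
  have "?S \<noteq> 0" using pos le by auto
  thus S: "0 < ?S" using Sup_unit_values_nonneg[OF weight P(1)] by simp
  have "norm_at K v (poly P x) \<le> ?S * ?M ^ d"
    by (rule order_trans[OF le]) (use P(2) S in \<open>intro mult_left_mono power_increasing; simp\<close>)
  hence "ln (norm_at K v (poly P x)) \<le> ln (?S * ?M ^ d)" using pos by (intro ln_mono) auto
  also have "\<dots> = ln ?S + real d * ln ?M" using S by (simp add: ln_mult ln_realpow)
  also have "ln ?M = max 0 (ln (norm_at K v x))"
  proof (cases "norm_at K v x \<le> 1")
    case True
    moreover have "0 \<le> norm_at K v x" by (simp add: norm_at_def)
    ultimately have "ln (norm_at K v x) \<le> 0" by (cases "norm_at K v x = 0") (auto simp: ln_le_zero_iff)
    thus ?thesis using True by simp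
  qed simp
  finally show "ln (norm_at K v (poly P x)) \<le> ln ?S + real d * max 0 (ln (norm_at K v x))" .
qed

text \<open>The ultrametric inequality for 1 = 3 + (-2).\<close>

lemma ultrametric_2_or_3:
  assumes "\<And>k::nat. v (of_nat k) \<le> 1" shows "v 2 \<ge> 1 \<or> v 3 \<ge> 1"
proof -
  have m: "-2 \<in> K" "3 \<in> K" "2 \<in> K" using uminus_K[OF of_nat_K[of 2]] of_nat_K[of 3] of_nat_K[of 2] by simp_all
  have "v (3 + (-2)) \<le> max (v 3) (v (-2))" by (rule ultrametric[OF assms m(2,1)])
  thus ?thesis using av_one av_uminus[OF m(3)] by auto
qed

end

context primitive_field
begin

text \<open>With weight 0 every nonzero number would have normalised size 1, and the exponent
  1/weight could not undo the normalisation.\<close>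

lemma weight_pos: "loc_degree K v > 0 \<Longrightarrow> weight K v > 0"
  using n_pos by (simp add: weight_def nf_degree_eq)

lemma abs_field_infinite: "v \<in> infinite_places K \<Longrightarrow> abs_field K v"
  unfolding infinite_places_eq by (rule places_overD)

lemma infinite_place_le:
  assumes v: "v \<in> infinite_places K" and P: "P \<in> polys" and x: "x \<in> K" "poly P x \<noteq> 0"
  shows "nu K v P = ereal (ln (Sup (unit_values K v P)))"
    and "ln (norm_at K v (poly P x))
      \<le> ln (Sup (unit_values K v P)) + real (Polynomial.degree P) * max 0 (ln (norm_at K v x))"
proof -
  interpret v: abs_field K v by (rule abs_field_infinite[OF v])
  have w: "weight K v > 0" by (rule weight_pos[OF infinite_places_local(2)[OF x(1) v]])
  have "v (of_rat 2) = \<bar>of_rat 2\<bar>" using v unfolding infinite_places_def by blast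
  hence "v 2 \<ge> 1 \<or> v 3 \<ge> 1" by simp
  note le = v.ln_norm_at_poly_le[OF w this P order_refl x]
  show "nu K v P = ereal (ln (Sup (unit_values K v P)))" unfolding nu_eq elog_def using le(1) by simp
  show "ln (norm_at K v (poly P x))
      \<le> ln (Sup (unit_values K v P)) + real (Polynomial.degree P) * max 0 (ln (norm_at K v x))" by (rule le(2))
qed

lemma finite_place_le:
  assumes p: "Factorial_Ring.prime p" and v: "v \<in> places_over K (padic_abs p)"
    and P: "P \<in> polys" "Polynomial.degree P \<le> d" and x: "x \<in> K" "poly P x \<noteq> 0"
    and m: "m \<in> K" "m \<noteq> 0" and nu: "nu K v P \<le> elog (norm_at K v m)"
  shows "ln (norm_at K v (poly P x)) \<le> ln (norm_at K v m) + real d * max 0 (ln (norm_at K v x))"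
proof -
  interpret v: abs_field K v by (rule places_overD[OF v])
  have w: "weight K v > 0" by (rule weight_pos[OF finite_places_local(2)[OF p v]])
  have "v 2 \<ge> 1 \<or> v 3 \<ge> 1" by (rule v.ultrametric_2_or_3, rule places_over_of_nat_le_1[OF p v])
  note le = v.ln_norm_at_poly_le[OF w this P x]
  have "ln (Sup (unit_values K v P)) \<le> ln (norm_at K v m)"
    using nu le(1) v.norm_at_pos[OF m] unfolding nu_eq elog_def by simp
  thus ?thesis using le(2) by simp
qed

lemma norm_at_product_formula:
  assumes x: "x \<in> K" "x \<noteq> 0" and P: "finite P" "\<And>p. p \<in> P \<Longrightarrow> Factorial_Ring.prime p"
    "\<And>p v. Factorial_Ring.prime p \<Longrightarrow> v \<in> places_over K (padic_abs p) \<Longrightarrow> v x \<noteq> 1 \<Longrightarrow> p \<in> P"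
  shows "(\<Sum>v\<in>infinite_places K. ln (norm_at K v x)) + (\<Sum>p\<in>P. \<Sum>v\<in>places_over K (padic_abs p). ln (norm_at K v x)) = 0"
proof -
  have e: "ln (norm_at K v x) = real (loc_degree K v) * ln (v x) / real n" if "abs_field K v" for v
    using abs_field.ln_norm_at[OF that x] by (simp add: weight_def nf_degree_eq)
  have "(\<Sum>v\<in>infinite_places K. ln (norm_at K v x)) = (\<Sum>v\<in>infinite_places K. real (loc_degree K v) * ln (v x)) / real n"
    unfolding sum_divide_distrib by (intro sum.cong refl e abs_field_infinite)
  moreover have "(\<Sum>p\<in>P. \<Sum>v\<in>places_over K (padic_abs p). ln (norm_at K v x))
    = (\<Sum>p\<in>P. \<Sum>v\<in>places_over K (padic_abs p). real (loc_degree K v) * ln (v x)) / real n"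
    unfolding sum_divide_distrib by (intro sum.cong refl e places_overD)
  ultimately show ?thesis using product_formula[OF x P] by (simp add: add_divide_distrib[symmetric])
qed

text \<open>The rational number 1/p has size \<open>p\<close> for the p-adic absolute value and size
  1 for the q-adic one.\<close>

lemma places_over_disjoint:
  assumes "Factorial_Ring.prime p" "Factorial_Ring.prime q" "p \<noteq> q"
  shows "places_over K (padic_abs p) \<inter> places_over K (padic_abs q) = {}"
proof (rule ccontr)
  assume "places_over K (padic_abs p) \<inter> places_over K (padic_abs q) \<noteq> {}"
  then obtain v where v: "v \<in> places_over K (padic_abs p)" "v \<in> places_over K (padic_abs q)" by blast
  define r :: rat where "r = 1 / of_int (int p)"
  have "v (of_rat r) = padic_abs p r" "v (of_rat r) = padic_abs q r"
    using v unfolding places_over_def by blast+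
  hence "padic_abs p (1 / of_int (int p)) = padic_abs q (1 / of_int (int p))" unfolding r_def by simp
  thus False using assms padic_abs_divide[OF assms(1), of 1 "int p"] padic_abs_divide[OF assms(2), of 1 "int p"]
      prime_gt_1_nat[OF assms(1)] by (simp add: multiplicity_self prime_multiplicity_other)
qed

lemma infinite_places_disjoint:
  assumes "Factorial_Ring.prime p" shows "infinite_places K \<inter> places_over K (padic_abs p) = {}"
proof (rule ccontr)
  assume "infinite_places K \<inter> places_over K (padic_abs p) \<noteq> {}"
  then obtain v where v: "v \<in> infinite_places K" "v \<in> places_over K (padic_abs p)" by blast
  have "v (of_rat 2) = \<bar>of_rat 2\<bar>" using v(1) unfolding infinite_places_def by blast
  thus False using places_over_of_nat_le_1[OF assms v(2), of 2] by simp
qed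

text \<open>Reduces the infinite sum to the finitely many places that matter, grouped by primes. At
  x = 0 every summand is 0 because \<open>ln 0 = 0\<close>, so the condition on \<open>P\<close> is
  imposed only for nonzero \<open>x\<close>.\<close>

lemma weil_height_eq:
  assumes x: "x \<in> K" and P: "finite P" "\<And>p. p \<in> P \<Longrightarrow> Factorial_Ring.prime p"
    "\<And>p v. x \<noteq> 0 \<Longrightarrow> Factorial_Ring.prime p \<Longrightarrow> v \<in> places_over K (padic_abs p) \<Longrightarrow> v x \<noteq> 1 \<Longrightarrow> p \<in> P"
  shows "weil_height K x = (\<Sum>v\<in>infinite_places K. max 0 (ln (norm_at K v x))) +
    (\<Sum>p\<in>P. \<Sum>v\<in>places_over K (padic_abs p). max 0 (ln (norm_at K v x)))"
proof -
  let ?f = "\<lambda>v. max 0 (ln (norm_at K v x))"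
  let ?F = "\<Union>p\<in>P. places_over K (padic_abs p)" and ?B = "infinite_places K \<union> (\<Union>p\<in>P. places_over K (padic_abs p))"
  have finI: "finite (infinite_places K)" by (rule infinite_places_local(1)[OF x])
  have finp: "finite (places_over K (padic_abs p))" if "p \<in> P" for p by (rule finite_places_local(1)[OF P(2)[OF that]])
  have fin: "finite ?F" using P(1) finp by blast
  have zero: "?f v = 0" if "v \<in> places K - ?B" for v
  proof -
    from that obtain p where p: "Factorial_Ring.prime p" "v \<in> places_over K (padic_abs p)" "p \<notin> P"
      by (auto simp: places_def finite_places_eq)
    show ?thesis
    proof (cases "x = 0")
      case True thus ?thesis using abs_field.av_zero[OF places_overD[OF p(2)]] by (simp add: norm_at_def)
    next
      case False
      hence "v x = 1" using P(3) p by blast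
      thus ?thesis by (simp add: norm_at_def)
    qed
  qed
  have "weil_height K x = infsum ?f ?B"
    unfolding weil_height_def
  proof (rule infsum_cong_neutral)
    show "?f v = 0" if "v \<in> ?B - places K" for v
      using that P(2) by (auto simp: places_def finite_places_eq)
  qed (use zero in auto)
  also have "\<dots> = sum ?f ?B" using finI fin by (intro infsum_finite) simp
  also have "\<dots> = sum ?f (infinite_places K) + sum ?f ?F"
  proof (intro sum.union_disjoint finI fin)
    show "infinite_places K \<inter> ?F = {}" unfolding Int_UN_distrib using infinite_places_disjoint[OF P(2)] by simp
  qed
  also have "sum ?f ?F = (\<Sum>p\<in>P. sum ?f (places_over K (padic_abs p)))"
    by (intro sum.UNION_disjoint P(1) ballI impI finp places_over_disjoint P(2))
  finally show ?thesis .
qed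

lemma height_lower_bound:
  assumes m: "m \<in> K" "m \<noteq> 0" and f: "f \<in> polys" and T: "T \<in> polys"
    and deg: "Polynomial.degree f = Polynomial.degree T" and cong: "poly_cong K f T m"
    and x: "x \<in> K" "poly f x = 0" "poly T x \<noteq> 0"
  shows "ereal (log_norm K m) - nu_infinity K T \<le> ereal (real (Polynomial.degree T) * weil_height K x)"
proof -
  define d b where "d = Polynomial.degree T" and "b = poly T x"
  have b: "b \<in> K" "b \<noteq> 0" using poly_K[OF T x(1)] x(3) by (simp_all add: b_def)
  \<comment> \<open>One finite set of primes for both product formulas and for the height. The point
    \<open>x\<close> may be 0, and 0 is removed because it has size 0 rather than 1 at every
    place.\<close>
  define P where "P = (\<Union>y\<in>{b, m, x} - {0}. {p. Factorial_Ring.prime p \<and> (\<exists>v\<in>places_over K (padic_abs p). v y \<noteq> 1)})"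
  have fin: "finite P" unfolding P_def using b m x by (intro finite_UN_I finite_primes_neq_1) auto
  have prime: "Factorial_Ring.prime p" if "p \<in> P" for p using that by (auto simp: P_def)
  have mem: "p \<in> P" if "y \<in> {b, m, x}" "y \<noteq> 0" "Factorial_Ring.prime p" "v \<in> places_over K (padic_abs p)" "v y \<noteq> 1" for y p v
    unfolding P_def using that by blast
  let ?I = "infinite_places K" and ?F = "\<lambda>p. places_over K (padic_abs p)"
  let ?l = "\<lambda>v y. ln (norm_at K v y)" and ?h = "\<lambda>v. max 0 (ln (norm_at K v x))"
  let ?S = "\<lambda>v. ln (Sup (unit_values K v T))"
  have pb: "(\<Sum>v\<in>?I. ?l v b) + (\<Sum>p\<in>P. \<Sum>v\<in>?F p. ?l v b) = 0"
    by (rule norm_at_product_formula[OF b fin prime mem[of b, OF _ b(2)]]) simp_all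
  have pm: "(\<Sum>v\<in>?I. ?l v m) + (\<Sum>p\<in>P. \<Sum>v\<in>?F p. ?l v m) = 0"
    by (rule norm_at_product_formula[OF m fin prime mem[of m, OF _ m(2)]]) simp_all
  have h: "weil_height K x = (\<Sum>v\<in>?I. ?h v) + (\<Sum>p\<in>P. \<Sum>v\<in>?F p. ?h v)"
    by (rule weil_height_eq[OF x(1) fin prime mem[of x]]) simp_all
  have "(\<Sum>v\<in>?I. ?l v b) \<le> (\<Sum>v\<in>?I. ?S v + real d * ?h v)"
    unfolding b_def d_def by (intro sum_mono infinite_place_le(2) T x)
  hence I: "(\<Sum>v\<in>?I. ?l v b) \<le> (\<Sum>v\<in>?I. ?S v) + real d * (\<Sum>v\<in>?I. ?h v)"
    by (simp add: sum.distrib sum_distrib_left)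
  have "(\<Sum>p\<in>P. \<Sum>v\<in>?F p. ?l v b) \<le> (\<Sum>p\<in>P. \<Sum>v\<in>?F p. ?l v m + real d * ?h v)"
  proof (intro sum_mono)
    fix p v assume p: "p \<in> P" and v: "v \<in> ?F p"
    have b': "b = poly (T - f) x" using x(2) by (simp add: b_def)
    have "v \<in> finite_places K" using prime[OF p] v by (auto simp: finite_places_eq)
    hence "nu K v (T - f) \<le> elog (norm_at K v m)" using cong by (simp add: poly_cong_def)
    thus "?l v b \<le> ?l v m + real d * ?h v"
      using deg b(2) unfolding b'
      by (intro finite_place_le[OF prime[OF p] v] polys_diff T f x(1) m) (auto simp: d_def intro: degree_diff_le)
  qed
  hence F: "(\<Sum>p\<in>P. \<Sum>v\<in>?F p. ?l v b) \<le> (\<Sum>p\<in>P. \<Sum>v\<in>?F p. ?l v m) + real d * (\<Sum>p\<in>P. \<Sum>v\<in>?F p. ?h v)"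
    by (simp add: sum.distrib sum_distrib_left)
  \<comment> \<open>All summands are finite because T(x) is nonzero, so the subtraction in
    \<open>ereal\<close> is an ordinary one of reals.\<close>
  have "nu_infinity K T = (\<Sum>v\<in>?I. ereal (?S v))"
    unfolding nu_infinity_def by (intro sum.cong refl infinite_place_le(1)[OF _ T x(1,3)])
  hence nu: "nu_infinity K T = ereal (\<Sum>v\<in>?I. ?S v)" by simp
  have "log_norm K m - (\<Sum>v\<in>?I. ?S v) \<le> real d * weil_height K x"
    using I F pb pm unfolding h log_norm_def distrib_left by linarith
  thus ?thesis by (simp add: nu d_def)
qed

end

theorem theorem5p1:
  fixes K :: "complex set" and m \<alpha> :: complex and f T :: "complex poly"
  assumes "number_field K"
    and "m \<in> K" and "m \<noteq> 0"
    and "\<forall>i. poly.coeff f i \<in> K" and "\<forall>i. poly.coeff T i \<in> K"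
    and "Polynomial.degree f = Polynomial.degree T"
    and "poly_cong K f T m"
    and "\<alpha> \<in> K" and "poly f \<alpha> = 0" and "poly T \<alpha> \<noteq> 0"
  shows "ereal (real (Polynomial.degree T) * weil_height K \<alpha>)
           \<ge> ereal (log_norm K m) - nu_infinity K T"
proof -
  obtain c g where "primitive_field K c g" by (rule primitive_field_exists[OF assms(1)])
  then interpret primitive_field K c g .
  have "f \<in> polys" "T \<in> polys" using assms(4,5) by (simp_all add: polys_def)
  thus ?thesis using height_lower_bound assms(2,3,6-10) by simp
qed

end
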